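(* Let $p,q$ be positive integers. (1) For every $1\le c\le\min\{p,q\}$, there are exactly $$2c\binom{2p}{p-c}\binom{2q}{q-c}$$ partitions in $NC^{(B)}(p,q)$ that have connectivity equal to $c$. (2) There are exactly $$\binom{2p}{p}\binom{2q}{q}$$ partitions in $NC^{(B)}(p,q)$ that have connectivity equal to $0$. (3) The total number of partitions in $NC^{(B)}(p,q)$ is $$\left|NC^{(B)}(p,q)\right| = \frac{p+q+pq}{p+q}\cdot\binom{2p}{p}\binom{2q}{q}.$$
   Context: Let $p,q$ be positive integers and $N = p+q$. The hyperoctahedral group $B_N$ is the group of permutations $\tau$ of $\{\pm 1,\ldots,\pm N\}$ with $\tau(-i) = -\tau(i)$ for $1\le i\le N$. It is generated by the set consisting of the elements $(i,j)(-i,-j)$ and $(i,-j)(-i,j)$ for $1\le i,j\le N$, $i\neq j$, and the elements $(i,-i)$ for $1\le i\le N$. For $\tau\in B_N$, let $\ell_B(\tau)$ be the smallest $k\ge 0$ such that $\tau$ is a product of $k$ of these generators (the empty product being the identity). The partial order on $B_N$ is: $\tau\le\sigma$ if and only if $\ell_B(\sigma)=\ell_B(\tau)+\ell_B(\tau^{-1}\sigma)$. Let $\gamma_{p,q}\in B_N$ be the permutation with two cycles $$\gamma_{p,q} = (1,\ldots,p,-1,\ldots,-p)\,(p+1,\ldots,p+q,-(p+1),\ldots,-(p+q)),$$ and let $\mathcal{S}^{(B)}_{nc}(p,q) = \{\tau\in B_N \mid \tau\le\gamma_{p,q}\}$. For $\tau\in B_N$, let $\Omega(\tau)$ be the partition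 of $\{\pm1,\ldots,\pm N\}$ into orbits of $\tau$, and let $\widetilde{\Omega}(\tau)$ be the partition obtained from $\Omega(\tau)$ by merging all inversion-invariant blocks (blocks $A$ with $A=-A$), if any exist, into one single block. Define $NC^{(B)}(p,q) = \{\widetilde{\Omega}(\tau)\mid \tau\in \mathcal{S}^{(B)}_{nc}(p,q)\}$. The connectivity of $\pi\in NC^{(B)}(p,q)$ is the number $c=\frac12\cdot\#\{$blocks $A$ of $\pi$ such that $A\ne -A$ and $A$ intersects both $\{\pm1,\ldots,\pm p\}$ and $\{\pm(p+1),\ldots,\pm(p+q)\}\}$. *)

theory Defs
  imports Complex_Main "HOL-Combinatorics.Combinatorics"
begin

definition signed_set :: "nat \<Rightarrow> int set" where
  "signed_set N = {i. 1 \<le> \<bar>i\<bar> \<and> \<bar>i\<bar> \<le> int N}"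

text \<open>Elements of the hyperoctahedral group are functions on all integers that fix everything
  outside the signed set, so that \<open>\<circ>\<close>, \<open>inv\<close> and \<open>id\<close> are the group operations.\<close>

definition hyperoctahedral :: "nat \<Rightarrow> (int \<Rightarrow> int) set" where
  "hyperoctahedral N =
     {\<tau>. \<tau> permutes signed_set N \<and> (\<forall>i. 1 \<le> i \<and> i \<le> int N \<longrightarrow> \<tau> (- i) = - \<tau> i)}"

definition generators_B :: "nat \<Rightarrow> (int \<Rightarrow> int) set" where
  "generators_B N =
     {transpose i j \<circ> transpose (- i) (- j) | i j. i \<in> {1..int N} \<and> j \<in> {1..int N} \<and> i \<noteq> j}
   \<union> {transpose i (- j) \<circ> transpose (- i) j | i j. i \<in> {1..int N} \<and> j \<in> {1..int N} \<and> i \<noteq> j}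
   \<union> {transpose i (- i) | i. i \<in> {1..int N}}"

definition length_B :: "nat \<Rightarrow> (int \<Rightarrow> int) \<Rightarrow> nat" where
  "length_B N \<tau> =
     (LEAST k. \<exists>ts. length ts = k \<and> set ts \<subseteq> generators_B N \<and> foldr (\<circ>) ts id = \<tau>)"

definition le_B :: "nat \<Rightarrow> (int \<Rightarrow> int) \<Rightarrow> (int \<Rightarrow> int) \<Rightarrow> bool" where
  "le_B N \<tau> \<sigma> \<longleftrightarrow> length_B N \<sigma> = length_B N \<tau> + length_B N (inv \<tau> \<circ> \<sigma>)"

definition signed_cycle :: "int \<Rightarrow> int \<Rightarrow> int \<Rightarrow> int" where
  "signed_cycle a b = cycle_of_list ([a..b] @ map uminus [a..b])"

definition gamma_B :: "nat \<Rightarrow> nat \<Rightarrow> int \<Rightarrow> int" where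
  "gamma_B p q = signed_cycle 1 (int p) \<circ> signed_cycle (int p + 1) (int p + int q)"

definition S_nc_B :: "nat \<Rightarrow> nat \<Rightarrow> (int \<Rightarrow> int) set" where
  "S_nc_B p q = {\<tau> \<in> hyperoctahedral (p + q). le_B (p + q) \<tau> (gamma_B p q)}"

definition orbit_partition :: "nat \<Rightarrow> (int \<Rightarrow> int) \<Rightarrow> int set set" where
  "orbit_partition N \<tau> = orbit \<tau> ` signed_set N"

definition inversion_invariant :: "int set \<Rightarrow> bool" where
  "inversion_invariant A \<longleftrightarrow> uminus ` A = A"

definition merge_invariant :: "int set set \<Rightarrow> int set set" where
  "merge_invariant P =
     {A \<in> P. \<not> inversion_invariant A} \<union>
     (if \<exists>A\<in>P. inversion_invariant A then {\<Union>{A \<in> P. inversion_invariant A}} else {})"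

definition NC_B :: "nat \<Rightarrow> nat \<Rightarrow> int set set set" where
  "NC_B p q = (\<lambda>\<tau>. merge_invariant (orbit_partition (p + q) \<tau>)) ` S_nc_B p q"

text \<open>The division by two is exact division of real numbers, not integer division.\<close>

definition connectivity :: "nat \<Rightarrow> nat \<Rightarrow> int set set \<Rightarrow> real" where
  "connectivity p q P =
     1 / 2 * real (card {A \<in> P. \<not> inversion_invariant A \<and>
       A \<inter> signed_set p \<noteq> {} \<and> A \<inter> (signed_set (p + q) - signed_set p) \<noteq> {}})"

end

theory Submission
  imports Defs "HOL-Library.Numeral_Type"
begin

text \<open>The order on the hyperoctahedral group is recognised by linear algebra over the field with three
elements. Let \<open>V\<close> be the space of odd functions on the signed points, with \<open>3 ^ N\<close> elements, and let
\<open>Fix \<tau>\<close> consist of the odd functions that are constant along the orbits of \<open>\<tau>\<close>; its dimension is half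
the number of orbits that are not inversion-invariant. Multiplication by a generator changes this
dimension by at most one, and whenever \<open>\<tau> i \<noteq> i\<close> the generator exchanging \<open>i\<close> and \<open>\<tau> i\<close> raises it;
hence the length of \<open>\<tau>\<close> is the codimension of \<open>Fix \<tau>\<close> (\<open>card_Fix_B\<close>). Both cycles of \<open>\<gamma>\<close> are
inversion-invariant, so \<open>Fix \<gamma> = 0\<close>, and \<open>\<tau> \<le> \<gamma>\<close> means exactly that \<open>V\<close> is the direct sum of
\<open>Fix \<tau>\<close> and \<open>Fix \<kappa>\<close>, where \<open>\<kappa> = \<tau>\<^sup>-\<^sup>1 \<gamma>\<close>. The partition attached to \<open>\<tau>\<close> determines \<open>Fix \<tau>\<close>, and below
\<open>\<gamma>\<close> the space \<open>Fix \<tau>\<close> determines \<open>\<tau>\<close> (\<open>fixed_space_determines\<close>). So it is enough to count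
permutations.

For the count, every point \<open>i\<close> is doubled into a neighbouring pair \<open>(i, False), (i, True)\<close> on its circle,
and \<open>\<tau>\<close> is drawn as the pairing \<open>\<sigma>\<close> that joins \<open>(i, True)\<close> to \<open>(\<tau> i, False)\<close>. If \<open>\<rho>\<close> is the step to the
next of the doubled points, then the cycles of \<open>\<sigma> \<circ> \<rho>\<close> are those of \<open>\<tau>\<close> together with those of \<open>\<kappa>\<close>, and
\<open>\<tau> \<le> \<gamma>\<close> becomes the condition that \<open>Fix (\<sigma> \<circ> \<rho>)\<close> has the dimension of a quarter of the number of
points. An \<^emph>\<open>arc\<close>, that is a pair of neighbours joined by \<open>\<sigma>\<close>, is a fixed point of \<open>\<sigma> \<circ> \<rho>\<close>. An arc and
its mirror image can be deleted, and this neither destroys nor creates the condition. Without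
arcs a dimension count forces all cycles of \<open>\<sigma> \<circ> \<rho>\<close> to have length two; then \<open>\<sigma>\<close> reverses the direction
of \<open>\<rho>\<close>, cannot preserve a circle, and is a rigid gluing of two circles of the same size \<open>4 c\<close>, for
which there are \<open>2 c\<close> choices (one choice for empty circles).

The binomial coefficients count \<^emph>\<open>words\<close>: symmetric sets of points, to be read as opening brackets,
with \<open>2 (p - c)\<close> and \<open>2 (q - c)\<close> elements on the two circles. An opening bracket followed by another
letter plays the role of an arc, can be deleted in the same manner, and only the empty word has
none. So for every nonempty set of positions, prescribing arcs there and prescribing such bracket
pairs there leads to the same smaller problem. Counting by prescribed subsets determines the whole
distribution, and the numbers of pairings and of words agree up to the factor for the gluings
(\<open>card_planar_pairings\<close>). No bijection between pairings and words has to be followed.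

Deletion of arcs also shows that an orbit of \<open>\<tau>\<close> leaves the first circle at most once, and that it is
not inversion-invariant if it does (\<open>orbit_exits_once\<close>). Hence the connectivity is half the number of
points at which \<open>\<tau>\<close> leaves the first circle, which is what the pairings with a given number of
crossing chords keep track of. The sum over all connectivities telescopes.\<close>

section \<open>Odd functions with values in the field of three elements\<close>

lemma z3_cases: "(x::3) = 0 \<or> x = 1 \<or> x = - 1"
proof (cases x)
  case (of_int z)
  then have "z = 0 \<or> z = 1 \<or> z = 2" by auto
  then show ?thesis using of_int by auto
qed

text \<open>This is where characteristic two would fail: functions in \<open>Fix \<tau>\<close> vanish on inversion-invariant orbits.\<close>

lemma z3_double: "(x::3) = - x \<Longrightarrow> x = 0"
  using z3_cases[of x] by auto

definition odd_functions :: "('a \<Rightarrow> 'a) \<Rightarrow> 'a set \<Rightarrow> ('a \<Rightarrow> 3) set" where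
  "odd_functions n D = {f. (\<forall>x\<in>D. f (n x) = - f x) \<and> (\<forall>x. x \<notin> D \<longrightarrow> f x = 0)}"

definition fixed_functions :: "('a \<Rightarrow> 'a) \<Rightarrow> 'a set \<Rightarrow> ('a \<Rightarrow> 'a) \<Rightarrow> ('a \<Rightarrow> 3) set" where
  "fixed_functions n D \<pi> = {f \<in> odd_functions n D. \<forall>x\<in>D. f (\<pi> x) = f x}"

lemma finite_odd_functions: "finite D \<Longrightarrow> finite (odd_functions n D)"
proof -
  assume "finite D"
  then have "finite {f::'a \<Rightarrow> 3. \<forall>x. (x \<in> D \<longrightarrow> f x \<in> UNIV) \<and> (x \<notin> D \<longrightarrow> f x = 0)}"
    by (rule finite_set_of_finite_funs) simp
  then show ?thesis
    by (rule rev_finite_subset) (auto simp: odd_functions_def)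
qed

lemma finite_fixed_functions: "finite D \<Longrightarrow> finite (fixed_functions n D \<pi>)"
  using finite_odd_functions[of D n] by (auto simp: fixed_functions_def)

lemma zero_in_fixed_functions: "(\<lambda>_. 0) \<in> fixed_functions n D \<pi>"
  by (simp add: fixed_functions_def odd_functions_def)

lemma card_fixed_functions_pos: "finite D \<Longrightarrow> 0 < card (fixed_functions n D \<pi>)"
  using zero_in_fixed_functions[of n D \<pi>] finite_fixed_functions[of D n \<pi>] card_gt_0_iff by blast

lemma fixed_functions_add:
  "f \<in> fixed_functions n D \<pi> \<Longrightarrow> g \<in> fixed_functions n D \<pi> \<Longrightarrow> (\<lambda>x. f x + g x) \<in> fixed_functions n D \<pi>"
  by (simp add: fixed_functions_def odd_functions_def)

lemma fixed_functions_diff: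
  "f \<in> fixed_functions n D \<pi> \<Longrightarrow> g \<in> fixed_functions n D \<pi> \<Longrightarrow> (\<lambda>x. f x - g x) \<in> fixed_functions n D \<pi>"
  by (simp add: fixed_functions_def odd_functions_def)

lemma finite_signed_set: "finite (signed_set N)"
  by (rule finite_subset[of _ "{- int N..int N}"]) (auto simp: signed_set_def)

lemma signed_set_iff: "x \<in> signed_set N \<longleftrightarrow> x \<in> {1..int N} \<or> - x \<in> {1..int N}"
  by (auto simp: signed_set_def)

lemma card_odd_functions_signed_set: "card (odd_functions uminus (signed_set N)) = 3 ^ N"
proof -
  let ?P = "{1..int N}"
  define ext where "ext g x = (if x \<in> ?P then g x else if - x \<in> ?P then - g (- x) else (0::3))" for g x
  have "bij_betw (\<lambda>f. restrict f ?P) (odd_functions uminus (signed_set N)) (?P \<rightarrow>\<^sub>E (UNIV::3 set))"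
  proof (rule bij_betw_byWitness[where f' = ext])
    show "\<forall>f\<in>odd_functions uminus (signed_set N). ext (restrict f ?P) = f"
    proof
      fix f assume f: "f \<in> odd_functions uminus (signed_set N)"
      show "ext (restrict f ?P) = f"
      proof
        fix x
        consider "x \<in> ?P" | "x \<notin> ?P" "- x \<in> ?P" | "x \<notin> ?P" "- x \<notin> ?P" by blast
        then show "ext (restrict f ?P) x = f x"
        proof cases
          case 1 then show ?thesis by (simp add: ext_def)
        next
          case 2
          then have "- x \<in> signed_set N" by (auto simp: signed_set_def)
          then have "f (- (- x)) = - f (- x)" using f unfolding odd_functions_def by blast
          then show ?thesis using 2 by (simp add: ext_def)
        next
          case 3
          then have "x \<notin> signed_set N" by (auto simp: signed_set_def)
          then have "f x = 0" using f by (simp add: odd_functions_def)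
          then show ?thesis using 3 by (simp only: ext_def if_False)
        qed
      qed
    qed
    show "\<forall>g\<in>?P \<rightarrow>\<^sub>E UNIV. restrict (ext g) ?P = g"
    proof (intro ballI ext)
      fix g and x assume g: "g \<in> ?P \<rightarrow>\<^sub>E (UNIV::3 set)"
      show "restrict (ext g) ?P x = g x"
        using PiE_arb[OF g, of x] by (cases "x \<in> ?P") (simp_all add: ext_def)
    qed
    show "(\<lambda>f. restrict f ?P) ` odd_functions uminus (signed_set N) \<subseteq> ?P \<rightarrow>\<^sub>E UNIV"
      by auto
    show "ext ` (?P \<rightarrow>\<^sub>E UNIV) \<subseteq> odd_functions uminus (signed_set N)"
    proof
      fix f assume "f \<in> ext ` (?P \<rightarrow>\<^sub>E UNIV)"
      then obtain g where f: "f = ext g" by blast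
      have "ext g (- x) = - ext g x" for x by (simp add: ext_def)
      moreover have "ext g x = 0" if "x \<notin> signed_set N" for x
        using that unfolding signed_set_iff ext_def by (simp only: if_False de_Morgan_disj)
      ultimately show "f \<in> odd_functions uminus (signed_set N)" by (simp add: f odd_functions_def)
    qed
  qed
  then have "card (odd_functions uminus (signed_set N)) = card (?P \<rightarrow>\<^sub>E (UNIV::3 set))"
    by (rule bij_betw_same_card)
  also have "\<dots> = 3 ^ N" by (simp add: card_PiE)
  finally show ?thesis .
qed

section \<open>The length as a codimension\<close>

text \<open>One formula for the three kinds of generators; for \<open>k = - i\<close> it is the sign change of \<open>i\<close>.\<close>

definition reflection :: "int \<Rightarrow> int \<Rightarrow> int \<Rightarrow> int" where
  "reflection i k x = (if x = i then k else if x = k then i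
     else if x = - i then - k else if x = - k then - i else x)"

lemma reflection_transpose:
  assumes "i \<noteq> 0" "k \<noteq> 0" "i \<noteq> k" "k \<noteq> - i"
  shows "reflection i k = transpose i k \<circ> transpose (- i) (- k)"
proof
  fix x
  show "reflection i k x = (transpose i k \<circ> transpose (- i) (- k)) x"
    using assms by (simp add: reflection_def transpose_def)
qed

lemma reflection_transpose_minus: "i \<noteq> 0 \<Longrightarrow> reflection i (- i) = transpose i (- i)"
  by (rule ext) (simp add: reflection_def transpose_def)

lemma reflection_minus: "i \<noteq> 0 \<Longrightarrow> k \<noteq> 0 \<Longrightarrow> i \<noteq> k \<Longrightarrow> reflection (- i) (- k) = reflection i k"
  by (rule ext, smt (verit) reflection_def)

lemma generators_B_eq:
  "generators_B N = {reflection i k | i k. i \<in> signed_set N \<and> k \<in> signed_set N \<and> i \<noteq> k}" (is "?L = ?R")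
proof
  show "?L \<subseteq> ?R"
  proof
    fix t assume "t \<in> ?L"
    then consider i j where "i \<in> {1..int N}" "j \<in> {1..int N}" "i \<noteq> j" "t = transpose i j \<circ> transpose (- i) (- j)"
      | i j where "i \<in> {1..int N}" "j \<in> {1..int N}" "i \<noteq> j" "t = transpose i (- j) \<circ> transpose (- i) j"
      | i where "i \<in> {1..int N}" "t = transpose i (- i)"
      unfolding generators_B_def by blast
    then show "t \<in> ?R"
    proof cases
      case 1
      have "t = reflection i j" unfolding 1(4) by (rule reflection_transpose[symmetric]) (use 1 in auto)
      moreover have "i \<in> signed_set N" "j \<in> signed_set N" using 1 by (auto simp: signed_set_def)
      ultimately show ?thesis using 1(3) by blast
    next
      case 2
      have "t = transpose i (- j) \<circ> transpose (- i) (- (- j))" unfolding 2(4) by simp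
      also have "\<dots> = reflection i (- j)" by (rule reflection_transpose[symmetric]) (use 2 in auto)
      finally have "t = reflection i (- j)" .
      moreover have "i \<in> signed_set N" "- j \<in> signed_set N" "i \<noteq> - j" using 2 by (auto simp: signed_set_def)
      ultimately show ?thesis by blast
    next
      case 3
      have "t = reflection i (- i)" unfolding 3(2) by (rule reflection_transpose_minus[symmetric]) (use 3 in auto)
      moreover have "i \<in> signed_set N" "- i \<in> signed_set N" "i \<noteq> - i" using 3 by (auto simp: signed_set_def)
      ultimately show ?thesis by blast
    qed
  qed
  have pos: "reflection i k \<in> ?L" if "i \<in> {1..int N}" "k \<in> signed_set N" "i \<noteq> k" for i k
  proof -
    have "k \<in> {1..int N} \<or> - k \<in> {1..int N}" using that(2) by (auto simp: signed_set_def)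
    then consider "k = - i" | "k \<in> {1..int N}" | "k \<noteq> - i" "- k \<in> {1..int N}" by blast
    then show ?thesis
    proof cases
      case 1
      have "reflection i k = transpose i (- i)"
        unfolding 1 by (rule reflection_transpose_minus) (use that in auto)
      then show ?thesis unfolding generators_B_def using that by blast
    next
      case 2
      have "reflection i k = transpose i k \<circ> transpose (- i) (- k)"
        by (rule reflection_transpose) (use 2 that in auto)
      then show ?thesis unfolding generators_B_def using 2 that by blast
    next
      case 3
      have "reflection i k = transpose i k \<circ> transpose (- i) (- k)"
        by (rule reflection_transpose) (use 3 that in auto)
      then have "reflection i k = transpose i (- (- k)) \<circ> transpose (- i) (- k)" by simp
      moreover have "i \<noteq> - k" using 3(1) by auto
      ultimately show ?thesis unfolding generators_B_def using 3(2) that(1) by blast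
    qed
  qed
  show "?R \<subseteq> ?L"
  proof
    fix t assume "t \<in> ?R"
    then obtain i k where ik: "i \<in> signed_set N" "k \<in> signed_set N" "i \<noteq> k" and t: "t = reflection i k"
      by blast
    show "t \<in> ?L"
    proof (cases "0 < i")
      case True
      then show ?thesis unfolding t using ik by (intro pos) (auto simp: signed_set_def)
    next
      case False
      have "t = reflection (- i) (- k)"
        unfolding t by (rule reflection_minus[symmetric]) (use ik in \<open>auto simp: signed_set_def\<close>)
      moreover have "reflection (- i) (- k) \<in> ?L"
        by (rule pos) (use ik False in \<open>auto simp: signed_set_def\<close>)
      ultimately show ?thesis by simp
    qed
  qed
qed

lemma hyperoctahedral_minus:
  assumes "\<tau> \<in> hyperoctahedral N" shows "\<tau> (- x) = - \<tau> x"
proof -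
  have p: "\<tau> permutes signed_set N" and o: "\<And>i. 1 \<le> i \<Longrightarrow> i \<le> int N \<Longrightarrow> \<tau> (- i) = - \<tau> i"
    using assms by (auto simp: hyperoctahedral_def)
  consider "1 \<le> x" "x \<le> int N" | "1 \<le> - x" "- x \<le> int N" | "x \<notin> signed_set N" "- x \<notin> signed_set N"
    by (force simp: signed_set_def)
  then show ?thesis
  proof cases
    case 1 then show ?thesis by (rule o)
  next
    case 2 then show ?thesis using o[of "- x"] by simp
  next
    case 3 then show ?thesis using p by (simp add: permutes_not_in)
  qed
qed

lemma hyperoctahedralI:
  "\<tau> permutes signed_set N \<Longrightarrow> (\<And>x. \<tau> (- x) = - \<tau> x) \<Longrightarrow> \<tau> \<in> hyperoctahedral N"
  by (simp add: hyperoctahedral_def)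

lemma hyperoctahedral_permutes: "\<tau> \<in> hyperoctahedral N \<Longrightarrow> \<tau> permutes signed_set N"
  by (simp add: hyperoctahedral_def)

lemma hyperoctahedral_comp:
  "\<sigma> \<in> hyperoctahedral N \<Longrightarrow> \<tau> \<in> hyperoctahedral N \<Longrightarrow> \<sigma> \<circ> \<tau> \<in> hyperoctahedral N"
  by (intro hyperoctahedralI) (auto simp: hyperoctahedral_permutes hyperoctahedral_minus intro: permutes_compose)

lemma hyperoctahedral_inv:
  assumes "\<tau> \<in> hyperoctahedral N" shows "inv \<tau> \<in> hyperoctahedral N"
proof (intro hyperoctahedralI)
  have p: "\<tau> permutes signed_set N" using assms by (rule hyperoctahedral_permutes)
  then show "inv \<tau> permutes signed_set N" by (rule permutes_inv)
  show "inv \<tau> (- x) = - inv \<tau> x" for x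
    using p assms by (metis hyperoctahedral_minus permutes_inverses)
qed

lemma reflection_reflection: "i \<noteq> k \<Longrightarrow> i \<noteq> 0 \<Longrightarrow> k \<noteq> 0 \<Longrightarrow> reflection i k (reflection i k x) = x"
  by (smt (verit) reflection_def)

lemma minus_in_signed_set: "- x \<in> signed_set N \<longleftrightarrow> x \<in> signed_set N"
  by (simp add: signed_set_def)

lemma reflection_hyperoctahedral:
  assumes "i \<in> signed_set N" "k \<in> signed_set N" "i \<noteq> k"
  shows "reflection i k \<in> hyperoctahedral N"
proof (intro hyperoctahedralI)
  have nz: "i \<noteq> 0" "k \<noteq> 0" using assms by (auto simp: signed_set_def)
  show "reflection i k permutes signed_set N"
  proof (rule bij_imp_permutes)
    have "reflection i k x \<in> signed_set N" if "x \<in> signed_set N" for x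
      using assms that by (simp add: reflection_def minus_in_signed_set)
    then show "bij_betw (reflection i k) (signed_set N) (signed_set N)"
      using assms(3) nz
      by (intro bij_betw_byWitness[where f' = "reflection i k"]) (simp_all add: reflection_reflection image_subset_iff)
    show "reflection i k x = x" if "x \<notin> signed_set N" for x
      using assms that by (auto simp: reflection_def minus_in_signed_set)
  qed
  show "reflection i k (- x) = - reflection i k x" for x
    using nz assms(3) by (smt (verit) reflection_def)
qed

abbreviation Fix_B :: "nat \<Rightarrow> (int \<Rightarrow> int) \<Rightarrow> (int \<Rightarrow> 3) set" where
  "Fix_B N \<tau> \<equiv> fixed_functions uminus (signed_set N) \<tau>"

lemma Fix_B_minus: "f \<in> Fix_B N \<tau> \<Longrightarrow> f (- x) = - f x"
  by (cases "x \<in> signed_set N") (auto simp: fixed_functions_def odd_functions_def minus_in_signed_set)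

lemma Fix_B_fixed: "f \<in> Fix_B N \<tau> \<Longrightarrow> \<tau> permutes signed_set N \<Longrightarrow> f (\<tau> x) = f x"
  by (cases "x \<in> signed_set N") (auto simp: fixed_functions_def permutes_not_in)

lemma Fix_B_reflection:
  assumes f: "f \<in> Fix_B N \<tau>" and e: "f i = f k"
  shows "f (reflection i k x) = f x"
  using Fix_B_minus[OF f, of i] Fix_B_minus[OF f, of k] e by (simp add: reflection_def)

text \<open>The nonempty fibres of the linear form \<open>f i - f k\<close>, which takes at most three values, are
translates of its kernel.\<close>

lemma card_fixed_functions_hyperplane:
  assumes "finite D"
  shows "card (fixed_functions n D \<pi>) \<le> 3 * card {f \<in> fixed_functions n D \<pi>. f i = f k}"
proof -
  let ?A = "fixed_functions n D \<pi>" and ?H = "{f \<in> fixed_functions n D \<pi>. f i = f k}"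
  have fin: "finite ?A" using assms by (rule finite_fixed_functions)
  have "card {f \<in> ?A. f i - f k = v} \<le> card ?H" for v
  proof (cases "{f \<in> ?A. f i - f k = v} = {}")
    case False
    then obtain f0 where f0: "f0 \<in> ?A" "f0 i - f0 k = v" by auto
    show ?thesis
    proof (rule card_inj_on_le[where f = "\<lambda>f x. f x - f0 x"])
      show "inj_on (\<lambda>f x. f x - f0 x) {f \<in> ?A. f i - f k = v}"
        by (auto simp: inj_on_def fun_eq_iff)
      show "(\<lambda>f x. f x - f0 x) ` {f \<in> ?A. f i - f k = v} \<subseteq> ?H"
        using f0 by (auto intro!: fixed_functions_diff simp: algebra_simps)
      show "finite ?H" using fin by simp
    qed
  qed (simp only: card.empty)
  then have "(\<Sum>v\<in>UNIV. card {f \<in> ?A. f i - f k = v}) \<le> (\<Sum>v\<in>(UNIV::3 set). card ?H)"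
    by (intro sum_mono)
  moreover have "card ?A = (\<Sum>v\<in>UNIV. card {f \<in> ?A. f i - f k = v})"
  proof -
    have "card ?A = card (\<Union>v\<in>UNIV. {f \<in> ?A. f i - f k = v})" by (rule arg_cong[where f = card]) auto
    also have "\<dots> = (\<Sum>v\<in>UNIV. card {f \<in> ?A. f i - f k = v})"
      using fin by (intro card_UN_disjoint) auto
    finally show ?thesis .
  qed
  ultimately show ?thesis by simp
qed

text \<open>Functions with \<open>f i = f k\<close> do not notice the reflection that exchanges \<open>i\<close> and \<open>k\<close>.\<close>

lemma card_Fix_B_reflection:
  assumes "\<tau> permutes signed_set N" "t \<in> generators_B N"
  shows "card (Fix_B N \<tau>) \<le> 3 * card (Fix_B N (t \<circ> \<tau>))"
proof -
  obtain i k where t: "t = reflection i k" using assms(2) by (auto simp: generators_B_eq)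
  have "card (Fix_B N \<tau>) \<le> 3 * card {f \<in> Fix_B N \<tau>. f i = f k}"
    by (rule card_fixed_functions_hyperplane[OF finite_signed_set])
  also have "{f \<in> Fix_B N \<tau>. f i = f k} \<subseteq> Fix_B N (t \<circ> \<tau>)"
  proof
    fix f assume "f \<in> {f \<in> Fix_B N \<tau>. f i = f k}"
    then have f: "f \<in> Fix_B N \<tau>" and e: "f i = f k" by auto
    have "f (t (\<tau> x)) = f x" for x
      using Fix_B_reflection[OF f e] Fix_B_fixed[OF f assms(1)] by (simp add: t)
    then show "f \<in> Fix_B N (t \<circ> \<tau>)" using f by (simp add: fixed_functions_def)
  qed
  then have "card {f \<in> Fix_B N \<tau>. f i = f k} \<le> card (Fix_B N (t \<circ> \<tau>))"
    by (intro card_mono finite_fixed_functions finite_signed_set)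
  finally show ?thesis by simp
qed

lemma Fix_B_id: "card (Fix_B N id) = 3 ^ N"
proof -
  have "Fix_B N id = odd_functions uminus (signed_set N)" by (auto simp: fixed_functions_def)
  then show ?thesis by (simp add: card_odd_functions_signed_set)
qed

lemma card_Fix_B_le: "card (Fix_B N \<tau>) \<le> 3 ^ N"
proof -
  have "Fix_B N \<tau> \<subseteq> odd_functions uminus (signed_set N)" by (auto simp: fixed_functions_def)
  then show ?thesis
    by (metis card_mono card_odd_functions_signed_set finite_odd_functions finite_signed_set)
qed

lemma foldr_generators:
  assumes "set ts \<subseteq> generators_B N"
  shows "foldr (\<circ>) ts id \<in> hyperoctahedral N \<and> 3 ^ N \<le> 3 ^ length ts * card (Fix_B N (foldr (\<circ>) ts id))"
  using assms
proof (induction ts)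
  case Nil
  have "id \<in> hyperoctahedral N" by (simp add: hyperoctahedral_def permutes_def)
  then show ?case using Fix_B_id[of N]
    by (simp add: id_def)
next
  case (Cons t ts)
  let ?r = "foldr (\<circ>) ts id"
  have r: "?r \<in> hyperoctahedral N" "3 ^ N \<le> 3 ^ length ts * card (Fix_B N ?r)" and t: "t \<in> generators_B N"
    using Cons.IH Cons.prems by (simp_all only: list.set insert_subset simp_thms)
  have "t \<in> hyperoctahedral N" using t by (auto simp: generators_B_eq reflection_hyperoctahedral)
  then have "t \<circ> ?r \<in> hyperoctahedral N" using r by (intro hyperoctahedral_comp)
  moreover have "3 ^ N \<le> 3 ^ length ts * (3 * card (Fix_B N (t \<circ> ?r)))"
    using r(2) card_Fix_B_reflection[OF hyperoctahedral_permutes[OF r(1)] t]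
    by (meson le_trans mult_le_mono2)
  moreover have "foldr (\<circ>) (t # ts) id = t \<circ> ?r" by (rule ext) simp
  ultimately show ?case by (simp only: list.size power_Suc mult_ac add_Suc_right add_0_right simp_thms)
qed

text \<open>If \<open>\<tau> i = k \<noteq> i\<close>, then left multiplication by the reflection \<open>t\<close> exchanging \<open>i\<close> and \<open>k\<close> keeps all of \<open>Fix \<tau>\<close> and
turns \<open>i\<close> into a fixed point. The odd function \<open>d\<close> supported on \<open>i\<close> and \<open>- i\<close> is then new in \<open>Fix (t \<circ> \<tau>)\<close>,
which therefore is at least three times as large as \<open>Fix \<tau>\<close>. Iteration reaches the identity.\<close>

lemma exists_short_factorization:
  assumes "\<tau> \<in> hyperoctahedral N"
  shows "\<exists>ts. set ts \<subseteq> generators_B N \<and> foldr (\<circ>) ts id = \<tau> \<and> 3 ^ length ts * card (Fix_B N \<tau>) \<le> 3 ^ N"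
  using assms
proof (induction "3 ^ N - card (Fix_B N \<tau>)" arbitrary: \<tau> rule: less_induct)
  case less
  have per: "\<tau> permutes signed_set N" using less.prems by (rule hyperoctahedral_permutes)
  show ?case
  proof (cases "\<tau> = id")
    case True
    then show ?thesis by (intro exI[of _ "[]"]) (simp add: Fix_B_id[unfolded id_def] Fix_B_id)
  next
    case False
    then obtain i where i: "\<tau> i \<noteq> i" by (auto simp: fun_eq_iff)
    define k where "k = \<tau> i"
    have ik: "i \<in> signed_set N" "k \<in> signed_set N" "i \<noteq> k"
      using i per permutes_not_in[OF per, of i] by (auto simp: k_def permutes_in_image)
    have nz: "i \<noteq> 0" "k \<noteq> 0" using ik by (auto simp: signed_set_def)
    define t where "t = reflection i k"
    have t: "t \<in> generators_B N" using ik by (auto simp: t_def generators_B_eq)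
    have th: "t \<in> hyperoctahedral N" using ik by (simp add: t_def reflection_hyperoctahedral)
    have h': "t \<circ> \<tau> \<in> hyperoctahedral N" using th less.prems by (rule hyperoctahedral_comp)
    have per': "t \<circ> \<tau> permutes signed_set N" using h' by (rule hyperoctahedral_permutes)
    have ti: "(t \<circ> \<tau>) i = i" using ik by (simp add: t_def k_def[symmetric] reflection_def)
    define d where "d x = (if x = i then 1 else if x = - i then - 1 else (0::3))" for x
    have d: "d \<in> Fix_B N (t \<circ> \<tau>)"
    proof -
      have "(t \<circ> \<tau>) (- i) = - i" using hyperoctahedral_minus[OF h', of i] ti by simp
      then have "(t \<circ> \<tau>) x = i \<longleftrightarrow> x = i" "(t \<circ> \<tau>) x = - i \<longleftrightarrow> x = - i" for x
        using ti inj_eq[OF permutes_inj[OF per'], of x i] inj_eq[OF permutes_inj[OF per'], of x "- i"] by simp_all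
      then have "d ((t \<circ> \<tau>) x) = d x" for x by (simp only: d_def)
      moreover have "d (- x) = - d x" for x using nz by (simp add: d_def)
      moreover have "d x = 0" if "x \<notin> signed_set N" for x
        using that ik minus_in_signed_set[of x N] by (auto simp: d_def minus_in_signed_set)
      ultimately show ?thesis by (simp add: fixed_functions_def odd_functions_def)
    qed
    have sub: "f \<in> Fix_B N (t \<circ> \<tau>)" "f i = f k" if f: "f \<in> Fix_B N \<tau>" for f
    proof -
      show e: "f i = f k" using Fix_B_fixed[OF f per, of i] by (simp add: k_def)
      have "f (t (\<tau> x)) = f x" for x
        using Fix_B_reflection[OF f e] Fix_B_fixed[OF f per] by (simp add: t_def)
      then show "f \<in> Fix_B N (t \<circ> \<tau>)" using f by (simp add: fixed_functions_def)
    qed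
    have dk: "d i \<noteq> d k" using ik nz by (auto simp: d_def)
    \<comment> \<open>The three translates of \<open>Fix \<tau>\<close> by multiples of \<open>d\<close> are disjoint, since \<open>d\<close> separates \<open>i\<close> from \<open>k\<close>.\<close>
    define h where "h = (\<lambda>(c::3, f) x. f x + c * d x)"
    have "inj_on h (UNIV \<times> Fix_B N \<tau>)"
    proof (rule inj_onI, clarify)
      fix c f c' f' assume f: "f \<in> Fix_B N \<tau>" "f' \<in> Fix_B N \<tau>" and e: "h (c, f) = h (c', f')"
      have e': "f x + c * d x = f' x + c' * d x" for x using fun_cong[OF e, of x] by (simp add: h_def)
      have "c * (d i - d k) = c' * (d i - d k)"
      proof -
        have "f i + c * d i - (f k + c * d k) = f' i + c' * d i - (f' k + c' * d k)"
          by (simp only: e')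
        then show ?thesis using sub(2)[OF f(1)] sub(2)[OF f(2)] by (simp add: right_diff_distrib)
      qed
      moreover have "d i - d k = 1 \<or> d i - d k = - 1" using dk z3_cases[of "d i - d k"] by simp
      ultimately have c: "c = c'" by (metis mult.right_neutral mult_minus1_right neg_equal_iff_equal)
      have "f x = f' x" for x using e'[of x] by (simp add: c)
      with c show "c = c' \<and> f = f'" by (simp add: fun_eq_iff)
    qed
    moreover have "h ` (UNIV \<times> Fix_B N \<tau>) \<subseteq> Fix_B N (t \<circ> \<tau>)"
    proof clarify
      fix c :: 3 and f assume f: "f \<in> Fix_B N \<tau>"
      have "(\<lambda>x. c * d x) \<in> Fix_B N (t \<circ> \<tau>)"
        using d by (simp add: fixed_functions_def odd_functions_def)
      then show "h (c, f) \<in> Fix_B N (t \<circ> \<tau>)"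
        using fixed_functions_add[OF sub(1)[OF f]] by (simp add: h_def)
    qed
    ultimately have "card ((UNIV :: 3 set) \<times> Fix_B N \<tau>) \<le> card (Fix_B N (t \<circ> \<tau>))"
      by (intro card_inj_on_le finite_fixed_functions finite_signed_set)
    then have c3: "3 * card (Fix_B N \<tau>) \<le> card (Fix_B N (t \<circ> \<tau>))" by (simp add: card_cartesian_product)
    have "0 < card (Fix_B N \<tau>)" by (rule card_fixed_functions_pos[OF finite_signed_set])
    then have "3 ^ N - card (Fix_B N (t \<circ> \<tau>)) < 3 ^ N - card (Fix_B N \<tau>)"
      using c3 card_Fix_B_le[of N "t \<circ> \<tau>"] by linarith
    from less.hyps[OF this h'] obtain ts where ts: "set ts \<subseteq> generators_B N" "foldr (\<circ>) ts id = t \<circ> \<tau>"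
      "3 ^ length ts * card (Fix_B N (t \<circ> \<tau>)) \<le> 3 ^ N" by blast
    have "foldr (\<circ>) (t # ts) id = \<tau>"
      using ts(2) reflection_reflection[OF ik(3) nz] by (auto simp: fun_eq_iff t_def)
    moreover have "3 ^ length (t # ts) * card (Fix_B N \<tau>) \<le> 3 ^ N"
    proof -
      have "3 ^ length (t # ts) * card (Fix_B N \<tau>) = 3 ^ length ts * (3 * card (Fix_B N \<tau>))" by simp
      also have "\<dots> \<le> 3 ^ length ts * card (Fix_B N (t \<circ> \<tau>))" using c3 by (rule mult_le_mono2)
      finally show ?thesis using ts(3) by linarith
    qed
    moreover have "set (t # ts) \<subseteq> generators_B N" using ts(1) t by simp
    ultimately show ?thesis by blast
  qed
qed

text \<open>The length is the codimension of the fixed space: one inequality bounds the loss per generator, the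
other comes from the greedy factorization.\<close>

lemma card_Fix_B:
  assumes "\<tau> \<in> hyperoctahedral N"
  shows "3 ^ length_B N \<tau> * card (Fix_B N \<tau>) = 3 ^ N"
proof -
  let ?Q = "\<lambda>k. \<exists>ts. length ts = k \<and> set ts \<subseteq> generators_B N \<and> foldr (\<circ>) ts id = \<tau>"
  obtain ts where ts: "set ts \<subseteq> generators_B N" "foldr (\<circ>) ts id = \<tau>"
    "3 ^ length ts * card (Fix_B N \<tau>) \<le> 3 ^ N"
    using exists_short_factorization[OF assms] by blast
  have "?Q (length ts)" using ts(1,2) by (intro exI[of _ ts] conjI refl)
  then have Q: "?Q (length_B N \<tau>)" and le: "length_B N \<tau> \<le> length ts"
    unfolding length_B_def by (rule LeastI, rule Least_le)
  obtain us where us: "length us = length_B N \<tau>" "set us \<subseteq> generators_B N" "foldr (\<circ>) us id = \<tau>"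
    using Q by (elim exE conjE)
  have "3 ^ N \<le> 3 ^ length_B N \<tau> * card (Fix_B N \<tau>)"
    using foldr_generators[OF us(2)] unfolding us(1,3) by (rule conjunct2)
  moreover have "3 ^ length_B N \<tau> * card (Fix_B N \<tau>) \<le> 3 ^ length ts * card (Fix_B N \<tau>)"
    using le by (intro mult_le_mono1 power_increasing) auto
  ultimately show ?thesis using ts(3) by linarith
qed


section \<open>Permutations below \<open>\<gamma>\<close> and their partitions\<close>

abbreviation odd_B :: "nat \<Rightarrow> (int \<Rightarrow> 3) set" where
  "odd_B N \<equiv> odd_functions uminus (signed_set N)"

lemma Fix_B_inv_fixed:
  assumes "\<tau> permutes signed_set N" "f \<in> Fix_B N \<tau>"
  shows "f (inv \<tau> x) = f x"
  using Fix_B_fixed[OF assms(2,1), of "inv \<tau> x"] permutes_inverses(1)[OF assms(1)] by simp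

lemma le_B_iff_card:
  assumes "\<tau> \<in> hyperoctahedral N" "\<gamma> \<in> hyperoctahedral N" "Fix_B N \<gamma> = {\<lambda>_. 0}"
  shows "le_B N \<tau> \<gamma> \<longleftrightarrow> card (Fix_B N \<tau>) * card (Fix_B N (inv \<tau> \<circ> \<gamma>)) = 3 ^ N"
proof -
  let ?l = "length_B N \<tau> + length_B N (inv \<tau> \<circ> \<gamma>)"
  let ?c = "card (Fix_B N \<tau>) * card (Fix_B N (inv \<tau> \<circ> \<gamma>))"
  have "inv \<tau> \<circ> \<gamma> \<in> hyperoctahedral N"
    using assms by (intro hyperoctahedral_comp hyperoctahedral_inv)
  then have *: "3 ^ length_B N (inv \<tau> \<circ> \<gamma>) * card (Fix_B N (inv \<tau> \<circ> \<gamma>)) = 3 ^ N"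
    by (rule card_Fix_B)
  have "(3::nat) ^ length_B N \<gamma> = 3 ^ N" using card_Fix_B[OF assms(2)] assms(3) by simp
  then have l: "length_B N \<gamma> = N" by simp
  have prod: "3 ^ ?l * ?c = 3 ^ N * 3 ^ N"
  proof -
    have "3 ^ ?l * ?c = (3 ^ length_B N \<tau> * card (Fix_B N \<tau>)) *
        (3 ^ length_B N (inv \<tau> \<circ> \<gamma>) * card (Fix_B N (inv \<tau> \<circ> \<gamma>)))"
      by (simp only: power_add mult_ac)
    then show ?thesis unfolding * card_Fix_B[OF assms(1)] .
  qed
  show ?thesis
  proof
    assume "le_B N \<tau> \<gamma>"
    then have "?l = N" using l by (simp add: le_B_def)
    with prod show "?c = 3 ^ N" by simp
  next
    assume "?c = 3 ^ N"
    with prod have "(3::nat) ^ ?l = 3 ^ N" by simp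
    then have "?l = N" by simp
    then show "le_B N \<tau> \<gamma>" using l by (simp add: le_B_def)
  qed
qed

text \<open>A function fixed by \<open>\<tau>\<close> and by \<open>\<tau>\<^sup>-\<^sup>1 \<gamma>\<close> is fixed by \<open>\<gamma>\<close>, hence zero. So addition is injective on the product
of the two fixed spaces, and the cardinalities agree exactly for \<open>\<tau> \<le> \<gamma>\<close>.\<close>

lemma decomposition:
  assumes \<tau>: "\<tau> \<in> hyperoctahedral N" and \<gamma>: "\<gamma> \<in> hyperoctahedral N" "Fix_B N \<gamma> = {\<lambda>_. 0}"
    and le: "le_B N \<tau> \<gamma>" and v: "v \<in> odd_B N"
  obtains a b where "a \<in> Fix_B N \<tau>" "b \<in> Fix_B N (inv \<tau> \<circ> \<gamma>)" "\<And>x. v x = a x + b x"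
proof -
  let ?F = "Fix_B N \<tau>" and ?K = "Fix_B N (inv \<tau> \<circ> \<gamma>)"
  have p: "\<tau> permutes signed_set N" using \<tau> by (rule hyperoctahedral_permutes)
  have "inv \<tau> \<circ> \<gamma> \<in> hyperoctahedral N"
    using \<tau> \<gamma> by (intro hyperoctahedral_comp hyperoctahedral_inv)
  then have pk: "inv \<tau> \<circ> \<gamma> permutes signed_set N" by (rule hyperoctahedral_permutes)
  have zero: "h = (\<lambda>_. 0)" if "h \<in> ?F" "h \<in> ?K" for h
  proof -
    have "h (\<gamma> x) = h x" for x
      using Fix_B_fixed[OF that(2) pk, of x] Fix_B_fixed[OF that(1) p, of "inv \<tau> (\<gamma> x)"]
        permutes_inverses(1)[OF p] by simp
    then have "h \<in> Fix_B N \<gamma>" using that(1) by (simp add: fixed_functions_def)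
    then show ?thesis using \<gamma>(2) by simp
  qed
  define s :: "(int \<Rightarrow> 3) \<times> (int \<Rightarrow> 3) \<Rightarrow> int \<Rightarrow> 3" where "s = (\<lambda>(a, b) x. a x + b x)"
  have inj: "inj_on s (?F \<times> ?K)"
  proof (rule inj_onI, clarify)
    fix a b a' b' assume ab: "a \<in> ?F" "b \<in> ?K" "a' \<in> ?F" "b' \<in> ?K" and e: "s (a, b) = s (a', b')"
    have e': "a x + b x = a' x + b' x" for x using fun_cong[OF e, of x] by (simp add: s_def)
    have e'': "a x - a' x = b' x - b x" for x using e'[of x] by (simp add: algebra_simps)
    have "(\<lambda>x. a x - a' x) \<in> ?F" using ab by (intro fixed_functions_diff)
    moreover have "(\<lambda>x. a x - a' x) \<in> ?K" unfolding e'' using ab by (intro fixed_functions_diff)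
    ultimately have "(\<lambda>x. a x - a' x) = (\<lambda>_. 0)" by (rule zero)
    then have z: "a x - a' x = 0" for x by (rule fun_cong)
    have "a = a'" using z by (simp add: fun_eq_iff)
    moreover have "b = b'" using z e'' by (simp add: fun_eq_iff)
    ultimately show "a = a' \<and> b = b'" by simp
  qed
  have sub: "s ` (?F \<times> ?K) \<subseteq> odd_B N"
  proof clarify
    fix a b assume "a \<in> ?F" "b \<in> ?K"
    then show "s (a, b) \<in> odd_B N"
      by (simp add: s_def fixed_functions_def odd_functions_def)
  qed
  have "card (s ` (?F \<times> ?K)) = card (odd_B N)"
    using le le_B_iff_card[OF \<tau> \<gamma>] inj by (simp add: card_image card_cartesian_product card_odd_functions_signed_set)
  with sub have "s ` (?F \<times> ?K) = odd_B N"
    by (intro card_subset_eq finite_odd_functions finite_signed_set)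
  with v obtain a b where "a \<in> ?F" "b \<in> ?K" "v = s (a, b)" by blast
  then show thesis by (intro that[of a b]) (simp_all add: s_def)
qed

definition odd_delta :: "int \<Rightarrow> int \<Rightarrow> 3" where
  "odd_delta i x = (if x = i then 1 else if x = - i then - 1 else 0)"

lemma odd_delta_in: "i \<in> signed_set N \<Longrightarrow> odd_delta i \<in> odd_B N"
  unfolding odd_functions_def odd_delta_def using minus_in_signed_set[of i N]
  by (auto simp: signed_set_def)

lemma sum_odd_delta:
  assumes "i \<in> signed_set N" and "\<And>x. w (- x) = - w x"
  shows "(\<Sum>x\<in>signed_set N. w x * odd_delta i x) = - w i"
proof -
  have i: "i \<noteq> - i" "- i \<in> signed_set N" using assms(1) by (auto simp: signed_set_def)
  have "(\<Sum>x\<in>signed_set N. w x * odd_delta i x) = (\<Sum>x\<in>{i, - i}. w x * odd_delta i x)"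
    using assms(1) i finite_signed_set by (intro sum.mono_neutral_right) (auto simp: odd_delta_def)
  also have "\<dots> = w i * odd_delta i i + w (- i) * odd_delta i (- i)" using i by simp
  also have "\<dots> = w i + w i" using i assms(2)[of i] by (simp add: odd_delta_def)
  \<comment> \<open>Characteristic three turns the factor two into a sign.\<close>
  also have "\<dots> = - w i" using z3_cases[of "w i"] by auto
  finally show ?thesis .
qed

lemma sum_permutes_swap:
  assumes "\<tau> permutes S"
  shows "(\<Sum>x\<in>S. f (inv \<tau> x) * g x) = (\<Sum>x\<in>S. f x * g (\<tau> x) :: 3)"
proof -
  have "(\<Sum>x\<in>S. f (inv \<tau> x) * g x) = (\<Sum>x\<in>S. ((\<lambda>x. f (inv \<tau> x) * g x) \<circ> \<tau>) x)"
    using sum.permute[OF assms, of "\<lambda>x. f (inv \<tau> x) * g x"] by simp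
  then show ?thesis using permutes_inverses(2)[OF assms] by simp
qed

text \<open>The argument of Brady and Watt for the orthogonal group, with pairings of functions instead of inner
products. Let \<open>F\<close> be the common fixed space and \<open>K1\<close>, \<open>K2\<close> the two complementary ones. On
\<open>K1\<close> the inverses of \<open>\<gamma>\<close> and \<open>\<tau>1\<close> act in the same way, so it suffices to show \<open>K1 \<subseteq> K2\<close>: then both permutations
act as the identity on \<open>F\<close> and as \<open>\<gamma>\<close> on \<open>K1\<close>. Write \<open>f \<in> K1\<close> as \<open>a + b\<close> with \<open>a \<in> F\<close> and \<open>b \<in> K2\<close>. Then
\<open>\<gamma>\<close> changes \<open>a\<close> by the difference between the images of \<open>f\<close> under \<open>\<tau>1\<close> and under \<open>\<tau>2\<close>, and this difference is
orthogonal to \<open>F\<close>. This makes \<open>a\<close> orthogonal to everything of the form \<open>v \<circ> \<kappa> - v\<close> with \<open>\<kappa> = \<tau>1\<^sup>-\<^sup>1 \<gamma>\<close>, so that \<open>a\<close> is fixed by \<open>\<kappa>\<close>,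
lies in \<open>F \<inter> K1\<close>, and is zero.\<close>

lemma fixed_space_determines:
  assumes \<gamma>: "\<gamma> \<in> hyperoctahedral N" "Fix_B N \<gamma> = {\<lambda>_. 0}"
    and \<tau>1: "\<tau>1 \<in> hyperoctahedral N" "le_B N \<tau>1 \<gamma>"
    and \<tau>2: "\<tau>2 \<in> hyperoctahedral N" "le_B N \<tau>2 \<gamma>"
    and F: "Fix_B N \<tau>1 = Fix_B N \<tau>2"
  shows "\<tau>1 = \<tau>2"
proof -
  let ?S = "signed_set N"
  let ?F = "Fix_B N \<tau>1" and ?K1 = "Fix_B N (inv \<tau>1 \<circ> \<gamma>)" and ?K2 = "Fix_B N (inv \<tau>2 \<circ> \<gamma>)"
  have p: "\<tau>1 permutes ?S" "\<tau>2 permutes ?S" "\<gamma> permutes ?S"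
    using \<tau>1 \<tau>2 \<gamma> by (auto intro: hyperoctahedral_permutes)
  have k1: "inv \<tau>1 \<circ> \<gamma> \<in> hyperoctahedral N" and k2: "inv \<tau>2 \<circ> \<gamma> \<in> hyperoctahedral N"
    using \<tau>1 \<tau>2 \<gamma> by (auto intro: hyperoctahedral_comp hyperoctahedral_inv)
  have pk: "inv \<tau>1 \<circ> \<gamma> permutes ?S" "inv \<tau>2 \<circ> \<gamma> permutes ?S"
    using k1 k2 by (auto intro: hyperoctahedral_permutes)
  have agree: "f (inv \<gamma> x) = f (inv \<tau> x)"
    if \<tau>: "\<tau> permutes ?S" "inv \<tau> \<circ> \<gamma> permutes ?S" and f: "f \<in> Fix_B N (inv \<tau> \<circ> \<gamma>)" for f \<tau> x
    using Fix_B_fixed[OF f \<tau>(2), of "inv \<gamma> x"] permutes_inverses(1)[OF p(3)] by simp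
  have K: "f \<in> ?K2" if f: "f \<in> ?K1" for f
  proof -
    have "f \<in> odd_B N" using f by (simp add: fixed_functions_def)
    from decomposition[OF \<tau>2(1) \<gamma> \<tau>2(2) this] obtain a b
      where a: "a \<in> ?F" and b: "b \<in> ?K2" and fab: "\<And>x. f x = a x + b x" unfolding F by metis
    have a2: "a \<in> Fix_B N \<tau>2" using a F by simp
    \<comment> \<open>Substitute \<open>b = f - a\<close> and use that \<open>a\<close> is fixed by \<open>\<tau>2\<close>.\<close>
    have key: "a (inv \<gamma> x) - a x = f (inv \<tau>1 x) - f (inv \<tau>2 x)" for x
      using agree[OF p(1) pk(1) f, of x] agree[OF p(2) pk(2) b, of x]
        Fix_B_inv_fixed[OF p(2) a2, of x] fab[of "inv \<gamma> x"] fab[of "inv \<tau>2 x"]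
      by (simp add: algebra_simps)
    have orth: "(\<Sum>x\<in>?S. a x * g (inv \<tau>1 (\<gamma> x))) = (\<Sum>x\<in>?S. a x * g x)" if g: "g \<in> ?F" for g
    proof -
      have g2: "g \<in> Fix_B N \<tau>2" using g F by simp
      have "(\<Sum>x\<in>?S. f (inv \<tau>1 x) * g x) = (\<Sum>x\<in>?S. f x * g x)"
        unfolding sum_permutes_swap[OF p(1)] by (simp only: Fix_B_fixed[OF g p(1)])
      moreover have "(\<Sum>x\<in>?S. f (inv \<tau>2 x) * g x) = (\<Sum>x\<in>?S. f x * g x)"
        unfolding sum_permutes_swap[OF p(2)] by (simp only: Fix_B_fixed[OF g2 p(2)])
      ultimately have "(\<Sum>x\<in>?S. (f (inv \<tau>1 x) - f (inv \<tau>2 x)) * g x) = 0"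
        by (simp add: left_diff_distrib sum_subtractf)
      then have "(\<Sum>x\<in>?S. a (inv \<gamma> x) * g x) = (\<Sum>x\<in>?S. a x * g x)"
        unfolding key[symmetric] by (simp add: left_diff_distrib sum_subtractf)
      then show ?thesis
        unfolding sum_permutes_swap[OF p(3)] by (simp only: Fix_B_inv_fixed[OF p(1) g])
    qed
    \<comment> \<open>Every \<open>v\<close> is a sum of a function in \<open>F\<close>, covered by \<open>orth\<close>, and one in \<open>K1\<close>, for which both sides agree trivially.\<close>
    have orth': "(\<Sum>x\<in>?S. a x * v (inv \<tau>1 (\<gamma> x))) = (\<Sum>x\<in>?S. a x * v x)" if vo: "v \<in> odd_B N" for v
    proof -
      obtain g k where g: "g \<in> ?F" and k: "k \<in> ?K1" and v: "\<And>x. v x = g x + k x"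
        using decomposition[OF \<tau>1(1) \<gamma> \<tau>1(2) vo] by metis
      have "k (inv \<tau>1 (\<gamma> x)) = k x" for x using Fix_B_fixed[OF k pk(1), of x] by simp
      then show ?thesis using orth[OF g] by (simp add: v distrib_left sum.distrib)
    qed
    define w where "w x = a (inv (inv \<tau>1 \<circ> \<gamma>) x) - a x" for x
    have am: "a (- x) = - a x" for x using Fix_B_minus[OF a] by simp
    have "w (- x) = - w x" for x
      using hyperoctahedral_minus[OF hyperoctahedral_inv[OF k1], of x] by (simp add: w_def am)
    moreover have "(\<Sum>x\<in>?S. w x * odd_delta i x) = 0" if "i \<in> ?S" for i
      using orth'[OF odd_delta_in[OF that]] sum_permutes_swap[OF pk(1), of a "odd_delta i"]
      by (simp add: w_def left_diff_distrib sum_subtractf)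
    ultimately have "w i = 0" if "i \<in> ?S" for i
      using sum_odd_delta[OF that, of w] that by simp
    then have "a (inv (inv \<tau>1 \<circ> \<gamma>) x) = a x" if "x \<in> ?S" for x using that by (simp add: w_def)
    then have "a ((inv \<tau>1 \<circ> \<gamma>) x) = a x" if "x \<in> ?S" for x
      using that permutes_inverses(2)[OF pk(1), of x] permutes_in_image[OF pk(1), of x] by metis
    then have "a \<in> ?K1" using a by (simp add: fixed_functions_def)
    then have "a (\<gamma> x) = a x" for x
      using Fix_B_fixed[OF _ pk(1), of a x] Fix_B_fixed[OF a p(1), of "inv \<tau>1 (\<gamma> x)"] permutes_inverses(1)[OF p(1)]
      by simp
    then have "a \<in> Fix_B N \<gamma>" using a by (simp add: fixed_functions_def)
    then have "a x = 0" for x using \<gamma>(2) by simp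
    then have "f = b" using fab by (simp add: fun_eq_iff)
    with b show ?thesis by simp
  qed
  have same: "v (inv \<tau>1 x) = v (inv \<tau>2 x)" if v: "v \<in> odd_B N" for v x
  proof -
    obtain a f where a: "a \<in> ?F" and f: "f \<in> ?K1" and vaf: "\<And>x. v x = a x + f x"
      using decomposition[OF \<tau>1(1) \<gamma> \<tau>1(2) v] by metis
    have a2: "a \<in> Fix_B N \<tau>2" using a F by simp
    show ?thesis
      using agree[OF p(1) pk(1) f, of x] agree[OF p(2) pk(2) K[OF f], of x]
        Fix_B_inv_fixed[OF p(1) a, of x] Fix_B_inv_fixed[OF p(2) a2, of x] by (simp add: vaf)
  qed
  have "inv \<tau>1 x = inv \<tau>2 x" for x
  proof (cases "x \<in> ?S")
    case True
    define i where "i = inv \<tau>1 x"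
    have "i \<in> ?S" using True permutes_in_image[OF permutes_inv[OF p(1)]] by (simp add: i_def)
    then have "odd_delta i (inv \<tau>2 x) = odd_delta i i"
      using same[OF odd_delta_in, of i x] by (simp add: i_def)
    moreover have "odd_delta i i = 1" by (simp add: odd_delta_def)
    ultimately show ?thesis by (auto simp: odd_delta_def i_def split: if_splits)
  next
    case False
    then show ?thesis using permutes_not_in[OF permutes_inv] p by metis
  qed
  then have "inv \<tau>1 = inv \<tau>2" by (rule ext)
  then show ?thesis using permutes_inv_inv p by metis
qed

lemma merge_invariant_block:
  assumes "A \<in> P"
  shows "\<exists>B\<in>merge_invariant P. A \<subseteq> B"
  using assms by (cases "inversion_invariant A") (auto simp: merge_invariant_def)

lemma Fix_B_constant_on_orbit:
  assumes "f \<in> Fix_B N \<tau>" "\<tau> permutes signed_set N" "y \<in> orbit \<tau> x"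
  shows "f y = f x"
  using assms(3) by induction (simp_all add: Fix_B_fixed[OF assms(1,2)])

text \<open>Merging the inversion-invariant orbits loses nothing here, because functions in \<open>Fix \<tau>\<close> vanish on all of them.\<close>

lemma Fix_B_eq_constant_on_blocks:
  assumes \<tau>: "\<tau> permutes signed_set N"
  shows "Fix_B N \<tau> = {f \<in> odd_B N. \<forall>A\<in>merge_invariant (orbit_partition N \<tau>). \<forall>x\<in>A. \<forall>y\<in>A. f x = f y}"
proof (intro set_eqI iffI CollectI conjI ballI)
  fix f assume f: "f \<in> Fix_B N \<tau>"
  then show "f \<in> odd_B N" by (simp add: fixed_functions_def)
  have const: "f x = f y" if A: "A \<in> orbit_partition N \<tau>" "x \<in> A" "y \<in> A" for A x y
  proof -
    obtain z where "A = orbit \<tau> z" using A(1) by (auto simp: orbit_partition_def)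
    then show ?thesis using Fix_B_constant_on_orbit[OF f \<tau>, of x z] Fix_B_constant_on_orbit[OF f \<tau>, of y z] A
      by simp
  qed
  have zero: "f x = 0" if A: "A \<in> orbit_partition N \<tau>" "inversion_invariant A" "x \<in> A" for A x
  proof -
    have "- x \<in> A" using A(2,3) by (auto simp: inversion_invariant_def)
    then have "f x = - f x" using const[OF A(1,3)] Fix_B_minus[OF f, of x] by simp
    then show ?thesis by (rule z3_double)
  qed
  fix A x y assume A: "A \<in> merge_invariant (orbit_partition N \<tau>)" "x \<in> A" "y \<in> A"
  then consider "A \<in> orbit_partition N \<tau>"
    | "A = \<Union>{A \<in> orbit_partition N \<tau>. inversion_invariant A}"
    unfolding merge_invariant_def by (auto split: if_splits)
  then show "f x = f y"
  proof cases
    case 1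
    then show ?thesis using A(2,3) by (rule const)
  next
    case 2
    then obtain B C where "B \<in> orbit_partition N \<tau>" "inversion_invariant B" "x \<in> B"
      and "C \<in> orbit_partition N \<tau>" "inversion_invariant C" "y \<in> C" using A(2,3) by blast
    then show ?thesis using zero[of B x] zero[of C y] by simp
  qed
next
  fix f assume f: "f \<in> {f \<in> odd_B N. \<forall>A\<in>merge_invariant (orbit_partition N \<tau>). \<forall>x\<in>A. \<forall>y\<in>A. f x = f y}"
  have "f (\<tau> x) = f x" if "x \<in> signed_set N" for x
  proof -
    have "permutation \<tau>" unfolding permutation_permutes using \<tau> finite_signed_set by blast
    then have "x \<in> orbit \<tau> x" by (rule permutation_self_in_orbit)
    moreover have "\<tau> x \<in> orbit \<tau> x" by (rule orbit.base)
    moreover have "orbit \<tau> x \<in> orbit_partition N \<tau>" unfolding orbit_partition_def using that by (rule imageI)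
    then obtain B where B: "B \<in> merge_invariant (orbit_partition N \<tau>)" "orbit \<tau> x \<subseteq> B"
      using merge_invariant_block by metis
    ultimately have "x \<in> B" "\<tau> x \<in> B" by auto
    moreover have "\<forall>x\<in>B. \<forall>y\<in>B. f x = f y" using f B(1) by (elim CollectE conjE) (rule bspec)
    ultimately show ?thesis by meson
  qed
  then show "f \<in> Fix_B N \<tau>" using f by (simp add: fixed_functions_def)
qed

lemma inj_on_merged_partition:
  assumes \<gamma>: "\<gamma> \<in> hyperoctahedral N" "Fix_B N \<gamma> = {\<lambda>_. 0}"
  shows "inj_on (\<lambda>\<tau>. merge_invariant (orbit_partition N \<tau>)) {\<tau> \<in> hyperoctahedral N. le_B N \<tau> \<gamma>}"
proof (rule inj_onI, clarify)
  fix \<tau>1 \<tau>2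
  assume h: "\<tau>1 \<in> hyperoctahedral N" "le_B N \<tau>1 \<gamma>" "\<tau>2 \<in> hyperoctahedral N" "le_B N \<tau>2 \<gamma>"
    and e: "merge_invariant (orbit_partition N \<tau>1) = merge_invariant (orbit_partition N \<tau>2)"
  have "Fix_B N \<tau>1 = Fix_B N \<tau>2"
    unfolding Fix_B_eq_constant_on_blocks[OF hyperoctahedral_permutes[OF h(1)]]
      Fix_B_eq_constant_on_blocks[OF hyperoctahedral_permutes[OF h(3)]] e ..
  then show "\<tau>1 = \<tau>2" using fixed_space_determines[OF \<gamma> h] by simp
qed


section \<open>Coloured circles and the deletion of an arc\<close>

text \<open>A single cycle of \<open>\<rho>\<close>, possibly empty, which is invariant under the fixed-point-free involution \<open>n\<close> and whose points
are alternately coloured by \<open>\<chi>\<close>. That there is only one cycle is expressed by the absence of proper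
closed subsets, a form which passes easily to the circle with an arc deleted.\<close>

definition circle :: "('a \<Rightarrow> 'a) \<Rightarrow> ('a \<Rightarrow> bool) \<Rightarrow> ('a \<Rightarrow> 'a) \<Rightarrow> 'a set \<Rightarrow> bool" where
  "circle n \<chi> \<rho> C \<longleftrightarrow> finite C
     \<and> (\<forall>x\<in>C. n x \<in> C \<and> n x \<noteq> x \<and> n (n x) = x \<and> \<chi> (n x) = \<chi> x)
     \<and> (\<forall>x\<in>C. \<rho> x \<in> C \<and> \<rho> (n x) = n (\<rho> x) \<and> \<chi> (\<rho> x) \<noteq> \<chi> x)
     \<and> inj_on \<rho> C
     \<and> (\<forall>A. A \<subseteq> C \<longrightarrow> A \<noteq> {} \<longrightarrow> \<rho> ` A \<subseteq> A \<longrightarrow> A = C)"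

lemma circleD:
  assumes "circle n \<chi> \<rho> C"
  shows "finite C"
    and "x \<in> C \<Longrightarrow> n x \<in> C" "x \<in> C \<Longrightarrow> n x \<noteq> x" "x \<in> C \<Longrightarrow> n (n x) = x" "x \<in> C \<Longrightarrow> \<chi> (n x) = \<chi> x"
    and "x \<in> C \<Longrightarrow> \<rho> x \<in> C" "x \<in> C \<Longrightarrow> \<rho> (n x) = n (\<rho> x)" "x \<in> C \<Longrightarrow> \<chi> (\<rho> x) \<noteq> \<chi> x"
    and "x \<in> C \<Longrightarrow> y \<in> C \<Longrightarrow> \<rho> x = \<rho> y \<Longrightarrow> x = y"
  using assms by (auto simp: circle_def inj_on_def)

lemma circle_closed:
  assumes "circle n \<chi> \<rho> C" "A \<subseteq> C" "x \<in> A" "\<And>y. y \<in> A \<Longrightarrow> \<rho> y \<in> A"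
  shows "A = C"
  using assms(1) unfolding circle_def using assms(2-) by (metis empty_iff image_subsetI)

text \<open>The four points that disappear when the neighbours \<open>x\<close> and \<open>\<rho> x\<close> are deleted together with their mirror images.\<close>

definition arc_ends :: "('a \<Rightarrow> 'a) \<Rightarrow> ('a \<Rightarrow> 'a) \<Rightarrow> 'a \<Rightarrow> 'a set" where
  "arc_ends n \<rho> x = {x, \<rho> x, n x, n (\<rho> x)}"

text \<open>The cycle \<open>\<rho>\<close> on the remaining points. Jumping over one deleted pair suffices: two deleted pairs are adjacent only if they
make up the whole circle (lemma \<open>rho_rho_in_arc_ends\<close>).\<close>

definition bypass :: "('a \<Rightarrow> 'a) \<Rightarrow> ('a \<Rightarrow> 'a) \<Rightarrow> 'a \<Rightarrow> 'a \<Rightarrow> 'a" where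
  "bypass n \<rho> x y = (if \<rho> y \<in> arc_ends n \<rho> x then \<rho> (\<rho> (\<rho> y)) else \<rho> y)"

lemma arc_ends_distinct:
  assumes "circle n \<chi> \<rho> C" "x \<in> C"
  shows "x \<noteq> \<rho> x" "x \<noteq> n x" "x \<noteq> n (\<rho> x)" "\<rho> x \<noteq> n x" "\<rho> x \<noteq> n (\<rho> x)" "n x \<noteq> n (\<rho> x)"
proof -
  have rx: "\<rho> x \<in> C" using circleD(6)[OF assms] .
  note c = circleD(8)[OF assms] circleD(5)[OF assms] circleD(5)[OF assms(1) rx]
  have ne: "u \<noteq> v" if "\<chi> u \<noteq> \<chi> v" for u v using that by blast
  show "x \<noteq> \<rho> x" by (rule ne) (use c in simp)
  show "x \<noteq> n (\<rho> x)" by (rule ne) (use c in simp)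
  show "\<rho> x \<noteq> n x" by (rule ne) (use c in simp)
  show "n x \<noteq> n (\<rho> x)" by (rule ne) (use c in simp)
  show "x \<noteq> n x" using circleD(3)[OF assms] by (rule not_sym)
  show "\<rho> x \<noteq> n (\<rho> x)" using circleD(3)[OF assms(1) rx] by (rule not_sym)
qed

lemma arc_ends_subset: "circle n \<chi> \<rho> C \<Longrightarrow> x \<in> C \<Longrightarrow> arc_ends n \<rho> x \<subseteq> C"
  using circleD(2,6)[of n \<chi> \<rho> C] by (auto simp: arc_ends_def)

lemma card_arc_ends:
  assumes "circle n \<chi> \<rho> C" "x \<in> C" shows "card (arc_ends n \<rho> x) = 4"
proof -
  note d = arc_ends_distinct[OF assms]
  have "n x \<noteq> \<rho> x" "n (\<rho> x) \<noteq> \<rho> x" "n (\<rho> x) \<noteq> x" "n x \<noteq> x"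
    using d by (simp_all add: eq_commute)
  then show ?thesis using d by (simp add: arc_ends_def)
qed

lemma n_arc_ends:
  assumes "circle n \<chi> \<rho> C" "x \<in> C" "y \<in> C"
  shows "n y \<in> arc_ends n \<rho> x \<longleftrightarrow> y \<in> arc_ends n \<rho> x"
proof -
  have nn: "n (n z) = z" if "z \<in> C" for z using circleD(4)[OF assms(1) that] .
  have "\<rho> x \<in> C" using circleD(6)[OF assms(1,2)] .
  then show ?thesis using nn assms(2,3) unfolding arc_ends_def by (smt (verit) insert_iff singletonD)
qed

lemma rho_rho_neq:
  assumes c: "circle n \<chi> \<rho> C" and x: "x \<in> C"
  shows "\<rho> (\<rho> x) \<noteq> x"
proof
  assume e: "\<rho> (\<rho> x) = x"
  have "{x, \<rho> x} = C"
    by (rule circle_closed[OF c, of _ x]) (use e x circleD(6)[OF c x] in auto)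
  then have "n x \<in> {x, \<rho> x}" using circleD(2)[OF c x] by simp
  then show False using arc_ends_distinct[OF c x] by auto
qed

lemma rho_rho_in_arc_ends:
  assumes c: "circle n \<chi> \<rho> C" and x: "x \<in> C" and k: "\<rho> (\<rho> x) \<in> arc_ends n \<rho> x"
  shows "\<rho> (\<rho> x) = n x" "C = arc_ends n \<rho> x"
proof -
  have rx: "\<rho> x \<in> C" using circleD(6)[OF c x] .
  have "\<chi> (\<rho> (\<rho> x)) = \<chi> x" using circleD(8)[OF c x] circleD(8)[OF c rx] by auto
  moreover have "\<chi> (\<rho> x) \<noteq> \<chi> x" "\<chi> (n (\<rho> x)) \<noteq> \<chi> x"
    using circleD(8)[OF c x] circleD(5)[OF c rx] by auto
  ultimately show e: "\<rho> (\<rho> x) = n x" using k rho_rho_neq[OF c x] by (auto simp: arc_ends_def)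
  have e2: "\<rho> (n x) = n (\<rho> x)" using circleD(7)[OF c x] .
  have e3: "\<rho> (n (\<rho> x)) = x" using circleD(7)[OF c rx] e circleD(4)[OF c x] by simp
  have "arc_ends n \<rho> x = C"
    by (rule circle_closed[OF c arc_ends_subset[OF c x], of x]) (auto simp: arc_ends_def e e2 e3)
  then show "C = arc_ends n \<rho> x" by simp
qed

lemma rho_in_arc_ends:
  assumes c: "circle n \<chi> \<rho> C" and x: "x \<in> C" and y: "y \<in> C" "y \<notin> arc_ends n \<rho> x"
    and k: "\<rho> y \<in> arc_ends n \<rho> x"
  obtains "\<rho> y = x" | "\<rho> y = n x"
proof -
  have "\<rho> y \<noteq> \<rho> x" using circleD(9)[OF c y(1) x] y(2) by (auto simp: arc_ends_def)
  moreover have "\<rho> y \<noteq> n (\<rho> x)"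
    using circleD(9)[OF c y(1) circleD(2)[OF c x]] circleD(7)[OF c x] y(2) by (auto simp: arc_ends_def)
  ultimately show thesis using k that by (auto simp: arc_ends_def)
qed

lemma circle_bypass_other:
  assumes c: "circle n \<chi> \<rho> C" and d: "arc_ends n \<rho> x \<inter> C = {}"
  shows "circle n \<chi> (bypass n \<rho> x) C"
proof -
  have e: "bypass n \<rho> x y = \<rho> y" if "y \<in> C" for y
    using circleD(6)[OF c that] d by (auto simp: bypass_def)
  then have "\<forall>y\<in>C. bypass n \<rho> x (n y) = \<rho> (n y)" using circleD(2)[OF c] by blast
  moreover have "inj_on (bypass n \<rho> x) C \<longleftrightarrow> inj_on \<rho> C"
    using e by (simp cong: inj_on_cong)
  moreover have "bypass n \<rho> x ` A = \<rho> ` A" if "A \<subseteq> C" for A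
    using that e by (intro image_cong) auto
  ultimately show ?thesis using c unfolding circle_def by (simp add: e)
qed

text \<open>A closed set of the shortened circle becomes closed in the original one when each deleted pair that it jumps over is
added.\<close>

lemma circle_bypass:
  assumes c: "circle n \<chi> \<rho> C" and x: "x \<in> C"
  shows "circle n \<chi> (bypass n \<rho> x) (C - arc_ends n \<rho> x)"
proof -
  let ?K = "arc_ends n \<rho> x" and ?r = "bypass n \<rho> x"
  have rx: "\<rho> x \<in> C" and nx: "n x \<in> C" using circleD(6,2)[OF c x] .
  have rnx: "\<rho> (n x) = n (\<rho> x)" using circleD(7)[OF c x] .
  have r3: "\<rho> (\<rho> (\<rho> y)) \<in> C - ?K" if y: "y \<in> C - ?K" and k: "\<rho> y \<in> ?K" for y
  proof -
    have "C \<noteq> ?K" using y by blast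
    then have *: "\<rho> (\<rho> x) \<notin> ?K" using rho_rho_in_arc_ends[OF c x] by blast
    have **: "\<rho> (\<rho> (n x)) = n (\<rho> (\<rho> x))" using rnx circleD(7)[OF c rx] by simp
    have "\<rho> (\<rho> x) \<in> C" "n (\<rho> (\<rho> x)) \<in> C" using circleD(6)[OF c rx] circleD(2)[OF c circleD(6)[OF c rx]] .
    moreover have "n (\<rho> (\<rho> x)) \<notin> ?K" using * n_arc_ends[OF c x circleD(6)[OF c rx]] by blast
    ultimately show ?thesis
      using rho_in_arc_ends[OF c x _ _ k] y * ** by (metis DiffD1 DiffD2 DiffI)
  qed
  have r: "?r y \<in> C - ?K" if "y \<in> C - ?K" for y
    using r3[OF that] that circleD(6)[OF c, of y] by (auto simp: bypass_def)
  have nK: "n y \<in> C - ?K" if "y \<in> C - ?K" for y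
    using that n_arc_ends[OF c x, of y] circleD(2)[OF c, of y] by blast
  have rn: "?r (n y) = n (?r y)" if y: "y \<in> C - ?K" for y
  proof -
    have yC: "y \<in> C" using y by blast
    note y1 = circleD(6)[OF c yC]
    note y2 = circleD(6)[OF c y1]
    show ?thesis
      unfolding bypass_def circleD(7)[OF c yC] n_arc_ends[OF c x y1]
      using circleD(7)[OF c y1] circleD(7)[OF c y2] by simp
  qed
  have rc: "\<chi> (?r y) \<noteq> \<chi> y" if y: "y \<in> C - ?K" for y
  proof -
    have yC: "y \<in> C" using y by blast
    note y1 = circleD(6)[OF c yC]
    note y2 = circleD(6)[OF c y1]
    show ?thesis
      unfolding bypass_def using circleD(8)[OF c yC] circleD(8)[OF c y1] circleD(8)[OF c y2] by auto
  qed
  have ri: "inj_on ?r (C - ?K)"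
  proof (rule inj_onI)
    fix y z assume y: "y \<in> C - ?K" and z: "z \<in> C - ?K" and e: "?r y = ?r z"
    have C: "\<rho> w \<in> C" "\<rho> (\<rho> w) \<in> C" if "w \<in> C" for w using that circleD(6)[OF c] by blast+
    have no: False if "u \<in> C - ?K" "w \<in> C - ?K" "\<rho> u \<in> ?K" "\<rho> (\<rho> (\<rho> u)) = \<rho> w" for u w
    proof -
      have "\<rho> (\<rho> u) = w"
        by (rule circleD(9)[OF c _ _ that(4)]) (use that(1,2) C in auto)
      moreover have "\<rho> (\<rho> u) \<in> ?K"
      proof -
        have "u \<in> C" "u \<notin> ?K" using that(1) by blast+
        from rho_in_arc_ends[OF c x this that(3)] show ?thesis
          by cases (simp_all add: arc_ends_def rnx)
      qed
      ultimately show False using that(2) by blast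
    qed
    have inj: "\<rho> u = \<rho> w \<Longrightarrow> u = w" if "u \<in> C" "w \<in> C" for u w using circleD(9)[OF c that] .
    have yC: "y \<in> C" and zC: "z \<in> C" using y z by blast+
    have in_K: "?r w = \<rho> (\<rho> (\<rho> w))" if "\<rho> w \<in> ?K" for w
      unfolding bypass_def using that by (rule if_P)
    have out_K: "?r w = \<rho> w" if "\<rho> w \<notin> ?K" for w
      unfolding bypass_def using that by (rule if_not_P)
    show "y = z"
    proof (cases "\<rho> y \<in> ?K"; cases "\<rho> z \<in> ?K")
      assume k: "\<rho> y \<in> ?K" "\<rho> z \<in> ?K"
      have "\<rho> (\<rho> (\<rho> y)) = \<rho> (\<rho> (\<rho> z))" using e unfolding in_K[OF k(1)] in_K[OF k(2)] .
      then have "\<rho> (\<rho> y) = \<rho> (\<rho> z)" by (rule inj[OF C(2)[OF yC] C(2)[OF zC]])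
      then have "\<rho> y = \<rho> z" by (rule inj[OF C(1)[OF yC] C(1)[OF zC]])
      then show ?thesis by (rule inj[OF yC zC])
    next
      assume k: "\<rho> y \<in> ?K" "\<rho> z \<notin> ?K"
      have "\<rho> (\<rho> (\<rho> y)) = \<rho> z" using e unfolding in_K[OF k(1)] out_K[OF k(2)] .
      then show ?thesis by (rule no[OF y z k(1), THEN FalseE])
    next
      assume k: "\<rho> y \<notin> ?K" "\<rho> z \<in> ?K"
      have "\<rho> (\<rho> (\<rho> z)) = \<rho> y" using e[symmetric] unfolding in_K[OF k(2)] out_K[OF k(1)] .
      then show ?thesis by (rule no[OF z y k(2), THEN FalseE])
    next
      assume k: "\<rho> y \<notin> ?K" "\<rho> z \<notin> ?K"
      have "\<rho> y = \<rho> z" using e unfolding out_K[OF k(1)] out_K[OF k(2)] .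
      then show ?thesis by (rule inj[OF yC zC])
    qed
  qed
  have cl: "A = C - ?K" if A: "A \<subseteq> C - ?K" "A \<noteq> {}" "?r ` A \<subseteq> A" for A
  proof -
    obtain a where a: "a \<in> A" using A(2) by blast
    \<comment> \<open>The set \<open>A\<close> together with each deleted pair that is entered from \<open>A\<close>.\<close>
    define B where "B = A \<union> {z. \<exists>y\<in>A. \<rho> y = x \<and> (z = x \<or> z = \<rho> x)} \<union> {z. \<exists>y\<in>A. \<rho> y = n x \<and> (z = n x \<or> z = n (\<rho> x))}"
    have "B = C"
    proof (rule circle_closed[OF c, of _ a])
      show "B \<subseteq> C" using A(1) x rx nx circleD(2)[OF c rx] by (auto simp: B_def)
      show "a \<in> B" using a by (simp add: B_def)
      fix z assume "z \<in> B"
      then consider "z \<in> A" | y where "y \<in> A" "\<rho> y = x" "z = x \<or> z = \<rho> x"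
        | y where "y \<in> A" "\<rho> y = n x" "z = n x \<or> z = n (\<rho> x)" unfolding B_def by blast
      then show "\<rho> z \<in> B"
      proof cases
        case 1
        show ?thesis
        proof (cases "\<rho> z \<in> ?K")
          case True
          show ?thesis
            using rho_in_arc_ends[OF c x _ _ True] 1 A(1) unfolding B_def by blast
        next
          case False
          then have "?r z = \<rho> z" by (simp add: bypass_def)
          then show ?thesis using 1 A(3) by (auto simp: B_def)
        qed
      next
        case 2
        then have "?r y = \<rho> (\<rho> x)" by (simp add: bypass_def arc_ends_def)
        then have "\<rho> (\<rho> x) \<in> A" using 2 A(3) by auto
        then show ?thesis using 2 by (auto simp: B_def)
      next
        case 3
        then have "?r y = \<rho> (n (\<rho> x))" by (simp add: bypass_def arc_ends_def rnx)
        then have "\<rho> (n (\<rho> x)) \<in> A" using 3 A(3) by auto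
        then show ?thesis using 3 rnx by (auto simp: B_def)
      qed
    qed
    moreover have "B \<subseteq> A \<union> ?K" unfolding B_def arc_ends_def by blast
    moreover have "A \<subseteq> B" unfolding B_def by blast
    ultimately show ?thesis using A(1) by blast
  qed
  have n: "n y \<in> C - ?K \<and> n y \<noteq> y \<and> n (n y) = y \<and> \<chi> (n y) = \<chi> y" if "y \<in> C - ?K" for y
    using nK[OF that] circleD(3-5)[OF c, of y] that by blast
  show ?thesis
    unfolding circle_def using circleD(1)[OF c] n r rn rc ri cl by simp
qed


definition two_circles where
  "two_circles n \<chi> \<rho> C1 C2 \<longleftrightarrow> circle n \<chi> \<rho> C1 \<and> circle n \<chi> \<rho> C2 \<and> C1 \<inter> C2 = {}"

lemma two_circlesD:
  assumes "two_circles n \<chi> \<rho> C1 C2" "x \<in> C1 \<union> C2"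
  shows "n x \<in> C1 \<longleftrightarrow> x \<in> C1" "n x \<in> C1 \<union> C2" "n x \<noteq> x" "n (n x) = x" "\<chi> (n x) = \<chi> x"
    "\<rho> x \<in> C1 \<longleftrightarrow> x \<in> C1" "\<rho> x \<in> C1 \<union> C2" "\<rho> (n x) = n (\<rho> x)" "\<chi> (\<rho> x) \<noteq> \<chi> x"
proof -
  have d: "C1 \<inter> C2 = {}" using assms(1) by (simp add: two_circles_def)
  from assms have "(circle n \<chi> \<rho> C1 \<and> x \<in> C1) \<or> (circle n \<chi> \<rho> C2 \<and> x \<in> C2)"
    by (auto simp: two_circles_def)
  then obtain C where C: "circle n \<chi> \<rho> C" "x \<in> C" "C = C1 \<or> C = C2" by blast
  note c = circleD(2-8)[OF C(1,2)]
  show "n x \<noteq> x" "n (n x) = x" "\<chi> (n x) = \<chi> x" "\<rho> (n x) = n (\<rho> x)" "\<chi> (\<rho> x) \<noteq> \<chi> x" using c by blast+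
  show "n x \<in> C1 \<longleftrightarrow> x \<in> C1" "n x \<in> C1 \<union> C2" "\<rho> x \<in> C1 \<longleftrightarrow> x \<in> C1" "\<rho> x \<in> C1 \<union> C2"
    using c C(2,3) d by blast+
qed

lemma two_circles_inj:
  assumes c: "two_circles n \<chi> \<rho> C1 C2" and x: "x \<in> C1 \<union> C2" and y: "y \<in> C1 \<union> C2" and e: "\<rho> x = \<rho> y"
  shows "x = y"
proof -
  have "x \<in> C1 \<longleftrightarrow> y \<in> C1" using two_circlesD(6)[OF c x] two_circlesD(6)[OF c y] e by simp
  then have "(x \<in> C1 \<and> y \<in> C1) \<or> (x \<in> C2 \<and> y \<in> C2)" using x y by blast
  then show ?thesis using circleD(9)[of n \<chi> \<rho> C1 x y] circleD(9)[of n \<chi> \<rho> C2 x y] c e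
    unfolding two_circles_def by blast
qed

lemma two_circles_finite: "two_circles n \<chi> \<rho> C1 C2 \<Longrightarrow> finite (C1 \<union> C2)"
  using circleD(1) by (auto simp: two_circles_def)

lemma two_circles_home:
  assumes "two_circles n \<chi> \<rho> C1 C2" "x \<in> C1 \<union> C2"
  obtains C where "circle n \<chi> \<rho> C" "x \<in> C" "C \<subseteq> C1 \<union> C2" "\<And>y. y \<in> C1 \<union> C2 \<Longrightarrow> y \<in> C \<longleftrightarrow> (y \<in> C1 \<longleftrightarrow> x \<in> C1)"
proof (cases "x \<in> C1")
  case True then show thesis using assms by (intro that[of C1]) (auto simp: two_circles_def)
next
  case False then show thesis using assms by (intro that[of C2]) (auto simp: two_circles_def)
qed

lemma two_circles_bypass:
  assumes c: "two_circles n \<chi> \<rho> C1 C2" and x: "x \<in> C1 \<union> C2"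
  shows "two_circles n \<chi> (bypass n \<rho> x) (C1 - arc_ends n \<rho> x) (C2 - arc_ends n \<rho> x)"
proof -
  have *: "circle n \<chi> (bypass n \<rho> x) (A - arc_ends n \<rho> x) \<and> circle n \<chi> (bypass n \<rho> x) (B - arc_ends n \<rho> x)"
    if "circle n \<chi> \<rho> A" "circle n \<chi> \<rho> B" "A \<inter> B = {}" "x \<in> A" for A B
  proof -
    have "arc_ends n \<rho> x \<inter> B = {}" using arc_ends_subset[OF that(1,4)] that(3) by blast
    moreover from this have "B - arc_ends n \<rho> x = B" by blast
    ultimately show ?thesis
      using circle_bypass[OF that(1,4)] circle_bypass_other[OF that(2)] by simp
  qed
  show ?thesis
    using *[of C1 C2] *[of C2 C1] c x unfolding two_circles_def by blast
qed

lemma arc_ends_facts: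
  assumes c: "two_circles n \<chi> \<rho> C1 C2" and x: "x \<in> C1 \<union> C2"
  shows "distinct [x, \<rho> x, n x, n (\<rho> x)]" "arc_ends n \<rho> x \<subseteq> C1 \<union> C2" "card (arc_ends n \<rho> x) = 4"
    "y \<in> C1 \<union> C2 \<Longrightarrow> n y \<in> arc_ends n \<rho> x \<longleftrightarrow> y \<in> arc_ends n \<rho> x"
    "\<rho> (\<rho> x) \<noteq> x"
    "\<rho> (\<rho> x) \<in> arc_ends n \<rho> x \<Longrightarrow> \<rho> (\<rho> x) = n x"
    "y \<in> C1 \<union> C2 \<Longrightarrow> y \<notin> arc_ends n \<rho> x \<Longrightarrow> \<rho> y \<in> arc_ends n \<rho> x \<Longrightarrow> \<rho> y = x \<or> \<rho> y = n x"
proof -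
  obtain C where C: "circle n \<chi> \<rho> C" "x \<in> C" "C \<subseteq> C1 \<union> C2" "\<And>y. y \<in> C1 \<union> C2 \<Longrightarrow> y \<in> C \<longleftrightarrow> (y \<in> C1 \<longleftrightarrow> x \<in> C1)"
    using two_circles_home[OF c x] by blast
  show "distinct [x, \<rho> x, n x, n (\<rho> x)]" using arc_ends_distinct[OF C(1,2)] by simp
  show "arc_ends n \<rho> x \<subseteq> C1 \<union> C2" using arc_ends_subset[OF C(1,2)] C(3) by blast
  show "card (arc_ends n \<rho> x) = 4" by (rule card_arc_ends[OF C(1,2)])
  show "\<rho> (\<rho> x) \<noteq> x" by (rule rho_rho_neq[OF C(1,2)])
  show "\<rho> (\<rho> x) \<in> arc_ends n \<rho> x \<Longrightarrow> \<rho> (\<rho> x) = n x" by (rule rho_rho_in_arc_ends(1)[OF C(1,2)])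
  show "n y \<in> arc_ends n \<rho> x \<longleftrightarrow> y \<in> arc_ends n \<rho> x" if y: "y \<in> C1 \<union> C2"
  proof (cases "y \<in> C")
    case True then show ?thesis by (rule n_arc_ends[OF C(1,2)])
  next
    case False
    then have "n y \<notin> C" using C(4)[OF y] C(4)[OF two_circlesD(2)[OF c y]] two_circlesD(1)[OF c y] by simp
    then show ?thesis using False arc_ends_subset[OF C(1,2)] by blast
  qed
  show "\<rho> y = x \<or> \<rho> y = n x" if y: "y \<in> C1 \<union> C2" "y \<notin> arc_ends n \<rho> x" "\<rho> y \<in> arc_ends n \<rho> x"
  proof -
    have "\<rho> y \<in> C" using y(3) arc_ends_subset[OF C(1,2)] by blast
    then have "y \<in> C" using C(4)[OF y(1)] C(4)[OF two_circlesD(7)[OF c y(1)]] two_circlesD(6)[OF c y(1)] by simp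
    then show ?thesis using rho_in_arc_ends[OF C(1,2) _ y(2,3)] by blast
  qed
qed

section \<open>Pairings and their arcs\<close>

definition pairings :: "('a \<Rightarrow> 'a) \<Rightarrow> ('a \<Rightarrow> bool) \<Rightarrow> 'a set \<Rightarrow> ('a \<Rightarrow> 'a) set" where
  "pairings n \<chi> D = {\<sigma>. \<sigma> permutes D \<and> (\<forall>x\<in>D. \<sigma> (\<sigma> x) = x \<and> \<sigma> (n x) = n (\<sigma> x) \<and> \<chi> (\<sigma> x) \<noteq> \<chi> x)}"

lemma pairingsD:
  assumes "\<sigma> \<in> pairings n \<chi> D"
  shows "\<sigma> permutes D" "x \<in> D \<Longrightarrow> \<sigma> x \<in> D" "x \<in> D \<Longrightarrow> \<sigma> (\<sigma> x) = x"
    "x \<in> D \<Longrightarrow> \<sigma> (n x) = n (\<sigma> x)" "x \<in> D \<Longrightarrow> \<chi> (\<sigma> x) \<noteq> \<chi> x" "x \<notin> D \<Longrightarrow> \<sigma> x = x"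
  using assms by (auto simp: pairings_def permutes_in_image permutes_not_in)

lemma pairingsI:
  assumes "\<And>x. x \<in> D \<Longrightarrow> \<sigma> x \<in> D" "\<And>x. x \<notin> D \<Longrightarrow> \<sigma> x = x" "\<And>x. x \<in> D \<Longrightarrow> \<sigma> (\<sigma> x) = x"
    "\<And>x. x \<in> D \<Longrightarrow> \<sigma> (n x) = n (\<sigma> x)" "\<And>x. x \<in> D \<Longrightarrow> \<chi> (\<sigma> x) \<noteq> \<chi> x"
  shows "\<sigma> \<in> pairings n \<chi> D"
proof -
  have "bij_betw \<sigma> D D"
    by (rule bij_betw_byWitness[where f' = \<sigma>]) (use assms(1,3) in auto)
  then have "\<sigma> permutes D" using assms(2) by (rule bij_imp_permutes)
  then show ?thesis using assms(3-5) by (simp add: pairings_def)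
qed

definition remove_arc :: "'a set \<Rightarrow> ('a \<Rightarrow> 'a) \<Rightarrow> 'a \<Rightarrow> 'a" where
  "remove_arc K \<sigma> y = (if y \<in> K then y else \<sigma> y)"

definition insert_arc :: "('a \<Rightarrow> 'a) \<Rightarrow> ('a \<Rightarrow> 'a) \<Rightarrow> 'a \<Rightarrow> ('a \<Rightarrow> 'a) \<Rightarrow> 'a \<Rightarrow> 'a" where
  "insert_arc n \<rho> x \<sigma> y = (if y = x then \<rho> x else if y = \<rho> x then x
     else if y = n x then n (\<rho> x) else if y = n (\<rho> x) then n x else \<sigma> y)"

text \<open>The situation in which the neighbours \<open>x\<close> and \<open>\<rho> x\<close> and their mirror images are deleted; primes and differences
with \<open>K\<close> refer to what remains.\<close>

locale arc_removal =
  fixes n :: "'a \<Rightarrow> 'a" and \<chi> :: "'a \<Rightarrow> bool" and \<rho> :: "'a \<Rightarrow> 'a" and C1 C2 :: "'a set" and x :: 'a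
  assumes circles: "two_circles n \<chi> \<rho> C1 C2" and x_in: "x \<in> C1 \<union> C2"
begin

abbreviation "D \<equiv> C1 \<union> C2"
abbreviation "K \<equiv> arc_ends n \<rho> x"
abbreviation "\<rho>' \<equiv> bypass n \<rho> x"

lemmas facts = arc_ends_facts[OF circles x_in]
lemmas on_D = two_circlesD[OF circles]

lemma K_mem: "x \<in> K" "\<rho> x \<in> K" "n x \<in> K" "n (\<rho> x) \<in> K"
  by (simp_all add: arc_ends_def)

lemma K_cases: "y \<in> K \<Longrightarrow> y = x \<or> y = \<rho> x \<or> y = n x \<or> y = n (\<rho> x)"
  by (simp add: arc_ends_def)

lemma rx_in: "\<rho> x \<in> D" "n x \<in> D" "n (\<rho> x) \<in> D" "\<rho> (\<rho> x) \<in> D"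
  using on_D(7)[OF x_in] on_D(2)[OF x_in] on_D(2,7) by blast+

lemma n_rho: "\<rho> (n x) = n (\<rho> x)" "\<rho> (n (\<rho> x)) = n (\<rho> (\<rho> x))" "n (n x) = x" "n (n (\<rho> x)) = \<rho> x"
  using on_D(8)[OF x_in] on_D(8)[OF rx_in(1)] on_D(4)[OF x_in] on_D(4)[OF rx_in(1)] by blast+

lemma K_color: "y \<in> K \<Longrightarrow> y \<in> C1 \<longleftrightarrow> x \<in> C1"
  using K_cases[of y] on_D(6)[OF x_in] on_D(1)[OF x_in] on_D(1)[OF rx_in(1)] by blast

lemma bypass_in: "\<rho> y \<in> K \<Longrightarrow> \<rho>' y = \<rho> (\<rho> (\<rho> y))" and bypass_out: "\<rho> y \<notin> K \<Longrightarrow> \<rho>' y = \<rho> y"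
  by (simp_all add: bypass_def)

lemma bypass_cases:
  assumes "y \<in> D" "y \<notin> K"
  obtains "\<rho> y \<notin> K" "\<rho>' y = \<rho> y"
    | "\<rho> y = x" "\<rho>' y = \<rho> (\<rho> x)"
    | "\<rho> y = n x" "\<rho>' y = n (\<rho> (\<rho> x))"
proof (cases "\<rho> y \<in> K")
  case True
  from facts(7)[OF assms True] show thesis
  proof
    assume e: "\<rho> y = x"
    with bypass_in[OF True] that(2) show thesis by simp
  next
    assume e: "\<rho> y = n x"
    with bypass_in[OF True] that(3) n_rho show thesis by simp
  qed
qed (use that(1) bypass_out in blast)

lemma bypass_D': "y \<in> D \<Longrightarrow> y \<notin> K \<Longrightarrow> \<rho>' y \<in> D \<and> \<rho>' y \<notin> K"
  using two_circlesD(7)[OF two_circles_bypass[OF circles x_in], of y] by auto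

context
  fixes \<sigma>
  assumes \<sigma>: "\<sigma> \<in> pairings n \<chi> D" and arc: "\<sigma> x = \<rho> x"
begin

lemma sigma_K_eqs: "\<sigma> x = \<rho> x" "\<sigma> (\<rho> x) = x" "\<sigma> (n x) = n (\<rho> x)" "\<sigma> (n (\<rho> x)) = n x"
  using arc pairingsD(3)[OF \<sigma> x_in] pairingsD(4)[OF \<sigma> x_in] pairingsD(4)[OF \<sigma> rx_in(1)] by simp_all

lemma sigma_K: "y \<in> D \<Longrightarrow> \<sigma> y \<in> K \<longleftrightarrow> y \<in> K"
proof -
  assume y: "y \<in> D"
  have *: "\<sigma> z \<in> K" if "z \<in> K" for z
    using K_cases[OF that] sigma_K_eqs K_mem by (elim disjE) simp_all
  show ?thesis using *[of y] *[of "\<sigma> y"] pairingsD(3)[OF \<sigma> y] by auto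
qed

lemma remove_in_pairings: "remove_arc K \<sigma> \<in> pairings n \<chi> (D - K)"
proof (rule pairingsI)
  fix y assume y: "y \<in> D - K"
  then have yD: "y \<in> D" and yK: "y \<notin> K" by blast+
  have sy: "\<sigma> y \<in> D - K" using pairingsD(2)[OF \<sigma> yD] sigma_K[OF yD] yK by blast
  have ny: "n y \<notin> K" using facts(4)[OF yD] yK by blast
  show "remove_arc K \<sigma> y \<in> D - K" using sy yK by (simp add: remove_arc_def)
  show "remove_arc K \<sigma> (remove_arc K \<sigma> y) = y" using sy yK pairingsD(3)[OF \<sigma> yD] by (simp add: remove_arc_def)
  show "remove_arc K \<sigma> (n y) = n (remove_arc K \<sigma> y)" using yK ny pairingsD(4)[OF \<sigma> yD] by (simp add: remove_arc_def)
  show "\<chi> (remove_arc K \<sigma> y) \<noteq> \<chi> y" using yK pairingsD(5)[OF \<sigma> yD] by (simp add: remove_arc_def)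
next
  fix y assume "y \<notin> D - K"
  then show "remove_arc K \<sigma> y = y" using pairingsD(6)[OF \<sigma>, of y] by (auto simp: remove_arc_def)
qed

lemma insert_remove: "insert_arc n \<rho> x (remove_arc K \<sigma>) = \<sigma>"
proof
  fix y
  show "insert_arc n \<rho> x (remove_arc K \<sigma>) y = \<sigma> y"
  proof (cases "y \<in> K")
    case True
    then show ?thesis using K_cases[OF True] sigma_K_eqs facts(1) by (auto simp: insert_arc_def)
  next
    case False
    then show ?thesis using K_mem by (auto simp: insert_arc_def remove_arc_def)
  qed
qed

text \<open>Both ends of a deleted arc are on the same circle, so no chord that crosses between the circles is lost.\<close>

lemma crossings_remove:
  "{y \<in> C1 \<union> C2. (y \<in> C1) \<noteq> (\<sigma> y \<in> C1)}
   = {y \<in> (C1 - K) \<union> (C2 - K). (y \<in> C1 - K) \<noteq> (remove_arc K \<sigma> y \<in> C1 - K)}"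
proof -
  have "(y \<in> C1) = (\<sigma> y \<in> C1)" if "y \<in> K" for y
  proof -
    have "y \<in> D" using that facts(2) by blast
    then have "\<sigma> y \<in> K" using sigma_K that by simp
    then show ?thesis using K_color that by simp
  qed
  moreover have "\<sigma> y \<notin> K" if "y \<in> D" "y \<notin> K" for y using sigma_K that by simp
  ultimately show ?thesis by (auto simp: remove_arc_def)
qed

lemma remove_arc_step:
  assumes "y \<in> D" "y \<notin> K"
  shows "remove_arc K \<sigma> (\<rho>' y) = \<sigma> (\<rho>' y)"
  using bypass_D'[OF assms] by (simp add: remove_arc_def)

text \<open>The point \<open>x\<close> is a fixed point of \<open>\<sigma> \<circ> \<rho>\<close>, which contributes a free value, and \<open>\<rho> x\<close> is skipped in its cycle: the value there
is the one at its successor \<open>u\<close>. The exceptional case is \<open>u = n (\<rho> x)\<close>, when the cycle consists of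
\<open>\<rho> x\<close> and its mirror image and the value is zero by oddness.\<close>

lemma card_fixed_functions_remove:
  "card (fixed_functions n D (\<sigma> \<circ> \<rho>)) = 3 * card (fixed_functions n (D - K) (remove_arc K \<sigma> \<circ> \<rho>'))"
proof -
  let ?A = "fixed_functions n D (\<sigma> \<circ> \<rho>)" and ?B = "fixed_functions n (D - K) (remove_arc K \<sigma> \<circ> \<rho>')"
  define \<Phi> :: "('a \<Rightarrow> 3) \<Rightarrow> 3 \<times> ('a \<Rightarrow> 3)" where "\<Phi> = (\<lambda>f. (f x, \<lambda>y. if y \<in> D - K then f y else 0))"
  define u where "u = \<sigma> (\<rho> (\<rho> x))"
  have uD: "u \<in> D" unfolding u_def using pairingsD(2)[OF \<sigma> rx_in(4)] .
  have uK: "u \<in> K \<Longrightarrow> u = n (\<rho> x)"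
  proof -
    assume "u \<in> K"
    then have "\<rho> (\<rho> x) \<in> K" unfolding u_def using sigma_K[OF rx_in(4)] by simp
    then show "u = n (\<rho> x)" using facts(6) sigma_K_eqs by (simp add: u_def)
  qed
  have nu: "\<sigma> (n (\<rho> (\<rho> x))) = n u" unfolding u_def using pairingsD(4)[OF \<sigma> rx_in(4)] .
  have Aodd: "f (n y) = - f y" and Afix: "f (\<sigma> (\<rho> y)) = f y" if "f \<in> ?A" "y \<in> D" for f y
    using that by (auto simp: fixed_functions_def odd_functions_def)
  have Azero: "f y = 0" if "f \<in> ?A" "y \<notin> D" for f y
    using that by (auto simp: fixed_functions_def odd_functions_def)
  have "bij_betw \<Phi> ?A (UNIV \<times> ?B)"
    unfolding bij_betw_def
  proof (intro conjI set_eqI iffI)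
    show "inj_on \<Phi> ?A"
    proof (rule inj_onI)
      fix f g assume f: "f \<in> ?A" and g: "g \<in> ?A" and e: "\<Phi> f = \<Phi> g"
      have ex: "f x = g x" using e by (simp add: \<Phi>_def)
      have eD: "f y = g y" if "y \<in> D" "y \<notin> K" for y
        using fun_cong[OF arg_cong[OF e, of snd], of y] that by (simp add: \<Phi>_def)
      have enx: "f (n x) = g (n x)" using ex Aodd[OF f x_in] Aodd[OF g x_in] by simp
      have u: "f (\<rho> x) = f u" if "f \<in> ?A" for f
        unfolding u_def using Afix[OF that rx_in(1)] by simp
      have er: "f (\<rho> x) = g (\<rho> x)"
      proof (cases "u \<in> K")
        case True
        have h0: "h (\<rho> x) = 0" if h: "h \<in> ?A" for h
          using u[OF h] Aodd[OF h rx_in(1)] uK[OF True] by (intro z3_double) simp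
        show ?thesis using h0[OF f] h0[OF g] by simp
      next
        case False
        then show ?thesis using eD[OF uD] u[OF f] u[OF g] by simp
      qed
      have enr: "f (n (\<rho> x)) = g (n (\<rho> x))" using er Aodd[OF f rx_in(1)] Aodd[OF g rx_in(1)] by simp
      show "f = g"
      proof
        fix y
        consider "y \<notin> D" | "y \<in> D" "y \<notin> K" | "y \<in> K" by blast
        then show "f y = g y"
        proof cases
          case 1 then show ?thesis using Azero[OF f] Azero[OF g] by simp
        next
          case 2 then show ?thesis by (rule eD)
        next
          case 3 then show ?thesis using K_cases[OF 3] ex enx er enr by auto
        qed
      qed
    qed
  next
    fix p assume "p \<in> \<Phi> ` ?A"
    then obtain f where f: "f \<in> ?A" and p: "p = \<Phi> f" by blast
    let ?g = "\<lambda>y. if y \<in> D - K then f y else 0"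
    have "?g \<in> ?B"
      unfolding fixed_functions_def odd_functions_def mem_Collect_eq
    proof (intro conjI ballI allI impI)
      fix y assume y: "y \<in> D - K"
      then have yD: "y \<in> D" and yK: "y \<notin> K" by blast+
      show "?g (n y) = - ?g y"
        using y on_D(2)[OF yD] facts(4)[OF yD] Aodd[OF f yD] by simp
      have r: "remove_arc K \<sigma> (\<rho>' y) = \<sigma> (\<rho>' y)" using yD yK by (rule remove_arc_step)
      have r': "\<sigma> (\<rho>' y) \<in> D - K"
        using bypass_D'[OF yD yK] sigma_K[of "\<rho>' y"] pairingsD(2)[OF \<sigma>, of "\<rho>' y"] by simp
      have "f (\<sigma> (\<rho>' y)) = f y"
      proof (rule bypass_cases[OF yD yK])
        assume "\<rho>' y = \<rho> y" then show ?thesis using Afix[OF f yD] by simp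
      next
        assume e: "\<rho> y = x" "\<rho>' y = \<rho> (\<rho> x)"
        show ?thesis unfolding e(2) using Afix[OF f yD] Afix[OF f rx_in(1)] sigma_K_eqs(1) e(1) by simp
      next
        assume e: "\<rho> y = n x" "\<rho>' y = n (\<rho> (\<rho> x))"
        show ?thesis unfolding e(2)
          using Afix[OF f yD] Afix[OF f rx_in(3)] sigma_K_eqs(3) e(1) n_rho(2) by simp
      qed
      then show "?g ((remove_arc K \<sigma> \<circ> \<rho>') y) = ?g y" using y r r' by simp
    next
      fix y assume "y \<notin> D - K"
      then show "?g y = 0" by (simp only: if_False)
    qed
    then show "p \<in> UNIV \<times> ?B" by (simp add: p \<Phi>_def)
  next
    fix p assume "p \<in> (UNIV :: 3 set) \<times> ?B"
    then obtain v g where p: "p = (v, g)" and g: "g \<in> ?B" by blast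
    have gfix: "g (\<sigma> (\<rho>' y)) = g y" if "y \<in> D" "y \<notin> K" for y
    proof -
      have "g ((remove_arc K \<sigma> \<circ> \<rho>') y) = g y"
        using g that unfolding fixed_functions_def by blast
      then show ?thesis using remove_arc_step[OF that] by simp
    qed
    have godd: "g (n y) = - g y" if "y \<in> D" "y \<notin> K" for y
      using g that by (auto simp: fixed_functions_def odd_functions_def)
    have gzero: "g y = 0" if "y \<notin> D \<or> y \<in> K" for y
      using g that by (auto simp: fixed_functions_def odd_functions_def)
    \<comment> \<open>The preimage of \<open>(v, g)\<close>: the value at \<open>\<rho> x\<close> is taken from the point \<open>u\<close> that follows it in its cycle.\<close>
    define f where "f y = (if y = x then v else if y = n x then - v else if y = \<rho> x then g u
      else if y = n (\<rho> x) then - g u else g y)" for y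
    have fx: "f x = v" "f (n x) = - v" "f (\<rho> x) = g u" "f (n (\<rho> x)) = - g u"
      using facts(1) by (auto simp: f_def)
    have fK: "f y = g y" if "y \<notin> K" for y using that K_mem by (auto simp: f_def)
    have fodd: "f (n y) = - f y" if "y \<in> D" for y
    proof (cases "y \<in> K")
      case True
      then show ?thesis using K_cases[OF True] fx n_rho by auto
    next
      case False
      then show ?thesis using godd[OF that False] fK facts(4)[OF that] by simp
    qed
    have fu: "f u = g u"
    proof (cases "u \<in> K")
      case True
      then show ?thesis using uK fx(4) gzero[of u] by simp
    qed (rule fK)
    have ffix: "f (\<sigma> (\<rho> y)) = f y" if y: "y \<in> D" for y
    proof (cases "y \<in> K")
      case True
      then consider "y = x" | "y = \<rho> x" | "y = n x" | "y = n (\<rho> x)" using K_cases by blast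
      then show ?thesis
      proof cases
        case 1 then show ?thesis using sigma_K_eqs by simp
      next
        case 2 then show ?thesis using fu fx by (simp add: u_def[symmetric])
      next
        case 3 then show ?thesis using sigma_K_eqs n_rho by simp
      next
        case 4 then show ?thesis using fu fx fodd[OF uD] n_rho nu by simp
      qed
    next
      case False
      show ?thesis
      proof (rule bypass_cases[OF y False])
        assume e: "\<rho> y \<notin> K" "\<rho>' y = \<rho> y"
        have "\<sigma> (\<rho> y) \<notin> K" using sigma_K[OF on_D(7)[OF y]] e(1) by simp
        then show ?thesis using gfix[OF y False] fK False e(2) by simp
      next
        assume e: "\<rho> y = x" "\<rho>' y = \<rho> (\<rho> x)"
        show ?thesis using gfix[OF y False] fK[OF False] fx sigma_K_eqs by (simp add: e u_def)
      next
        assume e: "\<rho> y = n x" "\<rho>' y = n (\<rho> (\<rho> x))"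
        have "u \<notin> K"
        proof
          assume "u \<in> K"
          then have "n u \<in> K" using facts(4)[OF uD] by simp
          moreover have "\<rho>' y \<in> D" "\<rho>' y \<notin> K" using bypass_D'[OF y False] by auto
          then have "\<sigma> (\<rho>' y) \<notin> K" using sigma_K by blast
          ultimately show False using e(2) nu by simp
        qed
        then have "g (n u) = - g u" using godd uD by blast
        then show ?thesis using gfix[OF y False] fK[OF False] fx sigma_K_eqs e nu by simp
      qed
    qed
    have "f y = 0" if "y \<notin> D" for y
      using fK[of y] gzero[of y] that facts(2) by auto
    then have "f \<in> ?A"
      using fodd ffix by (simp add: fixed_functions_def odd_functions_def)
    moreover have "\<Phi> f = p"
    proof -
      have "(if y \<in> D - K then f y else 0) = g y" for y using fK gzero by auto
      then show ?thesis using fx(1) by (simp add: \<Phi>_def p)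
    qed
    ultimately show "p \<in> \<Phi> ` ?A" by blast
  qed
  then have "card ?A = card ((UNIV :: 3 set) \<times> ?B)" by (rule bij_betw_same_card)
  then show ?thesis by (simp add: card_cartesian_product)
qed

end

lemma insert_in_pairings:
  assumes \<sigma>: "\<sigma> \<in> pairings n \<chi> (D - K)"
  shows "insert_arc n \<rho> x \<sigma> \<in> pairings n \<chi> D" "insert_arc n \<rho> x \<sigma> x = \<rho> x"
    "remove_arc K (insert_arc n \<rho> x \<sigma>) = \<sigma>"
proof -
  let ?s = "insert_arc n \<rho> x \<sigma>"
  have s: "?s x = \<rho> x" "?s (\<rho> x) = x" "?s (n x) = n (\<rho> x)" "?s (n (\<rho> x)) = n x"
    using facts(1) by (auto simp: insert_arc_def)
  have sK: "?s y = \<sigma> y" if "y \<notin> K" for y using that K_mem by (auto simp: insert_arc_def)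
  show "?s x = \<rho> x" by (rule s(1))
  show "?s \<in> pairings n \<chi> D"
  proof (rule pairingsI)
    fix y assume y: "y \<in> D"
    show "?s y \<in> D" "?s (?s y) = y" "?s (n y) = n (?s y)" "\<chi> (?s y) \<noteq> \<chi> y"
    proof -
      consider (K) "y = x \<or> y = \<rho> x \<or> y = n x \<or> y = n (\<rho> x)" | (out) "y \<notin> K"
        using K_cases by blast
      then have "?s y \<in> D \<and> ?s (?s y) = y \<and> ?s (n y) = n (?s y) \<and> \<chi> (?s y) \<noteq> \<chi> y"
      proof cases
        case K
        have "\<chi> (\<rho> x) \<noteq> \<chi> x" "\<chi> (n x) = \<chi> x" "\<chi> (n (\<rho> x)) = \<chi> (\<rho> x)"
          using on_D(9,5)[OF x_in] on_D(5)[OF rx_in(1)] by blast+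
        then show ?thesis using K s n_rho rx_in x_in by (elim disjE) simp_all
      next
        case out
        then have y': "y \<in> D - K" using y by blast
        have "n y \<notin> K" using out facts(4)[OF y] by simp
        moreover have "\<sigma> y \<in> D - K" using pairingsD(2)[OF \<sigma> y'] .
        ultimately show ?thesis using pairingsD(3-5)[OF \<sigma> y'] sK out by simp
      qed
      then show "?s y \<in> D" "?s (?s y) = y" "?s (n y) = n (?s y)" "\<chi> (?s y) \<noteq> \<chi> y" by blast+
    qed
  next
    fix y assume y: "y \<notin> D"
    then have "y \<notin> K" using facts(2) by blast
    then show "?s y = y" using sK pairingsD(6)[OF \<sigma>, of y] y by simp
  qed
  show "remove_arc K ?s = \<sigma>"
  proof
    fix y
    show "remove_arc K ?s y = \<sigma> y"
      using sK[of y] pairingsD(6)[OF \<sigma>, of y] by (auto simp: remove_arc_def)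
  qed
qed

end


section \<open>Planar pairings and bracket words\<close>

text \<open>The power four avoids a division: the dimension of the fixed space is a quarter of the number of points. Each of the \<open>4 c\<close>
crossing chords is counted at both of its ends.\<close>

definition planar_pairings ::
    "('a \<Rightarrow> 'a) \<Rightarrow> ('a \<Rightarrow> bool) \<Rightarrow> ('a \<Rightarrow> 'a) \<Rightarrow> 'a set \<Rightarrow> 'a set \<Rightarrow> nat \<Rightarrow> ('a \<Rightarrow> 'a) set" where
  "planar_pairings n \<chi> \<rho> C1 C2 c = {\<sigma> \<in> pairings n \<chi> (C1 \<union> C2).
     card (fixed_functions n (C1 \<union> C2) (\<sigma> \<circ> \<rho>)) ^ 4 = 3 ^ card (C1 \<union> C2) \<and>
     card {y \<in> C1 \<union> C2. (y \<in> C1) \<noteq> (\<sigma> y \<in> C1)} = 8 * c}"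

text \<open>Symmetric sets of opening brackets. On each circle there are as many closing as opening brackets, and \<open>4 c\<close> further points, the
ends of the crossing chords.\<close>

definition circle_words :: "('a \<Rightarrow> 'a) \<Rightarrow> 'a set \<Rightarrow> 'a set \<Rightarrow> nat \<Rightarrow> 'a set set" where
  "circle_words n C1 C2 c = {W. W \<subseteq> C1 \<union> C2 \<and> (\<forall>y\<in>W. n y \<in> W) \<and>
     2 * card (W \<inter> C1) + 4 * c = card C1 \<and> 2 * card (W \<inter> C2) + 4 * c = card C2}"

context arc_removal begin

lemma card_D: "card D = card (D - K) + 4"
  using facts(2,3) two_circles_finite[OF circles] card_mono[of D K] by (simp add: card_Diff_subset finite_subset)

lemma planar_remove_iff:
  assumes "\<sigma> \<in> pairings n \<chi> D" "\<sigma> x = \<rho> x"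
  shows "\<sigma> \<in> planar_pairings n \<chi> \<rho> C1 C2 c \<longleftrightarrow>
    remove_arc K \<sigma> \<in> planar_pairings n \<chi> \<rho>' (C1 - K) (C2 - K) c"
proof -
  let ?b = "card (fixed_functions n (D - K) (remove_arc K \<sigma> \<circ> \<rho>'))"
  have "(3 * ?b) ^ 4 = 3 ^ (card (D - K) + 4) \<longleftrightarrow> ?b ^ 4 = 3 ^ card (D - K)"
    by (simp add: power_mult_distrib power_add)
  then show ?thesis
    unfolding planar_pairings_def mem_Collect_eq crossings_remove[OF assms]
      card_fixed_functions_remove[OF assms] card_D Un_Diff[symmetric]
    using assms(1) remove_in_pairings[OF assms] by simp
qed

lemma card_planar_arc:
  assumes J: "J \<subseteq> D - K" "\<And>y. y \<in> J \<Longrightarrow> \<rho> y \<notin> K"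
  shows "card {\<sigma> \<in> planar_pairings n \<chi> \<rho> C1 C2 c. \<sigma> x = \<rho> x \<and> (\<forall>y\<in>J. \<sigma> y = \<rho> y)}
    = card {\<sigma> \<in> planar_pairings n \<chi> \<rho>' (C1 - K) (C2 - K) c. \<forall>y\<in>J. \<sigma> y = \<rho>' y}"
    (is "card ?A = card ?B")
proof (rule bij_betw_same_card[where f = "remove_arc K"], rule bij_betw_byWitness[where f' = "insert_arc n \<rho> x"])
  have pl: "\<sigma> \<in> pairings n \<chi> D" if "\<sigma> \<in> planar_pairings n \<chi> \<rho> C1 C2 c" for \<sigma>
    using that by (simp add: planar_pairings_def)
  have pl': "\<sigma> \<in> pairings n \<chi> (D - K)" if "\<sigma> \<in> planar_pairings n \<chi> \<rho>' (C1 - K) (C2 - K) c" for \<sigma>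
    using that by (simp add: planar_pairings_def Un_Diff)
  have r: "\<rho>' y = \<rho> y" if "y \<in> J" for y using J(2)[OF that] by (rule bypass_out)
  have yK: "y \<notin> K" if "y \<in> J" for y using J(1) that by blast
  show "\<forall>\<sigma>\<in>?A. insert_arc n \<rho> x (remove_arc K \<sigma>) = \<sigma>"
    using insert_remove pl by blast
  show "\<forall>\<sigma>\<in>?B. remove_arc K (insert_arc n \<rho> x \<sigma>) = \<sigma>"
    using insert_in_pairings(3) pl' by blast
  show "remove_arc K ` ?A \<subseteq> ?B"
  proof clarify
    fix \<sigma> assume \<sigma>: "\<sigma> \<in> planar_pairings n \<chi> \<rho> C1 C2 c" "\<sigma> x = \<rho> x" "\<forall>y\<in>J. \<sigma> y = \<rho> y"
    have "remove_arc K \<sigma> \<in> planar_pairings n \<chi> \<rho>' (C1 - K) (C2 - K) c"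
      using planar_remove_iff[OF pl[OF \<sigma>(1)] \<sigma>(2)] \<sigma>(1) by simp
    moreover have "\<forall>y\<in>J. remove_arc K \<sigma> y = \<rho>' y"
      using \<sigma>(3) r yK by (simp add: remove_arc_def)
    ultimately show "remove_arc K \<sigma> \<in> planar_pairings n \<chi> \<rho>' (C1 - K) (C2 - K) c \<and> (\<forall>y\<in>J. remove_arc K \<sigma> y = \<rho>' y)"
      by blast
  qed
  show "insert_arc n \<rho> x ` ?B \<subseteq> ?A"
  proof clarify
    fix \<sigma> assume \<sigma>: "\<sigma> \<in> planar_pairings n \<chi> \<rho>' (C1 - K) (C2 - K) c" "\<forall>y\<in>J. \<sigma> y = \<rho>' y"
    note i = insert_in_pairings[OF pl'[OF \<sigma>(1)]]
    have "insert_arc n \<rho> x \<sigma> \<in> planar_pairings n \<chi> \<rho> C1 C2 c"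
      using planar_remove_iff[OF i(1,2)] \<sigma>(1) i(3) by simp
    moreover have "\<forall>y\<in>J. insert_arc n \<rho> x \<sigma> y = \<rho> y"
    proof
      fix y assume y: "y \<in> J"
      have "insert_arc n \<rho> x \<sigma> y = remove_arc K (insert_arc n \<rho> x \<sigma>) y"
        using yK[OF y] by (simp add: remove_arc_def)
      then show "insert_arc n \<rho> x \<sigma> y = \<rho> y" using i(3) \<sigma>(2) y r[OF y] by simp
    qed
    ultimately show "insert_arc n \<rho> x \<sigma> \<in> planar_pairings n \<chi> \<rho> C1 C2 c \<and> insert_arc n \<rho> x \<sigma> x = \<rho> x
        \<and> (\<forall>y\<in>J. insert_arc n \<rho> x \<sigma> y = \<rho> y)"
      using i(2) by blast
  qed
qed

lemma word_balance_iff: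
  assumes C: "C = C1 \<or> C = C2" and W: "W \<subseteq> D" "x \<in> W" "n x \<in> W" "\<rho> x \<notin> W" "n (\<rho> x) \<notin> W"
  shows "2 * card (W \<inter> C) + 4 * c = card C \<longleftrightarrow> 2 * card ((W - {x, n x}) \<inter> (C - K)) + 4 * c = card (C - K)"
proof -
  have fin: "finite C" using two_circles_finite[OF circles] C by auto
  have "K \<subseteq> C \<or> K \<inter> C = {}"
  proof -
    have d: "C1 \<inter> C2 = {}" using circles by (simp add: two_circles_def)
    have "y \<in> C \<longleftrightarrow> x \<in> C" if "y \<in> K" for y
      using K_color[OF that] facts(2) that x_in d C by blast
    then show ?thesis by blast
  qed
  then show ?thesis
  proof
    assume K: "K \<subseteq> C"
    have "W \<inter> C = (W - {x, n x}) \<inter> (C - K) \<union> {x, n x}"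
      using K W(2-) K_cases K_mem by blast
    moreover have "card ((W - {x, n x}) \<inter> (C - K) \<union> {x, n x}) = card ((W - {x, n x}) \<inter> (C - K)) + card {x, n x}"
      using fin by (intro card_Un_disjoint) auto
    ultimately have "card (W \<inter> C) = card ((W - {x, n x}) \<inter> (C - K)) + card {x, n x}" by (simp only:)
    moreover have "card {x, n x} = 2" using facts(1) by simp
    moreover have "card C = card (C - K) + 4"
      using facts(3) K fin card_mono[OF fin K] by (simp add: card_Diff_subset finite_subset)
    ultimately show ?thesis by simp
  next
    assume K: "K \<inter> C = {}"
    then have "C - K = C" by blast
    moreover have "(W - {x, n x}) \<inter> C = W \<inter> C" using K K_mem by blast
    ultimately show ?thesis by simp
  qed
qed

lemma card_words_arc:
  assumes J: "J \<subseteq> D - K" "\<And>y. y \<in> J \<Longrightarrow> \<rho> y \<notin> K"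
  shows "card {W \<in> circle_words n C1 C2 c. x \<in> W \<and> \<rho> x \<notin> W \<and> (\<forall>y\<in>J. y \<in> W \<and> \<rho> y \<notin> W)}
    = card {W \<in> circle_words n (C1 - K) (C2 - K) c. \<forall>y\<in>J. y \<in> W \<and> \<rho>' y \<notin> W}"
    (is "card ?A = card ?B")
proof (rule bij_betw_same_card[where f = "\<lambda>W. W - {x, n x}"],
    rule bij_betw_byWitness[where f' = "\<lambda>W. W \<union> {x, n x}"])
  have r: "\<rho>' y = \<rho> y" if "y \<in> J" for y using J(2)[OF that] by (rule bypass_out)
  have nx: "n x \<in> W" if "W \<in> circle_words n C1 C2 c" "x \<in> W" for W
    using that by (simp add: circle_words_def)
  have nrx: "n (\<rho> x) \<notin> W" if "W \<in> circle_words n C1 C2 c" "\<rho> x \<notin> W" for W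
    using that n_rho(4) by (auto simp: circle_words_def)
  show "\<forall>W\<in>?A. W - {x, n x} \<union> {x, n x} = W" using nx by blast
  have disj: "K \<inter> W = {}" if "W \<in> circle_words n (C1 - K) (C2 - K) c" for W
    using that by (auto simp: circle_words_def)
  show "\<forall>W\<in>?B. W \<union> {x, n x} - {x, n x} = W" using disj K_mem by blast
  show "(\<lambda>W. W - {x, n x}) ` ?A \<subseteq> ?B"
  proof clarify
    fix W assume W: "W \<in> circle_words n C1 C2 c" "x \<in> W" "\<rho> x \<notin> W" "\<forall>y\<in>J. y \<in> W \<and> \<rho> y \<notin> W"
    have WD: "W \<subseteq> D" and Wn: "\<forall>y\<in>W. n y \<in> W" using W(1) by (auto simp: circle_words_def)
    have sub: "W - {x, n x} \<subseteq> (C1 - K) \<union> (C2 - K)" using WD K_cases W(3) nrx[OF W(1,3)] by blast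
    have nn: "\<forall>y\<in>W - {x, n x}. n y \<in> W - {x, n x}"
    proof
      fix y assume y: "y \<in> W - {x, n x}"
      then have "y \<in> D" "y \<notin> K" using sub by blast+
      then have "n y \<notin> K" using facts(4) by blast
      then show "n y \<in> W - {x, n x}" using y Wn K_mem by auto
    qed
    have "W - {x, n x} \<in> circle_words n (C1 - K) (C2 - K) c"
      using W(1) word_balance_iff[OF disjI1[OF refl] WD W(2) nx[OF W(1,2)] W(3) nrx[OF W(1,3)]]
        word_balance_iff[OF disjI2[OF refl] WD W(2) nx[OF W(1,2)] W(3) nrx[OF W(1,3)]] sub nn
      unfolding circle_words_def by blast
    moreover have "y \<in> W - {x, n x} \<and> \<rho>' y \<notin> W - {x, n x}" if "y \<in> J" for y
      using W(4) that J(1) r[OF that] K_mem by auto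
    ultimately show "W - {x, n x} \<in> circle_words n (C1 - K) (C2 - K) c \<and>
        (\<forall>y\<in>J. y \<in> W - {x, n x} \<and> \<rho>' y \<notin> W - {x, n x})" by blast
  qed
  show "(\<lambda>W. W \<union> {x, n x}) ` ?B \<subseteq> ?A"
  proof clarify
    fix W assume W: "W \<in> circle_words n (C1 - K) (C2 - K) c" "\<forall>y\<in>J. y \<in> W \<and> \<rho>' y \<notin> W"
    let ?V = "W \<union> {x, n x}"
    have Wsub: "W \<subseteq> (C1 - K) \<union> (C2 - K)" and Wn: "\<forall>y\<in>W. n y \<in> W" using W(1) by (auto simp: circle_words_def)
    have VD: "?V \<subseteq> D" using Wsub x_in rx_in by blast
    have Vn: "\<forall>y\<in>?V. n y \<in> ?V" using Wn n_rho(3) by auto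
    have ne: "\<rho> x \<notin> {x, n x}" "n (\<rho> x) \<notin> {x, n x}" using facts(1) by auto
    have rx: "\<rho> x \<notin> ?V" "n (\<rho> x) \<notin> ?V"
      using disj[OF W(1)] K_mem ne by blast+
    have VW: "?V - {x, n x} = W" using disj[OF W(1)] K_mem by blast
    have "?V \<in> circle_words n C1 C2 c"
      using W(1) word_balance_iff[OF disjI1[OF refl] VD _ _ rx, of c] VW
        word_balance_iff[OF disjI2[OF refl] VD _ _ rx, of c] VD Vn
      unfolding circle_words_def by simp
    moreover have "y \<in> ?V \<and> \<rho> y \<notin> ?V" if y: "y \<in> J" for y
      using W(2) y r[OF y] J(2)[OF y] K_mem by auto
    ultimately show "?V \<in> circle_words n C1 C2 c \<and> x \<in> ?V \<and> \<rho> x \<notin> ?V \<and> (\<forall>y\<in>J. y \<in> ?V \<and> \<rho> y \<notin> ?V)"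
      using rx by blast
  qed
qed

text \<open>Two arcs cannot share a point, and \<open>y\<close> with \<open>\<rho> y = x\<close> would make \<open>x\<close> a common end.\<close>

lemma arcs_incompatible:
  assumes \<sigma>: "\<sigma> \<in> pairings n \<chi> D" "\<sigma> x = \<rho> x" and y: "y \<in> D" "y \<noteq> x" "y \<noteq> n x" "y \<in> K \<or> \<rho> y \<in> K"
  shows "\<sigma> y \<noteq> \<rho> y"
proof
  assume a: "\<sigma> y = \<rho> y"
  note s = sigma_K_eqs[OF \<sigma>]
  show False
  proof (cases "y \<in> K")
    case True
    then have "y = \<rho> x \<or> y = n (\<rho> x)" using K_cases y(2,3) by blast
    then show False
    proof
      assume "y = \<rho> x" then show False using a s facts(5) by simp
    next
      assume "y = n (\<rho> x)"
      then have "n x = n (\<rho> (\<rho> x))" using a s n_rho by simp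
      then have "x = \<rho> (\<rho> x)" using n_rho(3) on_D(4)[OF rx_in(4)] by metis
      then show False using facts(5) by simp
    qed
  next
    case False
    then have "\<sigma> y \<in> K" using y(4) a by simp
    then show False using sigma_K[OF \<sigma> y(1)] False by simp
  qed
qed

lemma words_incompatible:
  assumes W: "W \<in> circle_words n C1 C2 c" "x \<in> W" "\<rho> x \<notin> W" and y: "y \<in> D" "y \<noteq> x" "y \<noteq> n x" "y \<in> K \<or> \<rho> y \<in> K"
  shows "\<not> (y \<in> W \<and> \<rho> y \<notin> W)"
proof
  assume a: "y \<in> W \<and> \<rho> y \<notin> W"
  have Wn: "n z \<in> W" if "z \<in> W" for z using W(1) that by (simp add: circle_words_def)
  show False
  proof (cases "y \<in> K")
    case True
    then have "y = \<rho> x \<or> y = n (\<rho> x)" using K_cases y(2,3) by blast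
    then show False using a W(3) Wn[of "n (\<rho> x)"] n_rho(4) by auto
  next
    case False
    then have "\<rho> y = x \<or> \<rho> y = n x" using facts(7)[OF y(1)] y(4) by blast
    then show False using a W(2) Wn by auto
  qed
qed

end

lemma card_by_image:
  assumes "finite X" "finite F"
  shows "card {x \<in> X. a x \<in> F} = (\<Sum>J\<in>F. card {x \<in> X. a x = J})"
proof -
  have "{x \<in> X. a x \<in> F} = (\<Union>J\<in>F. {x \<in> X. a x = J})" by blast
  moreover have "card (\<Union>J\<in>F. {x \<in> X. a x = J}) = (\<Sum>J\<in>F. card {x \<in> X. a x = J})"
    by (rule card_UN_disjoint) (use assms in auto)
  ultimately show ?thesis by (simp only:)
qed

text \<open>Inclusion and exclusion without signs: downward induction on \<open>J\<close> passes from the number of elements with \<open>J \<subseteq> a x\<close> to the number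
with \<open>J = a x\<close>, and the latter are added up over all nonempty \<open>J\<close>.\<close>

lemma card_by_superset_counts:
  fixes a :: "'a \<Rightarrow> 'd set" and b :: "'b \<Rightarrow> 'd set"
  assumes fin: "finite X" "finite Y" "finite D"
    and a: "\<And>x. x \<in> X \<Longrightarrow> a x \<subseteq> D" and b: "\<And>y. y \<in> Y \<Longrightarrow> b y \<subseteq> D"
    and eq: "\<And>J. J \<subseteq> D \<Longrightarrow> J \<noteq> {} \<Longrightarrow> card {x \<in> X. J \<subseteq> a x} = m * card {y \<in> Y. J \<subseteq> b y}"
  shows "card {x \<in> X. a x \<noteq> {}} = m * card {y \<in> Y. b y \<noteq> {}}"
proof -
  have ex: "card {x \<in> X. a x = J} = m * card {y \<in> Y. b y = J}" if "J \<subseteq> D" "J \<noteq> {}" for J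
    using that
  proof (induction "card (D - J)" arbitrary: J rule: less_induct)
    case less
    let ?F = "{L. L \<subseteq> D \<and> J \<subset> L}"
    have F: "finite ?F" using fin(3) by (intro finite_subset[of ?F "Pow D"]) auto
    have split: "card {x \<in> X'. J \<subseteq> d x} = card {x \<in> X'. d x = J} + (\<Sum>L\<in>?F. card {x \<in> X'. d x = L})"
      if "finite X'" "\<And>x. x \<in> X' \<Longrightarrow> d x \<subseteq> D" for d :: "'c \<Rightarrow> 'd set" and X'
    proof -
      have "{x \<in> X'. J \<subseteq> d x} = {x \<in> X'. d x \<in> insert J ?F}" using that(2) less.prems by blast
      then have "card {x \<in> X'. J \<subseteq> d x} = (\<Sum>L\<in>insert J ?F. card {x \<in> X'. d x = L})"
        using card_by_image[OF that(1), of "insert J ?F" d] F by simp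
      also have "\<dots> = card {x \<in> X'. d x = J} + (\<Sum>L\<in>?F. card {x \<in> X'. d x = L})"
        using F by (rule sum.insert) simp
      finally show ?thesis .
    qed
    have "(\<Sum>L\<in>?F. card {x \<in> X. a x = L}) = (\<Sum>L\<in>?F. m * card {y \<in> Y. b y = L})"
    proof (rule sum.cong[OF refl])
      fix L assume L: "L \<in> ?F"
      have "card (D - L) < card (D - J)" using L fin(3) by (intro psubset_card_mono) auto
      then show "card {x \<in> X. a x = L} = m * card {y \<in> Y. b y = L}" using less.hyps[of L] L by blast
    qed
    then have "(\<Sum>L\<in>?F. card {x \<in> X. a x = L}) = m * (\<Sum>L\<in>?F. card {y \<in> Y. b y = L})"
      by (simp add: sum_distrib_left)
    moreover have "card {x \<in> X. a x = J} + (\<Sum>L\<in>?F. card {x \<in> X. a x = L})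
        = m * (card {y \<in> Y. b y = J} + (\<Sum>L\<in>?F. card {y \<in> Y. b y = L}))"
      using eq[OF less.prems] split[OF fin(1) a] split[OF fin(2) b] by simp
    ultimately show ?case by (simp add: distrib_left)
  qed
  let ?G = "Pow D - {{}}"
  have G: "finite ?G" using fin(3) by simp
  have "{x \<in> X. a x \<noteq> {}} = {x \<in> X. a x \<in> ?G}" "{y \<in> Y. b y \<noteq> {}} = {y \<in> Y. b y \<in> ?G}"
    using a b by blast+
  then have "card {x \<in> X. a x \<noteq> {}} = (\<Sum>J\<in>?G. card {x \<in> X. a x = J})"
    "card {y \<in> Y. b y \<noteq> {}} = (\<Sum>J\<in>?G. card {y \<in> Y. b y = J})"
    using card_by_image[OF fin(1) G, of a] card_by_image[OF fin(2) G, of b] by simp_all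
  moreover have "(\<Sum>J\<in>?G. card {x \<in> X. a x = J}) = (\<Sum>J\<in>?G. m * card {y \<in> Y. b y = J})"
    by (rule sum.cong[OF refl]) (use ex in auto)
  ultimately show ?thesis by (simp add: sum_distrib_left)
qed


section \<open>Bounds for the fixed space\<close>

text \<open>What is needed of a permutation on \<open>D\<close> in order to split off the orbits one by one, together with their
mirror images.\<close>

definition odd_perm :: "('a \<Rightarrow> 'a) \<Rightarrow> 'a set \<Rightarrow> ('a \<Rightarrow> 'a) \<Rightarrow> bool" where
  "odd_perm n D \<pi> \<longleftrightarrow> finite D \<and> inj_on \<pi> D \<and>
     (\<forall>x\<in>D. n x \<in> D \<and> n x \<noteq> x \<and> n (n x) = x \<and> \<pi> x \<in> D \<and> \<pi> (n x) = n (\<pi> x))"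

lemma odd_permD:
  assumes "odd_perm n D \<pi>"
  shows "finite D" "inj_on \<pi> D" "x \<in> D \<Longrightarrow> n x \<in> D" "x \<in> D \<Longrightarrow> n x \<noteq> x" "x \<in> D \<Longrightarrow> n (n x) = x"
    "x \<in> D \<Longrightarrow> \<pi> x \<in> D" "x \<in> D \<Longrightarrow> \<pi> (n x) = n (\<pi> x)"
  using assms by (auto simp: odd_perm_def)

lemma odd_perm_restrict:
  assumes d: "odd_perm n D \<pi>" and ED: "E \<subseteq> D" and Ec: "\<forall>y\<in>E. \<pi> y \<in> E \<and> n y \<in> E"
  shows "odd_perm n E \<pi>" "odd_perm n (D - E) \<pi>"
proof -
  have finE: "finite E" using ED odd_permD(1)[OF d] by (rule finite_subset)
  have injE: "inj_on \<pi> E" using odd_permD(2)[OF d] ED by (rule inj_on_subset)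
  show "odd_perm n E \<pi>"
    unfolding odd_perm_def using finE injE ED Ec odd_permD(4,5,7)[OF d] by blast
  have "\<pi> ` E \<subseteq> E" using Ec by blast
  then have surj: "\<pi> ` E = E" using finE injE by (intro card_subset_eq) (auto simp: card_image)
  have "\<pi> y \<in> D - E" if y: "y \<in> D - E" for y
  proof -
    have "\<pi> y \<notin> E"
    proof
      assume "\<pi> y \<in> E"
      then obtain z where "z \<in> E" "\<pi> y = \<pi> z" using surj by blast
      then have "y = z" using inj_onD[OF odd_permD(2)[OF d], of y z] y ED by blast
      then show False using y \<open>z \<in> E\<close> by blast
    qed
    then show ?thesis using y odd_permD(6)[OF d, of y] by blast
  qed
  moreover have "n y \<in> D - E" if y: "y \<in> D - E" for y
    using y odd_permD(3,5)[OF d, of y] Ec by auto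
  moreover have "inj_on \<pi> (D - E)" using odd_permD(2)[OF d] by (rule inj_on_subset) blast
  ultimately show "odd_perm n (D - E) \<pi>"
    unfolding odd_perm_def using odd_permD(1,4,5,7)[OF d] by blast
qed

lemma card_fixed_functions_split:
  assumes d: "odd_perm n D \<pi>" and ED: "E \<subseteq> D" and Ec: "\<forall>y\<in>E. \<pi> y \<in> E \<and> n y \<in> E"
  shows "card (fixed_functions n D \<pi>) = card (fixed_functions n E \<pi>) * card (fixed_functions n (D - E) \<pi>)"
proof -
  let ?F = "fixed_functions n D \<pi>" and ?A = "fixed_functions n E \<pi>" and ?B = "fixed_functions n (D - E) \<pi>"
  note c = odd_permD(3,6)[OF odd_perm_restrict(2)[OF d ED Ec]]
  define \<Phi> :: "('a \<Rightarrow> 3) \<Rightarrow> ('a \<Rightarrow> 3) \<times> ('a \<Rightarrow> 3)"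
    where "\<Phi> f = (\<lambda>y. if y \<in> E then f y else 0, \<lambda>y. if y \<in> D - E then f y else 0)" for f
  define \<Psi> :: "('a \<Rightarrow> 3) \<times> ('a \<Rightarrow> 3) \<Rightarrow> 'a \<Rightarrow> 3" where "\<Psi> p y = fst p y + snd p y" for p y
  have "bij_betw \<Phi> ?F (?A \<times> ?B)"
  proof (rule bij_betw_byWitness[where f' = \<Psi>])
    show "\<forall>f\<in>?F. \<Psi> (\<Phi> f) = f"
    proof
      fix f assume "f \<in> ?F"
      then have "f y = 0" if "y \<notin> D" for y using that by (simp add: fixed_functions_def odd_functions_def)
      then show "\<Psi> (\<Phi> f) = f"
        by (simp add: fun_eq_iff \<Phi>_def \<Psi>_def)
    qed
    have gz: "g y = 0" if "g \<in> ?A" "y \<notin> E" for g y using that by (simp add: fixed_functions_def odd_functions_def)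
    have hz: "h y = 0" if "h \<in> ?B" "y \<notin> D - E" for h y
      using that unfolding fixed_functions_def odd_functions_def by blast
    show "\<forall>p\<in>?A \<times> ?B. \<Phi> (\<Psi> p) = p"
    proof clarify
      fix g h assume gh: "g \<in> ?A" "h \<in> ?B"
      have "(if y \<in> E then g y + h y else 0) = g y" for y
        using gz[OF gh(1), of y] hz[OF gh(2), of y] by (cases "y \<in> E") auto
      moreover have "(if y \<in> D - E then g y + h y else 0) = h y" for y
        using gz[OF gh(1), of y] hz[OF gh(2), of y] by (cases "y \<in> D - E") auto
      ultimately show "\<Phi> (\<Psi> (g, h)) = (g, h)"
        by (simp only: \<Phi>_def \<Psi>_def fst_conv snd_conv)
    qed
    show "\<Phi> ` ?F \<subseteq> ?A \<times> ?B"
    proof (rule image_subsetI)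
      fix f assume f: "f \<in> ?F"
      have o: "f (n y) = - f y" "f (\<pi> y) = f y" if "y \<in> D" for y
        using f that by (auto simp: fixed_functions_def odd_functions_def)
      have "(\<lambda>y. if y \<in> E then f y else 0) \<in> ?A"
        using o ED Ec by (auto simp: fixed_functions_def odd_functions_def)
      moreover have "(\<lambda>y. if y \<in> D - E then f y else 0) \<in> ?B"
        using o c by (simp add: fixed_functions_def odd_functions_def)
      ultimately show "\<Phi> f \<in> ?A \<times> ?B" by (simp add: \<Phi>_def)
    qed
    show "\<Psi> ` (?A \<times> ?B) \<subseteq> ?F"
    proof clarify
      fix g h assume g: "g \<in> ?A" and h: "h \<in> ?B"
      have go: "g (n y) = - g y" "g (\<pi> y) = g y" if "y \<in> D" for y
      proof -
        have "(g (n y) = - g y \<and> g (\<pi> y) = g y)"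
        proof (cases "y \<in> E")
          case True then show ?thesis using g by (simp add: fixed_functions_def odd_functions_def)
        next
          case False
          then show ?thesis using c[of y] that gz[OF g] by simp
        qed
        then show "g (n y) = - g y" "g (\<pi> y) = g y" by blast+
      qed
      have ho: "h (n y) = - h y" "h (\<pi> y) = h y" if "y \<in> D" for y
      proof -
        have "(h (n y) = - h y \<and> h (\<pi> y) = h y)"
        proof (cases "y \<in> E")
          case True then show ?thesis using bspec[OF Ec True] hz[OF h] by simp
        next
          case False
          then show ?thesis using h that by (simp add: fixed_functions_def odd_functions_def)
        qed
        then show "h (n y) = - h y" "h (\<pi> y) = h y" by blast+
      qed
      have "g y + h y = 0" if "y \<notin> D" for y using gz[OF g, of y] hz[OF h, of y] that ED by auto
      then show "\<Psi> (g, h) \<in> ?F" using go ho by (simp add: fixed_functions_def odd_functions_def \<Psi>_def)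
    qed
  qed
  then have "card ?F = card (?A \<times> ?B)" by (rule bij_betw_same_card)
  then show ?thesis by (simp add: card_cartesian_product)
qed

text \<open>Let \<open>E\<close> be the orbit of \<open>x\<close> joined with its mirror image. A function in the fixed space is determined on \<open>E\<close> by its value at \<open>x\<close>, and this
is zero if the orbit is its own mirror image. Otherwise \<open>E\<close> has at least four
points, since \<open>x\<close> is not fixed, and exactly four only if the orbit has two.\<close>

lemma fixed_functions_class:
  assumes d: "odd_perm n D \<pi>" and nofix: "\<And>y. y \<in> D \<Longrightarrow> \<pi> y \<noteq> y" and x: "x \<in> D"
  obtains E where "E \<subseteq> D" "x \<in> E" "\<forall>y\<in>E. \<pi> y \<in> E \<and> n y \<in> E"
    "card (fixed_functions n E \<pi>) ^ 4 \<le> 3 ^ card E"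
    "card (fixed_functions n E \<pi>) ^ 4 = 3 ^ card E \<Longrightarrow> \<pi> (\<pi> x) = x \<and> \<pi> x \<noteq> n x"
proof -
  define Ob where "Ob = range (\<lambda>k. (\<pi> ^^ k) x)"
  define E where "E = Ob \<union> n ` Ob"
  have xO: "x \<in> Ob" unfolding Ob_def by (rule range_eqI[of _ _ 0]) simp
  have Oc: "\<pi> y \<in> Ob" if y: "y \<in> Ob" for y
  proof -
    obtain k where "y = (\<pi> ^^ k) x" using y by (auto simp: Ob_def)
    then have "\<pi> y = (\<pi> ^^ Suc k) x" by simp
    then show ?thesis unfolding Ob_def by blast
  qed
  have OD: "Ob \<subseteq> D"
  proof
    fix y assume "y \<in> Ob"
    then obtain k where "y = (\<pi> ^^ k) x" by (auto simp: Ob_def)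
    then show "y \<in> D" using x odd_permD(6)[OF d] by (induction k arbitrary: y) auto
  qed
  have ED: "E \<subseteq> D" using OD odd_permD(3)[OF d] by (auto simp: E_def)
  have Ec: "\<pi> y \<in> E" if "y \<in> E" for y
    using that Oc OD odd_permD(7)[OF d] by (auto simp: E_def)
  have En: "n y \<in> E" if "y \<in> E" for y
    using that OD odd_permD(5)[OF d] by (auto simp: E_def)
  have xE: "x \<in> E" using xO by (simp add: E_def)
  have Ecl: "\<forall>y\<in>E. \<pi> y \<in> E \<and> n y \<in> E" using Ec En by blast
  note Ep = odd_perm_restrict(1)[OF d ED Ecl]
  let ?F = "fixed_functions n E \<pi>"
  have fO: "f y = f x" if f: "f \<in> ?F" and y: "y \<in> Ob" for f y
  proof -
    obtain k where k: "y = (\<pi> ^^ k) x" using y by (auto simp: Ob_def)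
    have "f ((\<pi> ^^ k) x) = f x \<and> (\<pi> ^^ k) x \<in> E" for k
    proof (induction k)
      case (Suc k)
      then show ?case using f Ec by (simp add: fixed_functions_def)
    qed (use xE in simp)
    then show ?thesis using k by simp
  qed
  have fn: "f (n y) = - f x" if f: "f \<in> ?F" and y: "y \<in> Ob" for f y
  proof -
    have "y \<in> E" using y by (simp add: E_def)
    then have "f (n y) = - f y" using f by (simp add: fixed_functions_def odd_functions_def)
    then show ?thesis using fO[OF f y] by simp
  qed
  have fz: "f y = 0" if "f \<in> ?F" "y \<notin> E" for f y using that by (simp add: fixed_functions_def odd_functions_def)
  have finE: "finite E" using odd_permD(1)[OF Ep] .
  have inj: "inj_on (\<lambda>f. f x) ?F"
  proof (rule inj_onI)
    fix f g assume f: "f \<in> ?F" and g: "g \<in> ?F" and e: "f x = g x"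
    show "f = g"
    proof
      fix y
      consider "y \<in> Ob" | z where "z \<in> Ob" "y = n z" | "y \<notin> E" by (auto simp: E_def)
      then show "f y = g y"
        using fO[OF f] fO[OF g] fn[OF f] fn[OF g] fz[OF f] fz[OF g] e by cases auto
    qed
  qed
  have pos: "1 \<le> card ?F" using card_fixed_functions_pos[OF finE, of n \<pi>] by simp
  show thesis
  proof (cases "n x \<in> Ob")
    case True
    have "f x = 0" if f: "f \<in> ?F" for f
      using fO[OF f True] fn[OF f xO] by (intro z3_double) simp
    then have "(\<lambda>f. f x) ` ?F \<subseteq> {0}" by blast
    then have "card ?F \<le> card {0 :: 3}" by (intro card_inj_on_le[OF inj]) auto
    then have c1: "card ?F = 1" using pos by simp
    have "card {x, n x} \<le> card E" using xE En[OF xE] finE by (intro card_mono) auto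
    then have "2 \<le> card E" using odd_permD(4)[OF d x] by simp
    then have "(3::nat) ^ 2 \<le> 3 ^ card E" by (intro power_increasing) auto
    then have "card ?F ^ 4 < 3 ^ card E" using c1 by simp
    then show thesis using that[OF ED xE Ecl] by simp
  next
    case False
    let ?Q = "{x, \<pi> x, n x, n (\<pi> x)}"
    have px: "\<pi> x \<in> D" using odd_permD(6)[OF d x] .
    have ne: "\<pi> x \<noteq> n x" using False Oc[OF xO] by auto
    have nn: "n (\<pi> x) \<noteq> x" using ne odd_permD(5)[OF d px] by auto
    have "n x \<noteq> n (\<pi> x)"
      using nofix[OF x] odd_permD(5)[OF d x] odd_permD(5)[OF d px] by auto
    then have "distinct [x, \<pi> x, n x, n (\<pi> x)]"
      using nofix[OF x] ne nn odd_permD(4)[OF d x] odd_permD(4)[OF d px] by auto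
    then have "card (set [x, \<pi> x, n x, n (\<pi> x)]) = length [x, \<pi> x, n x, n (\<pi> x)]" by (rule distinct_card)
    then have Q4: "card ?Q = 4" by simp
    have QE: "?Q \<subseteq> E" using xE Ec[OF xE] En[OF xE] En[OF Ec[OF xE]] by blast
    have "4 \<le> card E" using card_mono[OF finE QE] Q4 by simp
    then have E4: "(3::nat) ^ 4 \<le> 3 ^ card E" by (intro power_increasing) auto
    have "card ?F \<le> card (UNIV :: 3 set)" by (intro card_inj_on_le[OF inj]) auto
    then have "card ?F ^ 4 \<le> 3 ^ 4" by (intro power_mono) auto
    then have le: "card ?F ^ 4 \<le> 3 ^ card E" using E4 by simp
    have "\<pi> (\<pi> x) = x \<and> \<pi> x \<noteq> n x" if eq: "card ?F ^ 4 = 3 ^ card E"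
    proof -
      have "(3::nat) ^ card E \<le> 3 ^ 4" using \<open>card ?F ^ 4 \<le> 3 ^ 4\<close> eq by simp
      then have "card E \<le> 4" using power_le_imp_le_exp[of "3::nat" "card E" 4] by simp
      then have "?Q = E" using card_seteq[OF finE QE] Q4 by simp
      then have "\<pi> (\<pi> x) \<in> ?Q" using Ec[OF Ec[OF xE]] by simp
      moreover have "\<pi> (\<pi> x) \<noteq> \<pi> x" using nofix[OF px] .
      moreover have "\<pi> (\<pi> x) \<noteq> n x" using False Oc[OF Oc[OF xO]] by auto
      moreover have "\<pi> (\<pi> x) \<noteq> n (\<pi> x)"
      proof
        assume "\<pi> (\<pi> x) = n (\<pi> x)"
        then have "\<pi> (\<pi> x) = \<pi> (n x)" using odd_permD(7)[OF d x] by simp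
        then have "\<pi> x = n x" using inj_onD[OF odd_permD(2)[OF d] _ px odd_permD(3)[OF d x]] by blast
        then show False using ne by simp
      qed
      ultimately show ?thesis using ne by blast
    qed
    then show thesis using that[OF ED xE Ecl le] by blast
  qed
qed

lemma card_fixed_functions_le:
  assumes "odd_perm n D \<pi>" "\<And>y. y \<in> D \<Longrightarrow> \<pi> y \<noteq> y"
  shows "card (fixed_functions n D \<pi>) ^ 4 \<le> 3 ^ card D"
  using assms
proof (induction "card D" arbitrary: D rule: less_induct)
  case less
  show ?case
  proof (cases "D = {}")
    case True
    have "fixed_functions n {} \<pi> = {\<lambda>_. 0}" by (auto simp: fixed_functions_def odd_functions_def)
    then show ?thesis using True by simp
  next
    case False
    then obtain x where x: "x \<in> D" by blast
    obtain E where E: "E \<subseteq> D" "x \<in> E" "\<forall>y\<in>E. \<pi> y \<in> E \<and> n y \<in> E"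
      "card (fixed_functions n E \<pi>) ^ 4 \<le> 3 ^ card E"
      using fixed_functions_class[OF less.prems x] by metis
    have finD: "finite D" using odd_permD(1)[OF less.prems(1)] .
    have "card (D - E) < card D" using E(1,2) finD by (intro psubset_card_mono) auto
    then have "card (fixed_functions n (D - E) \<pi>) ^ 4 \<le> 3 ^ card (D - E)"
      using less.hyps[OF _ odd_perm_restrict(2)[OF less.prems(1) E(1,3)]] less.prems(2) by simp
    then have "card (fixed_functions n E \<pi>) ^ 4 * card (fixed_functions n (D - E) \<pi>) ^ 4 \<le> 3 ^ card E * 3 ^ card (D - E)"
      using E(4) by (intro mult_mono) auto
    moreover have "card D = card E + card (D - E)"
      using E(1) finD card_mono[OF finD E(1)] by (simp add: card_Diff_subset finite_subset)
    ultimately show ?thesis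
      unfolding card_fixed_functions_split[OF less.prems(1) E(1,3)]
      by (simp add: power_mult_distrib power_add)
  qed
qed

text \<open>Equality in the bound for \<open>D\<close> forces equality in the bound for each class.\<close>

lemma card_fixed_functions_maximal:
  assumes d: "odd_perm n D \<pi>" and nofix: "\<And>y. y \<in> D \<Longrightarrow> \<pi> y \<noteq> y"
    and eq: "card (fixed_functions n D \<pi>) ^ 4 = 3 ^ card D" and x: "x \<in> D"
  shows "\<pi> (\<pi> x) = x" "\<pi> x \<noteq> n x"
proof -
  obtain E where E: "E \<subseteq> D" "x \<in> E" "\<forall>y\<in>E. \<pi> y \<in> E \<and> n y \<in> E"
    "card (fixed_functions n E \<pi>) ^ 4 \<le> 3 ^ card E"
    and *: "card (fixed_functions n E \<pi>) ^ 4 = 3 ^ card E \<Longrightarrow> \<pi> (\<pi> x) = x \<and> \<pi> x \<noteq> n x"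
    using fixed_functions_class[OF d nofix x] by metis
  let ?a = "card (fixed_functions n E \<pi>) ^ 4" and ?b = "card (fixed_functions n (D - E) \<pi>) ^ 4"
  have finD: "finite D" using odd_permD(1)[OF d] .
  have b: "?b \<le> 3 ^ card (D - E)"
    by (rule card_fixed_functions_le[OF odd_perm_restrict(2)[OF d E(1,3)]]) (use nofix in auto)
  have "card D = card E + card (D - E)"
    using E(1) finD card_mono[OF finD E(1)] by (simp add: card_Diff_subset finite_subset)
  then have ab: "?a * ?b = 3 ^ card E * 3 ^ card (D - E)"
    using eq unfolding card_fixed_functions_split[OF d E(1,3)] by (simp add: power_mult_distrib power_add)
  have "?a = 3 ^ card E"
  proof (rule ccontr)
    assume "?a \<noteq> 3 ^ card E"
    then have "?a < 3 ^ card E" using E(4) by simp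
    then have "?a * 3 ^ card (D - E) < 3 ^ card E * 3 ^ card (D - E)" by simp
    moreover have "?a * ?b \<le> ?a * 3 ^ card (D - E)" using b by (rule mult_le_mono2)
    ultimately show False using ab by simp
  qed
  with * show "\<pi> (\<pi> x) = x" "\<pi> x \<noteq> n x" by blast+
qed

lemma card_fixed_functions_involution:
  assumes "odd_perm n D \<pi>" "\<And>y. y \<in> D \<Longrightarrow> \<pi> (\<pi> y) = y \<and> \<pi> y \<noteq> y \<and> \<pi> y \<noteq> n y"
  shows "card (fixed_functions n D \<pi>) ^ 4 = 3 ^ card D"
  using assms
proof (induction "card D" arbitrary: D rule: less_induct)
  case less
  show ?case
  proof (cases "D = {}")
    case True
    have "fixed_functions n {} \<pi> = {\<lambda>_. 0}" by (auto simp: fixed_functions_def odd_functions_def)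
    then show ?thesis using True by simp
  next
    case False
    then obtain x where x: "x \<in> D" by blast
    note d = less.prems(1)
    have px: "\<pi> x \<in> D" using odd_permD(6)[OF d x] .
    note n2 = odd_permD(5)[OF d x] odd_permD(5)[OF d px]
    note p = less.prems(2)[OF x]
    define E where "E = {x, \<pi> x, n x, n (\<pi> x)}"
    have nn: "n (\<pi> x) \<noteq> x" using p n2 by auto
    have "n x \<noteq> n (\<pi> x)" using p n2 by auto
    then have ds: "distinct [x, \<pi> x, n x, n (\<pi> x)]"
      using p nn odd_permD(4)[OF d x] odd_permD(4)[OF d px] by auto
    then have "card (set [x, \<pi> x, n x, n (\<pi> x)]) = length [x, \<pi> x, n x, n (\<pi> x)]" by (rule distinct_card)
    then have E4: "card E = 4" by (simp add: E_def)
    have ED: "E \<subseteq> D" using x px odd_permD(3)[OF d] by (simp add: E_def)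
    have pn: "\<pi> (n x) = n (\<pi> x)" "\<pi> (n (\<pi> x)) = n x" using odd_permD(7)[OF d x] odd_permD(7)[OF d px] p by auto
    have Ec: "\<forall>y\<in>E. \<pi> y \<in> E \<and> n y \<in> E"
      using pn p n2 by (auto simp: E_def)
    have finD: "finite D" using odd_permD(1)[OF d] .
    have finE: "finite E" by (simp add: E_def)
    define h :: "3 \<Rightarrow> 'a \<Rightarrow> 3" where
      "h v y = (if y = x \<or> y = \<pi> x then v else if y = n x \<or> y = n (\<pi> x) then - v else 0)" for v y
    have "h v \<in> fixed_functions n E \<pi>" for v
      using ds pn p n2 by (auto simp: fixed_functions_def odd_functions_def h_def E_def)
    moreover have "inj h"
    proof (rule injI)
      fix v w assume "h v = h w"
      then have "h v x = h w x" by simp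
      then show "v = w" by (simp add: h_def)
    qed
    ultimately have "card (UNIV :: 3 set) \<le> card (fixed_functions n E \<pi>)"
      using finE by (intro card_inj_on_le[of h] finite_fixed_functions) auto
    then have "3 ^ 4 \<le> card (fixed_functions n E \<pi>) ^ 4" by (intro power_mono) auto
    moreover have "card (fixed_functions n E \<pi>) ^ 4 \<le> 3 ^ card E"
      by (rule card_fixed_functions_le[OF odd_perm_restrict(1)[OF d ED Ec]]) (use ED less.prems(2) in auto)
    ultimately have a: "card (fixed_functions n E \<pi>) ^ 4 = 3 ^ card E" using E4 by simp
    have "card (D - E) < card D" using ED finD by (intro psubset_card_mono) (auto simp: E_def)
    then have b: "card (fixed_functions n (D - E) \<pi>) ^ 4 = 3 ^ card (D - E)"
      using less.hyps[OF _ odd_perm_restrict(2)[OF d ED Ec]] less.prems(2) by simp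
    have "card D = card E + card (D - E)"
      using ED finD card_mono[OF finD ED] by (simp add: card_Diff_subset finite_subset)
    then show ?thesis
      unfolding card_fixed_functions_split[OF d ED Ec] by (simp add: power_mult_distrib power_add a b)
  qed
qed


section \<open>Counting planar pairings\<close>

text \<open>The number of ways to glue two circles with \<open>4 c\<close> points each: the image of one point can be any point of the
opposite colour. Two empty circles are glued in one way.\<close>

definition rotations :: "nat \<Rightarrow> nat" where "rotations c = (if c = 0 then 1 else 2 * c)"

lemma circle_reach:
  assumes c: "circle n \<chi> \<rho> C" and x: "x \<in> C" and y: "y \<in> C"
  obtains k where "y = (\<rho> ^^ k) x"
proof -
  let ?A = "range (\<lambda>k. (\<rho> ^^ k) x)"
  have in_C: "(\<rho> ^^ k) x \<in> C" for k
    by (induction k) (use x circleD(6)[OF c] in auto)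
  have "?A = C"
  proof (rule circle_closed[OF c])
    show "?A \<subseteq> C" using in_C by blast
    show "x \<in> ?A" by (rule range_eqI[of _ _ 0]) simp
    fix z assume "z \<in> ?A"
    then obtain k where "z = (\<rho> ^^ k) x" by blast
    then have "\<rho> z = (\<rho> ^^ Suc k) x" by simp
    then show "\<rho> z \<in> ?A" by blast
  qed
  then show thesis using y that by blast
qed

text \<open>A coordinate \<open>e\<close> on the circle by integers modulo its size, starting at \<open>x\<close>. Inversion is the half turn by \<open>h\<close>; only the
two divisibility properties of \<open>h\<close> that identify the half turn are recorded.\<close>

definition circle_coordinate ::
    "('a \<Rightarrow> 'a) \<Rightarrow> ('a \<Rightarrow> bool) \<Rightarrow> ('a \<Rightarrow> 'a) \<Rightarrow> 'a set \<Rightarrow> 'a \<Rightarrow> (int \<Rightarrow> 'a) \<Rightarrow> int \<Rightarrow> bool" where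
  "circle_coordinate n \<chi> \<rho> C x e h \<longleftrightarrow> e 0 = x \<and> range e = C \<and> (\<forall>k. \<rho> (e k) = e (k + 1)) \<and>
     (\<forall>k l. e k = e l \<longleftrightarrow> int (card C) dvd k - l) \<and> (\<forall>k. n (e k) = e (k + h)) \<and>
     int (card C) dvd 2 * h \<and> \<not> int (card C) dvd h \<and> (\<forall>k. \<chi> (e k) = (\<chi> x = even k))"

lemma circle_coordinateD:
  assumes "circle_coordinate n \<chi> \<rho> C x e h"
  shows "e 0 = x" "range e = C" "\<rho> (e k) = e (k + 1)"
    "e k = e l \<longleftrightarrow> int (card C) dvd k - l" "n (e k) = e (k + h)"
    "int (card C) dvd 2 * h" "\<not> int (card C) dvd h" "\<chi> (e k) = (\<chi> x = even k)"
  using assms unfolding circle_coordinate_def by blast+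

lemma circle_coordinate_exists:
  assumes c: "circle n \<chi> \<rho> C" and x: "x \<in> C"
  shows "\<exists>e h. circle_coordinate n \<chi> \<rho> C x e h"
proof -
  let ?f = "\<lambda>k. (\<rho> ^^ k) x"
  have in_C: "?f k \<in> C" for k
    by (induction k) (use x circleD(6)[OF c] in auto)
  have cancel: "?f j = x" if "?f (i + j) = ?f i" for i j
    using that
  proof (induction i)
    case (Suc i)
    have "\<rho> (?f (i + j)) = \<rho> (?f i)" using Suc.prems by simp
    then have "?f (i + j) = ?f i" by (rule circleD(9)[OF c in_C in_C])
    then show ?case by (rule Suc.IH)
  qed simp
  have "\<not> inj_on ?f {..card C}"
  proof
    assume "inj_on ?f {..card C}"
    then have "card {..card C} \<le> card C"
      using in_C circleD(1)[OF c] by (intro card_inj_on_le[of ?f]) auto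
    then show False by simp
  qed
  then obtain i j where ij: "i < j" "j \<le> card C" "?f i = ?f j"
    unfolding inj_on_def by (metis atMost_iff linorder_neqE_nat)
  have ex: "0 < j - i \<and> ?f (j - i) = x" using cancel[of i "j - i"] ij by simp
  \<comment> \<open>The period of \<open>x\<close>; it turns out to be the size of the circle.\<close>
  define M where "M = (LEAST m. 0 < m \<and> ?f m = x)"
  have M: "0 < M" "?f M = x" using LeastI[of "\<lambda>m. 0 < m \<and> ?f m = x", OF ex] by (auto simp: M_def)
  have "M \<le> j - i" using Least_le[of "\<lambda>m. 0 < m \<and> ?f m = x", OF ex] by (simp add: M_def)
  then have MC: "M \<le> card C" using ij by simp
  have least: "?f m \<noteq> x" if "0 < m" "m < M" for m
    using not_less_Least[of m "\<lambda>m. 0 < m \<and> ?f m = x"] that by (auto simp: M_def)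
  have inj: "k = l" if "k < M" "l < M" "?f k = ?f l" for k l
  proof (rule ccontr)
    assume "k \<noteq> l"
    define a where "a = min k l"
    define b where "b = max k l"
    have ab: "a < b" "b < M" "?f a = ?f b"
      using \<open>k \<noteq> l\<close> that by (auto simp: a_def b_def min_def max_def)
    have "?f (b - a) = x" using cancel[of a "b - a"] ab by simp
    then show False using least[of "b - a"] ab by simp
  qed
  have closed: "?f ` {..<M} = C"
  proof (rule circle_closed[OF c])
    show "?f ` {..<M} \<subseteq> C" using in_C by blast
    show "x \<in> ?f ` {..<M}" using M by (intro image_eqI[of _ _ 0]) auto
    fix z assume "z \<in> ?f ` {..<M}"
    then obtain k where k: "k < M" "z = ?f k" by blast
    then have z: "\<rho> z = ?f (Suc k)" by simp
    show "\<rho> z \<in> ?f ` {..<M}"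
    proof (cases "Suc k < M")
      case True then show ?thesis using z by blast
    next
      case False
      then have "Suc k = M" using k by simp
      then have "\<rho> z = ?f 0" using z M by simp
      then show ?thesis using M by blast
    qed
  qed
  have "card (?f ` {..<M}) = M" using inj by (subst card_image) (auto simp: inj_on_def)
  then have MeqC: "card C = M" using closed by simp
  define e where "e k = ?f (nat (k mod int M))" for k :: int
  have e0: "e 0 = x" using M by (simp add: e_def)
  have small: "nat (k mod int M) < M" for k :: int
    using M by (simp add: nat_less_iff)
  have range_e: "range e = C"
  proof
    show "range e \<subseteq> C" using in_C by (auto simp: e_def)
    show "C \<subseteq> range e"
    proof
      fix y assume "y \<in> C"
      then obtain k where k: "k < M" "y = ?f k" using closed by blast
      then have "y = e (int k)" by (simp add: e_def)
      then show "y \<in> range e" by blast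
    qed
  qed
  have step: "\<rho> (e k) = e (k + 1)" for k
  proof -
    let ?a = "k mod int M"
    have a: "0 \<le> ?a" "?a < int M" using M by simp_all
    have r: "\<rho> (e k) = ?f (Suc (nat ?a))" by (simp add: e_def)
    have k1: "(k + 1) mod int M = (?a + 1) mod int M" by (simp add: mod_simps)
    show ?thesis
    proof (cases "?a + 1 = int M")
      case True
      then have "Suc (nat ?a) = M" using a by linarith
      then have "\<rho> (e k) = x" using r M(2) by simp
      moreover have "e (k + 1) = x" unfolding e_def k1 True by simp
      ultimately show ?thesis by simp
    next
      case False
      then have "(?a + 1) mod int M = ?a + 1" using a by simp
      then have "nat ((k + 1) mod int M) = Suc (nat ?a)" using a k1 by simp
      then show ?thesis using r unfolding e_def by simp
    qed
  qed
  have eq_iff: "e k = e l \<longleftrightarrow> int (card C) dvd k - l" for k l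
  proof -
    have "e k = e l \<longleftrightarrow> nat (k mod int M) = nat (l mod int M)"
      using inj[OF small small] by (auto simp: e_def)
    also have "\<dots> \<longleftrightarrow> k mod int M = l mod int M" using M by (simp add: eq_nat_nat_iff)
    also have "\<dots> \<longleftrightarrow> int M dvd k - l" by (rule mod_eq_dvd_iff)
    finally show ?thesis by (simp add: MeqC)
  qed
  have eC: "e k \<in> C" for k using range_e by blast
  have "n x \<in> range e" using circleD(2)[OF c x] range_e by simp
  then obtain h where h: "n x = e h" by blast
  have nh: "n (e k) = e (k + h)" for k
  proof (induction k rule: int_induct[of _ 0])
    case base then show ?case using h e0 by simp
  next
    case (step1 i)
    have "n (e (i + 1)) = \<rho> (n (e i))" using circleD(7)[OF c eC] step by simp
    also have "\<dots> = e (i + 1 + h)" using step1.IH step by (simp add: algebra_simps)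
    finally show ?case .
  next
    case (step2 i)
    have "\<rho> (n (e (i - 1))) = n (e i)" using circleD(7)[OF c eC, of "i - 1"] step[of "i - 1"] by simp
    also have "\<dots> = \<rho> (e (i - 1 + h))" using step2.IH step[of "i - 1 + h"] by (simp add: algebra_simps)
    finally show ?case by (rule circleD(9)[OF c circleD(2)[OF c eC] eC])
  qed
  have "e (h + h) = e 0" using nh[of h] nh[of 0] circleD(4)[OF c eC, of 0] by simp
  then have "int (card C) dvd h + h - 0" unfolding eq_iff .
  then have 2: "int (card C) dvd 2 * h" by simp
  have nd: "\<not> int (card C) dvd h"
  proof
    assume "int (card C) dvd h"
    then have "e h = e 0" using eq_iff[of h 0] by simp
    then show False using h e0 circleD(3)[OF c x] by simp
  qed
  have chi: "\<chi> (e k) = (\<chi> x = even k)" for k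
  proof (induction k rule: int_induct[of _ 0])
    case base then show ?case using e0 by simp
  next
    case (step1 i)
    then show ?case using circleD(8)[OF c eC, of i] step[of i] by auto
  next
    case (step2 i)
    then show ?case using circleD(8)[OF c eC, of "i - 1"] step[of "i - 1"] by auto
  qed
  have "circle_coordinate n \<chi> \<rho> C x e h"
    unfolding circle_coordinate_def by (intro conjI allI) (fact e0 range_e step eq_iff nh 2 nd chi)+
  then show ?thesis by blast
qed

lemma card_circle_color:
  assumes c: "circle n \<chi> \<rho> C" and m: "card C = 2 * m"
  shows "card {y \<in> C. \<chi> y \<noteq> b} = m"
proof -
  have fin: "finite C" using circleD(1)[OF c] .
  have le: "card {y \<in> C. \<chi> y = a} \<le> card {y \<in> C. \<chi> y \<noteq> a}" for a
  proof (rule card_inj_on_le[where f = \<rho>])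
    show "inj_on \<rho> {y \<in> C. \<chi> y = a}" using c by (auto simp: circle_def inj_on_def)
    show "\<rho> ` {y \<in> C. \<chi> y = a} \<subseteq> {y \<in> C. \<chi> y \<noteq> a}" using circleD(6,8)[OF c] by auto
  qed (use fin in simp)
  have *: "{y \<in> C. \<chi> y \<noteq> (\<not> b)} = {y \<in> C. \<chi> y = b}" "{y \<in> C. \<chi> y = (\<not> b)} = {y \<in> C. \<chi> y \<noteq> b}" by auto
  have "card {y \<in> C. \<chi> y = b} = card {y \<in> C. \<chi> y \<noteq> b}"
    using le[of b] le[of "\<not> b"] unfolding * by (rule order_antisym)
  moreover have "card C = card {y \<in> C. \<chi> y = b} + card {y \<in> C. \<chi> y \<noteq> b}"
    using fin by (subst card_Un_disjoint[symmetric]) (auto intro: arg_cong[where f = card])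
  ultimately show ?thesis using m by simp
qed

context
  fixes n :: "'a \<Rightarrow> 'a" and \<chi> \<rho> C1 C2
  assumes circles: "two_circles n \<chi> \<rho> C1 C2"
begin

lemma disjoint_circles: "C1 \<inter> C2 = {}" and circle1: "circle n \<chi> \<rho> C1" and circle2: "circle n \<chi> \<rho> C2"
  using circles by (auto simp: two_circles_def)

lemma finite_circles: "finite C1" "finite C2"
  using circleD(1)[OF circle1] circleD(1)[OF circle2] .

lemma odd_perm_pairing:
  assumes \<sigma>: "\<sigma> \<in> pairings n \<chi> (C1 \<union> C2)"
  shows "odd_perm n (C1 \<union> C2) (\<sigma> \<circ> \<rho>)"
  unfolding odd_perm_def
proof (intro conjI ballI)
  show "finite (C1 \<union> C2)" by (rule two_circles_finite[OF circles])
  show "inj_on (\<sigma> \<circ> \<rho>) (C1 \<union> C2)"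
  proof (rule inj_onI)
    fix x y assume xy: "x \<in> C1 \<union> C2" "y \<in> C1 \<union> C2" and e: "(\<sigma> \<circ> \<rho>) x = (\<sigma> \<circ> \<rho>) y"
    have "\<rho> x = \<rho> y" using injD[OF permutes_inj[OF pairingsD(1)[OF \<sigma>]]] e by simp
    then show "x = y" by (rule two_circles_inj[OF circles xy])
  qed
  fix x assume x: "x \<in> C1 \<union> C2"
  note d = two_circlesD[OF circles x]
  show "n x \<in> C1 \<union> C2" "n x \<noteq> x" "n (n x) = x" using d by blast+
  show "(\<sigma> \<circ> \<rho>) x \<in> C1 \<union> C2" using pairingsD(2)[OF \<sigma> d(7)] by simp
  show "(\<sigma> \<circ> \<rho>) (n x) = n ((\<sigma> \<circ> \<rho>) x)" using pairingsD(4)[OF \<sigma> d(7)] d(8) by simp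
qed

text \<open>Maximality makes \<open>\<sigma> \<circ> \<rho>\<close> an involution, so \<open>\<sigma>\<close> reverses the direction of \<open>\<rho>\<close>. If \<open>\<sigma>\<close> joined \<open>x\<close> to a point \<open>k\<close>
steps further on the same circle, it would join \<open>\<rho> x\<close> to a point \<open>k - 2\<close> steps further, and so on until an
arc or a point joined to itself appears.\<close>

lemma arcless_maximal:
  assumes \<sigma>: "\<sigma> \<in> planar_pairings n \<chi> \<rho> C1 C2 c" and arcless: "\<And>y. y \<in> C1 \<union> C2 \<Longrightarrow> \<sigma> y \<noteq> \<rho> y"
    and x: "x \<in> C1 \<union> C2"
  shows "\<rho> (\<sigma> (\<rho> x)) = \<sigma> x" "\<sigma> x \<in> C1 \<longleftrightarrow> x \<notin> C1"
proof -
  have p: "\<sigma> \<in> pairings n \<chi> (C1 \<union> C2)"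
    and full: "card (fixed_functions n (C1 \<union> C2) (\<sigma> \<circ> \<rho>)) ^ 4 = 3 ^ card (C1 \<union> C2)"
    using \<sigma> by (simp_all add: planar_pairings_def)
  have rD: "\<rho> y \<in> C1 \<union> C2" if "y \<in> C1 \<union> C2" for y using two_circlesD(7)[OF circles that] .
  have nofix: "(\<sigma> \<circ> \<rho>) y \<noteq> y" if y: "y \<in> C1 \<union> C2" for y
  proof
    assume "(\<sigma> \<circ> \<rho>) y = y"
    then have "\<sigma> y = \<rho> y" using pairingsD(3)[OF p rD[OF y]] by simp
    then show False using arcless[OF y] by simp
  qed
  have rev: "\<rho> (\<sigma> (\<rho> y)) = \<sigma> y" if y: "y \<in> C1 \<union> C2" for y
  proof -
    have "\<sigma> (\<rho> (\<sigma> (\<rho> y))) = y"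
      using card_fixed_functions_maximal(1)[OF odd_perm_pairing[OF p] nofix full y] by simp
    then show ?thesis using pairingsD(3)[OF p rD[OF pairingsD(2)[OF p rD[OF y]]]] by metis
  qed
  show "\<rho> (\<sigma> (\<rho> x)) = \<sigma> x" using rev[OF x] .
  have no: "\<sigma> y \<noteq> (\<rho> ^^ k) y" if "y \<in> C1 \<union> C2" for k y
    using that
  proof (induction k arbitrary: y rule: less_induct)
    case (less k)
    consider "k = 0" | "k = 1" | m where "k = Suc (Suc m)"
      by (metis One_nat_def not0_implies_Suc)
    then show ?case
    proof cases
      case 1
      then show ?thesis using pairingsD(5)[OF p less.prems] by auto
    next
      case 2
      then show ?thesis using arcless[OF less.prems] by simp
    next
      case 3
      show ?thesis
      proof
        assume "\<sigma> y = (\<rho> ^^ k) y"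
        then have "\<rho> (\<sigma> (\<rho> y)) = \<rho> ((\<rho> ^^ m) (\<rho> y))"
          using rev[OF less.prems] 3 by (simp add: funpow_swap1)
        moreover have "(\<rho> ^^ m) z \<in> C1 \<union> C2" if "z \<in> C1 \<union> C2" for z
          using that by (induction m) (use rD in auto)
        ultimately have "\<sigma> (\<rho> y) = (\<rho> ^^ m) (\<rho> y)"
          using two_circles_inj[OF circles pairingsD(2)[OF p rD[OF less.prems]]] rD[OF less.prems] by blast
        then show False using less.IH[of m "\<rho> y"] 3 rD[OF less.prems] by simp
      qed
    qed
  qed
  show "\<sigma> x \<in> C1 \<longleftrightarrow> x \<notin> C1"
  proof (rule ccontr)
    assume a: "\<not> (\<sigma> x \<in> C1 \<longleftrightarrow> x \<notin> C1)"
    obtain C where C: "circle n \<chi> \<rho> C" "x \<in> C" "\<And>y. y \<in> C1 \<union> C2 \<Longrightarrow> y \<in> C \<longleftrightarrow> (y \<in> C1 \<longleftrightarrow> x \<in> C1)"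
      using two_circles_home[OF circles x] by blast
    have "\<sigma> x \<in> C" using C(3)[OF pairingsD(2)[OF p x]] a by blast
    then obtain k where "\<sigma> x = (\<rho> ^^ k) x" using circle_reach[OF C(1,2)] by blast
    then show False using no[OF x] by blast
  qed
qed

lemma arcless_card:
  assumes \<sigma>: "\<sigma> \<in> planar_pairings n \<chi> \<rho> C1 C2 c" and arcless: "\<And>y. y \<in> C1 \<union> C2 \<Longrightarrow> \<sigma> y \<noteq> \<rho> y"
  shows "card C1 = 4 * c" "card C2 = 4 * c"
proof -
  have p: "\<sigma> \<in> pairings n \<chi> (C1 \<union> C2)"
    and cross: "card {y \<in> C1 \<union> C2. (y \<in> C1) \<noteq> (\<sigma> y \<in> C1)} = 8 * c"
    using \<sigma> by (simp_all add: planar_pairings_def)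
  note sw = arcless_maximal(2)[OF \<sigma> arcless]
  have "{y \<in> C1 \<union> C2. (y \<in> C1) \<noteq> (\<sigma> y \<in> C1)} = C1 \<union> C2" using sw by blast
  then have "card (C1 \<union> C2) = 8 * c" using cross by simp
  then have s: "card C1 + card C2 = 8 * c"
    using card_Un_disjoint[OF finite_circles disjoint_circles] by simp
  have inj: "inj_on \<sigma> A" for A using permutes_inj[OF pairingsD(1)[OF p]] by (rule inj_on_subset) simp
  have "\<sigma> ` C1 \<subseteq> C2" "\<sigma> ` C2 \<subseteq> C1"
    using sw pairingsD(2)[OF p] disjoint_circles by blast+
  then have "card C1 \<le> card C2" "card C2 \<le> card C1"
    using card_inj_on_le[OF inj, of C1 C2] card_inj_on_le[OF inj, of C2 C1] finite_circles by simp_all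
  then show "card C1 = 4 * c" "card C2 = 4 * c" using s by simp_all
qed

text \<open>A reversal of direction is determined by the image of one point.\<close>

lemma arcless_determined:
  assumes \<sigma>: "\<sigma> \<in> planar_pairings n \<chi> \<rho> C1 C2 c" "\<And>y. y \<in> C1 \<union> C2 \<Longrightarrow> \<sigma> y \<noteq> \<rho> y"
    and \<sigma>': "\<sigma>' \<in> planar_pairings n \<chi> \<rho> C1 C2 c" "\<And>y. y \<in> C1 \<union> C2 \<Longrightarrow> \<sigma>' y \<noteq> \<rho> y"
    and x: "x \<in> C1" and e: "\<sigma> x = \<sigma>' x"
  shows "\<sigma> = \<sigma>'"
proof -
  have p: "\<sigma> \<in> pairings n \<chi> (C1 \<union> C2)" and p': "\<sigma>' \<in> pairings n \<chi> (C1 \<union> C2)"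
    using \<sigma>(1) \<sigma>'(1) by (simp_all add: planar_pairings_def)
  have "{y \<in> C1. \<sigma> y = \<sigma>' y} = C1"
  proof (rule circle_closed[OF circle1, of _ x])
    fix y assume "y \<in> {y \<in> C1. \<sigma> y = \<sigma>' y}"
    then have y: "y \<in> C1" "\<sigma> y = \<sigma>' y" by auto
    have ry: "\<rho> y \<in> C1" using circleD(6)[OF circle1 y(1)] .
    have "\<rho> (\<sigma> (\<rho> y)) = \<rho> (\<sigma>' (\<rho> y))"
      using arcless_maximal(1)[OF \<sigma>, of y] arcless_maximal(1)[OF \<sigma>', of y] y by simp
    then have "\<sigma> (\<rho> y) = \<sigma>' (\<rho> y)"
      by (rule two_circles_inj[OF circles pairingsD(2)[OF p] pairingsD(2)[OF p'], rotated 2]) (use ry in auto)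
    then show "\<rho> y \<in> {y \<in> C1. \<sigma> y = \<sigma>' y}" using ry by simp
  qed (use x e in auto)
  then have on1: "\<sigma> y = \<sigma>' y" if "y \<in> C1" for y using that by blast
  show ?thesis
  proof
    fix y
    consider "y \<in> C1" | "y \<in> C2" "y \<notin> C1" | "y \<notin> C1 \<union> C2" by blast
    then show "\<sigma> y = \<sigma>' y"
    proof cases
      case 1 then show ?thesis by (rule on1)
    next
      case 2
      then have yD: "y \<in> C1 \<union> C2" by blast
      have "\<sigma> y \<in> C1" using arcless_maximal(2)[OF \<sigma> yD] 2 by blast
      then have "\<sigma>' (\<sigma> y) = y" using on1 pairingsD(3)[OF p yD] by simp
      then show ?thesis using pairingsD(3)[OF p' pairingsD(2)[OF p yD]] by simp
    next
      case 3
      then show ?thesis using pairingsD(6)[OF p] pairingsD(6)[OF p'] by simp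
    qed
  qed
qed

text \<open>In coordinates based at \<open>x\<close> and \<open>y\<close> the pairing joins \<open>k\<close> on one circle to \<open>- k\<close> on the other.\<close>

lemma arcless_exists:
  assumes card: "card C1 = 4 * c" "card C2 = 4 * c" and x: "x \<in> C1" and y: "y \<in> C2" "\<chi> y \<noteq> \<chi> x"
  shows "\<exists>\<sigma>\<in>planar_pairings n \<chi> \<rho> C1 C2 c. (\<forall>z\<in>C1 \<union> C2. \<sigma> z \<noteq> \<rho> z) \<and> \<sigma> x = y"
proof -
  let ?D = "C1 \<union> C2"
  obtain e h where "circle_coordinate n \<chi> \<rho> C1 x e h"
    using circle_coordinate_exists[OF circle1 x] by blast
  note e = circle_coordinateD[OF this]
  obtain e' h' where "circle_coordinate n \<chi> \<rho> C2 y e' h'"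
    using circle_coordinate_exists[OF circle2 y(1)] by blast
  note e' = circle_coordinateD[OF this]
  define M where "M = int (4 * c)"
  have Mc: "int (card C1) = M" "int (card C2) = M" using card by (simp_all add: M_def)
  note e = e[unfolded Mc] and e' = e'[unfolded Mc]
  \<comment> \<open>Two half turns, one on each circle, add up to a multiple of the full turn; this makes the gluing compatible with inversion.\<close>
  have hh: "M dvd h + h'"
  proof -
    obtain t where t: "2 * h = M * t" using e(6) by blast
    obtain s where s: "2 * h' = M * s" using e'(6) by blast
    have "odd t" "odd s"
      using t s e(7) e'(7) by (auto elim!: evenE)
    then obtain u where "t + s = 2 * u" using odd_even_add evenE by metis
    then have "2 * (h + h') = 2 * (M * u)" using t s by (metis distrib_left mult.left_commute)
    then have "h + h' = M * u" by (simp only: mult_cancel_left) simp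
    then show ?thesis by (rule dvdI)
  qed
  \<comment> \<open>The choice of the coordinate does not matter: it is unique modulo \<open>M\<close>.\<close>
  define \<sigma> where "\<sigma> z = (if z \<in> C1 then e' (- (SOME k. e k = z)) else if z \<in> C2 then e (- (SOME k. e' k = z)) else z)" for z
  have eC: "e k \<in> C1" "e' k \<in> C2" "e' k \<notin> C1" for k using e(2) e'(2) disjoint_circles by blast+
  have \<sigma>1: "\<sigma> (e k) = e' (- k)" for k
  proof -
    have "e (SOME j. e j = e k) = e k" by (rule someI) (rule refl)
    then have "M dvd (SOME j. e j = e k) - k" using e(4) by simp
    then have "M dvd - (SOME j. e j = e k) - (- k)" by (simp add: dvd_diff_commute)
    then have "e' (- (SOME j. e j = e k)) = e' (- k)" using e'(4) by simp
    then show ?thesis using eC by (simp add: \<sigma>_def)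
  qed
  have \<sigma>2: "\<sigma> (e' k) = e (- k)" for k
  proof -
    have "e' (SOME j. e' j = e' k) = e' k" by (rule someI) (rule refl)
    then have "M dvd (SOME j. e' j = e' k) - k" using e'(4) by simp
    then have "M dvd - (SOME j. e' j = e' k) - (- k)" by (simp add: dvd_diff_commute)
    then have "e (- (SOME j. e' j = e' k)) = e (- k)" using e(4) by simp
    then show ?thesis using eC by (simp add: \<sigma>_def)
  qed
  have cases: "P z" if "z \<in> ?D" "\<And>k. P (e k)" "\<And>k. P (e' k)" for P z
    using that e(2) e'(2) by blast
  have shift: "e (k + h) = e (k - h')" "e' (k + h') = e' (k - h)" for k
    using hh by (simp_all add: e(4) e'(4) add.commute)
  have p: "\<sigma> \<in> pairings n \<chi> ?D"
  proof (rule pairingsI)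
    fix z assume z: "z \<in> ?D"
    show "\<sigma> z \<in> ?D" by (rule cases[OF z]) (use eC in \<open>auto simp: \<sigma>1 \<sigma>2\<close>)
    show "\<sigma> (\<sigma> z) = z" by (rule cases[OF z]) (auto simp: \<sigma>1 \<sigma>2)
    show "\<sigma> (n z) = n (\<sigma> z)"
      by (rule cases[OF z]) (simp_all add: \<sigma>1 \<sigma>2 e(5) e'(5) shift)
    show "\<chi> (\<sigma> z) \<noteq> \<chi> z"
      by (rule cases[OF z]) (use y(2) in \<open>auto simp: \<sigma>1 \<sigma>2 e(8) e'(8)\<close>)
  qed (simp add: \<sigma>_def)
  have inv: "(\<sigma> \<circ> \<rho>) ((\<sigma> \<circ> \<rho>) z) = z \<and> (\<sigma> \<circ> \<rho>) z \<noteq> z \<and> (\<sigma> \<circ> \<rho>) z \<noteq> n z" if z: "z \<in> ?D" for z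
  proof (rule cases[OF z])
    fix k
    have "e' (- (k + 1)) \<noteq> e k" "e' (- (k + 1)) \<noteq> e (k + h)" using eC by metis+
    then show "(\<sigma> \<circ> \<rho>) ((\<sigma> \<circ> \<rho>) (e k)) = e k \<and> (\<sigma> \<circ> \<rho>) (e k) \<noteq> e k \<and> (\<sigma> \<circ> \<rho>) (e k) \<noteq> n (e k)"
      by (simp add: e(3,5) e'(3) \<sigma>1 \<sigma>2)
    have "e (- (k + 1)) \<noteq> e' k" "e (- (k + 1)) \<noteq> e' (k + h')" using eC by metis+
    then show "(\<sigma> \<circ> \<rho>) ((\<sigma> \<circ> \<rho>) (e' k)) = e' k \<and> (\<sigma> \<circ> \<rho>) (e' k) \<noteq> e' k \<and> (\<sigma> \<circ> \<rho>) (e' k) \<noteq> n (e' k)"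
      by (simp add: e(3) e'(3,5) \<sigma>1 \<sigma>2)
  qed
  have "card (fixed_functions n ?D (\<sigma> \<circ> \<rho>)) ^ 4 = 3 ^ card ?D"
    by (rule card_fixed_functions_involution[OF odd_perm_pairing[OF p] inv])
  moreover have "{z \<in> ?D. (z \<in> C1) \<noteq> (\<sigma> z \<in> C1)} = ?D"
  proof -
    have "(z \<in> C1) \<noteq> (\<sigma> z \<in> C1)" if z: "z \<in> ?D" for z
      by (rule cases[OF z]) (use eC in \<open>auto simp: \<sigma>1 \<sigma>2\<close>)
    then show ?thesis by blast
  qed
  moreover have "card ?D = 8 * c"
    using card_Un_disjoint[OF finite_circles disjoint_circles] card by simp
  ultimately have "\<sigma> \<in> planar_pairings n \<chi> \<rho> C1 C2 c" using p by (simp add: planar_pairings_def)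
  moreover have "\<sigma> z \<noteq> \<rho> z" if z: "z \<in> ?D" for z
  proof (rule cases[OF z])
    fix k
    have "e' (- k) \<noteq> e (k + 1)" "e (- k) \<noteq> e' (k + 1)" using eC by metis+
    then show "\<sigma> (e k) \<noteq> \<rho> (e k)" "\<sigma> (e' k) \<noteq> \<rho> (e' k)" by (simp_all only: \<sigma>1 \<sigma>2 e(3) e'(3) not_False_eq_True)
  qed
  moreover have "\<sigma> x = y" using \<sigma>1[of 0] e(1) e'(1) by simp
  ultimately show ?thesis by blast
qed

lemma card_arcless:
  assumes card: "card C1 = 4 * c" "card C2 = 4 * c"
  shows "card {\<sigma> \<in> planar_pairings n \<chi> \<rho> C1 C2 c. \<forall>y\<in>C1 \<union> C2. \<sigma> y \<noteq> \<rho> y} = rotations c"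
proof (cases "c = 0")
  case True
  then have e: "C1 = {}" "C2 = {}" using card finite_circles by auto
  have "fixed_functions n {} (id \<circ> \<rho>) = {\<lambda>_. 0}" by (auto simp: fixed_functions_def odd_functions_def)
  moreover have "pairings n \<chi> {} = {id}" by (auto simp: pairings_def)
  ultimately have "{\<sigma> \<in> planar_pairings n \<chi> \<rho> C1 C2 c. \<forall>y\<in>C1 \<union> C2. \<sigma> y \<noteq> \<rho> y} = {id}"
    unfolding planar_pairings_def e True by auto
  then show ?thesis using True by (simp add: rotations_def)
next
  case False
  let ?X = "{\<sigma> \<in> planar_pairings n \<chi> \<rho> C1 C2 c. \<forall>y\<in>C1 \<union> C2. \<sigma> y \<noteq> \<rho> y}"
  obtain x where x: "x \<in> C1" using card(1) False by (metis card.empty equals0I mult_eq_0_iff zero_neq_numeral)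
  have "bij_betw (\<lambda>\<sigma>. \<sigma> x) ?X {y \<in> C2. \<chi> y \<noteq> \<chi> x}"
    unfolding bij_betw_def
  proof
    show "inj_on (\<lambda>\<sigma>. \<sigma> x) ?X"
    proof (rule inj_onI)
      fix \<sigma> \<sigma>' assume "\<sigma> \<in> ?X" "\<sigma>' \<in> ?X" "\<sigma> x = \<sigma>' x"
      then show "\<sigma> = \<sigma>'" using arcless_determined[of \<sigma> c \<sigma>' x] x by blast
    qed
    show "(\<lambda>\<sigma>. \<sigma> x) ` ?X = {y \<in> C2. \<chi> y \<noteq> \<chi> x}"
    proof
      show "(\<lambda>\<sigma>. \<sigma> x) ` ?X \<subseteq> {y \<in> C2. \<chi> y \<noteq> \<chi> x}"
      proof (rule image_subsetI)
        fix \<sigma> assume s: "\<sigma> \<in> ?X"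
        then have p: "\<sigma> \<in> pairings n \<chi> (C1 \<union> C2)" by (simp add: planar_pairings_def)
        have xD: "x \<in> C1 \<union> C2" using x by blast
        have "\<sigma> x \<notin> C1" using arcless_maximal(2)[of \<sigma> c x] s x xD by blast
        then show "\<sigma> x \<in> {y \<in> C2. \<chi> y \<noteq> \<chi> x}"
          using pairingsD(2)[OF p xD] pairingsD(5)[OF p xD] by blast
      qed
      show "{y \<in> C2. \<chi> y \<noteq> \<chi> x} \<subseteq> (\<lambda>\<sigma>. \<sigma> x) ` ?X"
        using arcless_exists[OF card x] by blast
    qed
  qed
  then have "card ?X = card {y \<in> C2. \<chi> y \<noteq> \<chi> x}" by (rule bij_betw_same_card)
  also have "\<dots> = 2 * c" by (rule card_circle_color[OF circle2]) (use card in simp)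
  finally show ?thesis using False by (simp add: rotations_def)
qed

text \<open>The set of opening brackets on a circle is closed under \<open>\<rho>\<close> here, so it is empty or the whole circle, and a whole nonempty circle
violates the balance.\<close>

lemma descentless_words:
  "{W \<in> circle_words n C1 C2 c. \<forall>y\<in>C1 \<union> C2. \<not> (y \<in> W \<and> \<rho> y \<notin> W)}
    = (if card C1 = 4 * c \<and> card C2 = 4 * c then {{}} else {})" (is "?Y = _")
proof -
  have one: "W \<inter> C = {} \<and> card C = 4 * c"
    if c: "circle n \<chi> \<rho> C" "C \<subseteq> C1 \<union> C2" and W: "\<forall>y\<in>C1 \<union> C2. \<not> (y \<in> W \<and> \<rho> y \<notin> W)"
      and b: "2 * card (W \<inter> C) + 4 * c = card C" for C W
  proof -
    have "W \<inter> C = {} \<or> W \<inter> C = C"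
    proof (cases "W \<inter> C = {}")
      case False
      then obtain x where "x \<in> W \<inter> C" by blast
      then have "W \<inter> C = C"
        by (intro circle_closed[OF c(1), of _ x]) (use W c(2) circleD(6)[OF c(1)] in blast)+
      then show ?thesis by blast
    qed blast
    then show ?thesis
    proof
      assume "W \<inter> C = {}" then show ?thesis using b by simp
    next
      assume e: "W \<inter> C = C"
      then have "card C = 0 \<and> c = 0" using b by simp
      then show ?thesis using circleD(1)[OF c(1)] by simp
    qed
  qed
  have "?Y \<subseteq> (if card C1 = 4 * c \<and> card C2 = 4 * c then {{}} else {})"
  proof
    fix W assume "W \<in> ?Y"
    then have W: "\<forall>y\<in>C1 \<union> C2. \<not> (y \<in> W \<and> \<rho> y \<notin> W)" "W \<subseteq> C1 \<union> C2"
      "2 * card (W \<inter> C1) + 4 * c = card C1" "2 * card (W \<inter> C2) + 4 * c = card C2"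
      by (auto simp: circle_words_def)
    have "W \<inter> C1 = {} \<and> card C1 = 4 * c" by (rule one[OF circle1 _ W(1,3)]) blast
    moreover have "W \<inter> C2 = {} \<and> card C2 = 4 * c" by (rule one[OF circle2 _ W(1,4)]) blast
    ultimately show "W \<in> (if card C1 = 4 * c \<and> card C2 = 4 * c then {{}} else {})"
      using W(2) by auto
  qed
  moreover have "{} \<in> ?Y" if "card C1 = 4 * c \<and> card C2 = 4 * c" using that by (simp add: circle_words_def)
  ultimately show ?thesis by (auto split: if_splits)
qed

lemma card_arcless_eq:
  "card {\<sigma> \<in> planar_pairings n \<chi> \<rho> C1 C2 c. \<forall>y\<in>C1 \<union> C2. \<sigma> y \<noteq> \<rho> y}
    = rotations c * card {W \<in> circle_words n C1 C2 c. \<forall>y\<in>C1 \<union> C2. \<not> (y \<in> W \<and> \<rho> y \<notin> W)}"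
proof (cases "card C1 = 4 * c \<and> card C2 = 4 * c")
  case True
  then show ?thesis using card_arcless unfolding descentless_words by simp
next
  case False
  then have "{\<sigma> \<in> planar_pairings n \<chi> \<rho> C1 C2 c. \<forall>y\<in>C1 \<union> C2. \<sigma> y \<noteq> \<rho> y} = {}"
    using arcless_card by blast
  then have "card {\<sigma> \<in> planar_pairings n \<chi> \<rho> C1 C2 c. \<forall>y\<in>C1 \<union> C2. \<sigma> y \<noteq> \<rho> y} = 0" by (simp only: card.empty)
  then show ?thesis using False unfolding descentless_words by auto
qed

lemma finite_planar_pairings: "finite (planar_pairings n \<chi> \<rho> C1 C2 c)"
proof -
  have "finite {\<sigma>. \<sigma> permutes (C1 \<union> C2)}" using finite_circles by (intro finite_permutations) simp
  then show ?thesis by (rule rev_finite_subset) (auto simp: planar_pairings_def pairings_def)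
qed

lemma finite_circle_words: "finite (circle_words n C1 C2 c)"
proof (rule finite_subset)
  show "circle_words n C1 C2 c \<subseteq> Pow (C1 \<union> C2)" unfolding circle_words_def by blast
  show "finite (Pow (C1 \<union> C2))" using finite_circles by simp
qed

end

text \<open>Induction on the number of points. For nonempty \<open>J\<close> one deletes the arc at a point of \<open>J\<close>; the conditions
at the other points of \<open>J\<close> either pass to the smaller circles or contradict the arc, for pairings and words alike. For
empty \<open>J\<close>, the nonempty sets determine how many pairings and words have some arc, and the
remaining ones were counted directly.\<close>

lemma card_planar_pairings_with_arcs:
  assumes "two_circles n \<chi> \<rho> C1 C2" "J \<subseteq> C1 \<union> C2"
  shows "card {\<sigma> \<in> planar_pairings n \<chi> \<rho> C1 C2 c. \<forall>y\<in>J. \<sigma> y = \<rho> y}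
    = rotations c * card {W \<in> circle_words n C1 C2 c. \<forall>y\<in>J. y \<in> W \<and> \<rho> y \<notin> W}"
  using assms
proof (induction "card (C1 \<union> C2)" arbitrary: \<rho> C1 C2 J rule: less_induct)
  case less
  note circles = less.prems(1)
  have nonempty: "card {\<sigma> \<in> planar_pairings n \<chi> \<rho> C1 C2 c. \<forall>y\<in>J. \<sigma> y = \<rho> y}
      = rotations c * card {W \<in> circle_words n C1 C2 c. \<forall>y\<in>J. y \<in> W \<and> \<rho> y \<notin> W}"
    if J: "J \<subseteq> C1 \<union> C2" "J \<noteq> {}" for J
  proof -
    obtain x where x: "x \<in> J" using J(2) by blast
    interpret arc_removal n \<chi> \<rho> C1 C2 x
      by unfold_locales (use circles x J(1) in auto)
    \<comment> \<open>By symmetry an arc at \<open>x\<close> includes the arc at \<open>n x\<close>.\<close>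
    define L where "L = J - {x, n x}"
    have "(\<forall>y\<in>J. \<sigma> y = \<rho> y) \<longleftrightarrow> \<sigma> x = \<rho> x \<and> (\<forall>y\<in>L. \<sigma> y = \<rho> y)"
      if "\<sigma> \<in> planar_pairings n \<chi> \<rho> C1 C2 c" for \<sigma>
    proof -
      have p: "\<sigma> \<in> pairings n \<chi> D" using that by (simp add: planar_pairings_def)
      have "\<sigma> (n x) = \<rho> (n x)" if "\<sigma> x = \<rho> x" using sigma_K_eqs(3)[OF p that] n_rho(1) by simp
      then show ?thesis using x unfolding L_def by blast
    qed
    then have P: "{\<sigma> \<in> planar_pairings n \<chi> \<rho> C1 C2 c. \<forall>y\<in>J. \<sigma> y = \<rho> y}
      = {\<sigma> \<in> planar_pairings n \<chi> \<rho> C1 C2 c. \<sigma> x = \<rho> x \<and> (\<forall>y\<in>L. \<sigma> y = \<rho> y)}" by blast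
    have "(\<forall>y\<in>J. y \<in> W \<and> \<rho> y \<notin> W) \<longleftrightarrow> x \<in> W \<and> \<rho> x \<notin> W \<and> (\<forall>y\<in>L. y \<in> W \<and> \<rho> y \<notin> W)"
      if "W \<in> circle_words n C1 C2 c" for W
    proof -
      have Wn: "n z \<in> W" if "z \<in> W" for z using \<open>W \<in> circle_words n C1 C2 c\<close> that by (simp add: circle_words_def)
      have "n x \<in> W \<and> \<rho> (n x) \<notin> W" if "x \<in> W" "\<rho> x \<notin> W"
        using Wn[OF that(1)] Wn[of "n (\<rho> x)"] that(2) n_rho by auto
      then show ?thesis using x unfolding L_def by blast
    qed
    then have W: "{W \<in> circle_words n C1 C2 c. \<forall>y\<in>J. y \<in> W \<and> \<rho> y \<notin> W}
      = {W \<in> circle_words n C1 C2 c. x \<in> W \<and> \<rho> x \<notin> W \<and> (\<forall>y\<in>L. y \<in> W \<and> \<rho> y \<notin> W)}" by blast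
    show ?thesis
    proof (cases "\<exists>y\<in>L. y \<in> K \<or> \<rho> y \<in> K")
      case True
      then obtain y where y: "y \<in> L" "y \<in> K \<or> \<rho> y \<in> K" by blast
      then have y': "y \<in> D" "y \<noteq> x" "y \<noteq> n x" using J(1) by (auto simp: L_def)
      have "\<sigma> \<in> pairings n \<chi> D" if "\<sigma> \<in> planar_pairings n \<chi> \<rho> C1 C2 c" for \<sigma>
        using that by (simp add: planar_pairings_def)
      then have e: "{\<sigma> \<in> planar_pairings n \<chi> \<rho> C1 C2 c. \<sigma> x = \<rho> x \<and> (\<forall>y\<in>L. \<sigma> y = \<rho> y)} = {}"
        using arcs_incompatible[OF _ _ y' y(2)] y(1) by blast
      have e': "{W \<in> circle_words n C1 C2 c. x \<in> W \<and> \<rho> x \<notin> W \<and> (\<forall>y\<in>L. y \<in> W \<and> \<rho> y \<notin> W)} = {}"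
        using words_incompatible[OF _ _ _ y' y(2)] y(1) by blast
      show ?thesis unfolding P W e e' by simp
    next
      case False
      then have L: "L \<subseteq> D - K" "\<And>y. y \<in> L \<Longrightarrow> \<rho> y \<notin> K" using J(1) by (auto simp: L_def)
      have "card ((C1 - K) \<union> (C2 - K)) < card D" using card_D by (simp add: Un_Diff)
      from less.hyps[OF this two_circles_bypass[OF circles x_in], of L] L(1)
      have "card {\<sigma> \<in> planar_pairings n \<chi> \<rho>' (C1 - K) (C2 - K) c. \<forall>y\<in>L. \<sigma> y = \<rho>' y}
        = rotations c * card {W \<in> circle_words n (C1 - K) (C2 - K) c. \<forall>y\<in>L. y \<in> W \<and> \<rho>' y \<notin> W}"
        by (simp add: Un_Diff)
      moreover have "card {\<sigma> \<in> planar_pairings n \<chi> \<rho> C1 C2 c. \<sigma> x = \<rho> x \<and> (\<forall>y\<in>L. \<sigma> y = \<rho> y)}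
          = card {\<sigma> \<in> planar_pairings n \<chi> \<rho>' (C1 - K) (C2 - K) c. \<forall>y\<in>L. \<sigma> y = \<rho>' y}"
        using L(1) by (rule card_planar_arc) (rule L(2))
      moreover have "card {W \<in> circle_words n C1 C2 c. x \<in> W \<and> \<rho> x \<notin> W \<and> (\<forall>y\<in>L. y \<in> W \<and> \<rho> y \<notin> W)}
          = card {W \<in> circle_words n (C1 - K) (C2 - K) c. \<forall>y\<in>L. y \<in> W \<and> \<rho>' y \<notin> W}"
        using L(1) by (rule card_words_arc) (rule L(2))
      ultimately show ?thesis unfolding P W by (simp only:)
    qed
  qed
  show ?case
  proof (cases "J = {}")
    case False
    then show ?thesis using nonempty less.prems(2) by blast
  next
    case True
    let ?D = "C1 \<union> C2" and ?P = "planar_pairings n \<chi> \<rho> C1 C2 c" and ?Y = "circle_words n C1 C2 c"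
    let ?a = "\<lambda>\<sigma>. {y \<in> ?D. \<sigma> y = \<rho> y}" and ?b = "\<lambda>W. {y \<in> ?D. y \<in> W \<and> \<rho> y \<notin> W}"
    have fin: "finite ?P" "finite ?Y" "finite ?D"
      using finite_planar_pairings[OF circles] finite_circle_words[OF circles] two_circles_finite[OF circles] .
    have some: "card {\<sigma> \<in> ?P. ?a \<sigma> \<noteq> {}} = rotations c * card {W \<in> ?Y. ?b W \<noteq> {}}"
    proof (rule card_by_superset_counts[OF fin])
      fix J assume J: "J \<subseteq> ?D" "J \<noteq> {}"
      have "J \<subseteq> ?a \<sigma> \<longleftrightarrow> (\<forall>y\<in>J. \<sigma> y = \<rho> y)" for \<sigma> using J(1) by blast
      moreover have "J \<subseteq> ?b W \<longleftrightarrow> (\<forall>y\<in>J. y \<in> W \<and> \<rho> y \<notin> W)" for W using J(1) by blast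
      ultimately show "card {\<sigma> \<in> ?P. J \<subseteq> ?a \<sigma>} = rotations c * card {W \<in> ?Y. J \<subseteq> ?b W}"
        using nonempty[OF J] by (simp only:)
    qed auto
    have "?a \<sigma> = {} \<longleftrightarrow> (\<forall>y\<in>?D. \<sigma> y \<noteq> \<rho> y)" for \<sigma> by blast
    moreover have "?b W = {} \<longleftrightarrow> (\<forall>y\<in>?D. \<not> (y \<in> W \<and> \<rho> y \<notin> W))" for W by blast
    ultimately have none: "card {\<sigma> \<in> ?P. ?a \<sigma> = {}} = rotations c * card {W \<in> ?Y. ?b W = {}}"
      using card_arcless_eq[OF circles] by (simp only:)
    have split: "card X = card {x \<in> X. d x \<noteq> {}} + card {x \<in> X. d x = {}}"
      if "finite X" for X :: "'x set" and d :: "'x \<Rightarrow> 'b set"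
    proof -
      have "X = {x \<in> X. d x \<noteq> {}} \<union> {x \<in> X. d x = {}}" by blast
      moreover have "card ({x \<in> X. d x \<noteq> {}} \<union> {x \<in> X. d x = {}}) = card {x \<in> X. d x \<noteq> {}} + card {x \<in> X. d x = {}}"
        using that by (intro card_Un_disjoint) auto
      ultimately show ?thesis by (simp only:)
    qed
    have "card ?P = rotations c * card ?Y"
      unfolding split[OF fin(1), of ?a] split[OF fin(2), of ?b] some none by (rule distrib_left[symmetric])
    then show ?thesis using True by simp
  qed
qed

theorem card_planar_pairings:
  "two_circles n \<chi> \<rho> C1 C2 \<Longrightarrow> card (planar_pairings n \<chi> \<rho> C1 C2 c) = rotations c * card (circle_words n C1 C2 c)"
  using card_planar_pairings_with_arcs[of n \<chi> \<rho> C1 C2 "{}" c] by simp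


section \<open>Orbits that cross between the circles\<close>

text \<open>The map \<open>\<rho> \<circ> \<sigma>\<close> is used instead of \<open>\<sigma> \<circ> \<rho>\<close>: ends of crossing chords are never deleted, so they are good starting
points of orbits of \<open>\<rho> \<circ> \<sigma>\<close>. Such an orbit enters the deleted points only at \<open>x\<close> or \<open>n x\<close> and leaves them again two steps of
\<open>\<rho>\<close> later.\<close>

lemma (in arc_removal) orbit_remove_arc:
  assumes \<sigma>: "\<sigma> \<in> pairings n \<chi> D" "\<sigma> x = \<rho> x" and u: "u \<in> D" "u \<notin> K" and v: "v \<in> orbit (\<rho> \<circ> \<sigma>) u" "v \<notin> K"
  shows "v \<in> orbit (\<rho>' \<circ> remove_arc K \<sigma>) u"
proof -
  let ?o = "orbit (\<rho>' \<circ> remove_arc K \<sigma>) u"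
  have r: "(\<rho>' \<circ> remove_arc K \<sigma>) w = \<rho>' (\<sigma> w) \<and> \<sigma> w \<in> D \<and> \<sigma> w \<notin> K" if "w \<in> D" "w \<notin> K" for w
    using that pairingsD(2)[OF \<sigma>(1)] sigma_K[OF \<sigma>] by (simp add: remove_arc_def)
  have o_in: "w \<in> D \<and> w \<notin> K" if "w \<in> ?o" for w
    using that
  proof induction
    case base
    then show ?case using r[OF u] bypass_D' by simp
  next
    case (step w)
    then show ?case using r[of w] bypass_D' by simp
  qed
  have next_in: "((\<rho> \<circ> \<sigma>) w \<notin> K \<and> (\<rho> \<circ> \<sigma>) w \<in> ?o)
      \<or> (((\<rho> \<circ> \<sigma>) w = x \<or> (\<rho> \<circ> \<sigma>) w = n x) \<and> \<rho> (\<rho> ((\<rho> \<circ> \<sigma>) w)) \<in> ?o)"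
    if w: "w \<in> D" "w \<notin> K" and wo: "(\<rho>' \<circ> remove_arc K \<sigma>) w \<in> ?o" for w
  proof -
    have a: "\<rho>' (\<sigma> w) \<in> ?o" and s: "\<sigma> w \<in> D" "\<sigma> w \<notin> K" using wo r[OF w] by auto
    show ?thesis
    proof (rule bypass_cases[OF s])
      assume "\<rho> (\<sigma> w) \<notin> K" "\<rho>' (\<sigma> w) = \<rho> (\<sigma> w)"
      then show ?thesis using a by simp
    next
      assume "\<rho> (\<sigma> w) = x" "\<rho>' (\<sigma> w) = \<rho> (\<rho> x)"
      then show ?thesis using a by simp
    next
      assume "\<rho> (\<sigma> w) = n x" "\<rho>' (\<sigma> w) = n (\<rho> (\<rho> x))"
      then show ?thesis using a n_rho by simp
    qed
  qed
  have "(v \<notin> K \<and> v \<in> ?o) \<or> ((v = x \<or> v = n x) \<and> \<rho> (\<rho> v) \<in> ?o)"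
    using v(1)
  proof induction
    case base
    show ?case by (rule next_in[OF u orbit.base])
  next
    case (step w)
    from step.IH show ?case
    proof (elim disjE)
      assume "w \<notin> K \<and> w \<in> ?o"
      then show ?case using next_in[of w] o_in[of w] orbit.step[of w] by blast
    next
      assume w: "(w = x \<or> w = n x) \<and> \<rho> (\<rho> w) \<in> ?o"
      have "(\<rho> \<circ> \<sigma>) w = \<rho> (\<rho> w)" using w sigma_K_eqs[OF \<sigma>] n_rho by auto
      then show ?case using w o_in[of "\<rho> (\<rho> w)"] by (simp only: simp_thms)
    qed
  qed
  then show ?thesis using v(2) K_mem by auto
qed

text \<open>Deleting arcs changes neither the crossing chords nor, by the preceding lemma, which of their ends lie on the same orbit. Without arcs
the orbit of \<open>u\<close> consists of \<open>u\<close> and one point of the other circle.\<close>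

lemma orbit_exits_once:
  assumes "two_circles n \<chi> \<rho> C1 C2" "\<sigma> \<in> planar_pairings n \<chi> \<rho> C1 C2 c" "u \<in> C1" "\<sigma> u \<notin> C1"
  shows "(\<forall>v \<in> orbit (\<rho> \<circ> \<sigma>) u. v \<in> C1 \<longrightarrow> \<sigma> v \<notin> C1 \<longrightarrow> v = u) \<and> n u \<notin> orbit (\<rho> \<circ> \<sigma>) u"
  using assms
proof (induction "card (C1 \<union> C2)" arbitrary: \<rho> C1 C2 \<sigma> rule: less_induct)
  case less
  note circles = less.prems(1)
  let ?D = "C1 \<union> C2"
  have p: "\<sigma> \<in> pairings n \<chi> ?D" using less.prems(2) by (simp add: planar_pairings_def)
  have uD: "u \<in> ?D" using less.prems(3) by blast
  show ?case
  proof (cases "\<exists>x\<in>?D. \<sigma> x = \<rho> x")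
    case True
    then obtain x where x: "x \<in> ?D" "\<sigma> x = \<rho> x" by blast
    interpret arc_removal n \<chi> \<rho> C1 C2 x by unfold_locales (fact circles x(1))+
    have notK: "v \<notin> K" if v: "v \<in> C1" "\<sigma> v \<notin> C1" for v
    proof
      assume k: "v \<in> K"
      have "v \<in> D" using v(1) by blast
      then have "\<sigma> v \<in> K" using sigma_K[OF p x(2)] k by simp
      then show False using K_color[OF k] K_color[of "\<sigma> v"] v by blast
    qed
    have r: "remove_arc K \<sigma> v = \<sigma> v" "\<sigma> v \<notin> K" if "v \<in> C1" "\<sigma> v \<notin> C1" for v
      using notK[OF that] sigma_K[OF p x(2), of v] that by (auto simp: remove_arc_def)
    have "card ((C1 - K) \<union> (C2 - K)) < card D" using card_D by (simp add: Un_Diff)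
    moreover have "remove_arc K \<sigma> \<in> planar_pairings n \<chi> \<rho>' (C1 - K) (C2 - K) c"
      using planar_remove_iff[OF p x(2)] less.prems(2) by simp
    moreover have "u \<in> C1 - K" "remove_arc K \<sigma> u \<notin> C1 - K"
      using less.prems(3,4) notK r by auto
    ultimately have IH: "(\<forall>v \<in> orbit (\<rho>' \<circ> remove_arc K \<sigma>) u. v \<in> C1 - K \<longrightarrow> remove_arc K \<sigma> v \<notin> C1 - K \<longrightarrow> v = u)
        \<and> n u \<notin> orbit (\<rho>' \<circ> remove_arc K \<sigma>) u"
      using less.hyps[OF _ two_circles_bypass[OF circles x_in]] by blast
    have uK: "u \<notin> K" using notK less.prems(3,4) by blast
    \<comment> \<open>Ends of crossing chords lie outside \<open>K\<close>, so the orbit relation between them passes to the smaller circles.\<close>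
    note transfer = orbit_remove_arc[OF p x(2) uD uK]
    show ?thesis
    proof (intro conjI ballI impI)
      fix v assume v: "v \<in> orbit (\<rho> \<circ> \<sigma>) u" "v \<in> C1" "\<sigma> v \<notin> C1"
      then show "v = u" using IH transfer[OF v(1) notK[OF v(2,3)]] notK[OF v(2,3)] r[OF v(2,3)] by auto
    next
      have "n u \<notin> K" using facts(4)[OF uD] uK by simp
      then show "n u \<notin> orbit (\<rho> \<circ> \<sigma>) u" using transfer IH by blast
    qed
  next
    case False
    then have al: "\<And>y. y \<in> ?D \<Longrightarrow> \<sigma> y \<noteq> \<rho> y" by blast
    let ?w = "\<rho> (\<sigma> u)"
    have su: "\<sigma> u \<in> ?D" using pairingsD(2)[OF p uD] .
    have "\<rho> (\<sigma> ?w) = \<sigma> (\<sigma> u)"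
      using arcless_maximal(1)[OF circles less.prems(2) al su] .
    then have returns: "\<rho> (\<sigma> ?w) = u" using pairingsD(3)[OF p uD] by simp
    have "v = ?w \<or> v = u" if "v \<in> orbit (\<rho> \<circ> \<sigma>) u" for v
      using that by induction (auto simp: returns)
    moreover have "?w \<notin> C1" using two_circlesD(6)[OF circles su] less.prems(4) by simp
    moreover have "n u \<in> C1" "n u \<noteq> u" using two_circlesD(1,3)[OF circles uD] less.prems(3) by auto
    ultimately show ?thesis by metis
  qed
qed

section \<open>The permutation \<open>\<gamma>\<close>\<close>

lemma signed_cycle_step:
  assumes ab: "1 \<le> a" "a \<le> b"
  shows "signed_cycle a b permutes {x. a \<le> \<bar>x\<bar> \<and> \<bar>x\<bar> \<le> b}"
    and "a \<le> x \<Longrightarrow> x < b \<Longrightarrow> signed_cycle a b x = x + 1"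
    and "signed_cycle a b b = - a"
    and "a \<le> x \<Longrightarrow> x < b \<Longrightarrow> signed_cycle a b (- x) = - (x + 1)"
    and "signed_cycle a b (- b) = a"
proof -
  define L where "L = nat (b - a + 1)"
  define cs where "cs = [a..b] @ map uminus [a..b]"
  have L: "0 < L" using ab by (simp add: L_def)
  have len: "length [a..b] = L" "length cs = 2 * L" using ab by (simp_all add: cs_def L_def)
  have nth1: "cs ! k = a + int k" if "k < L" for k
    using that ab len by (simp add: cs_def nth_append L_def nth_upto)
  have nth2: "cs ! (L + k) = - (a + int k)" if "k < L" for k
    using that ab len by (simp add: cs_def nth_append L_def nth_upto)
  have d: "distinct cs" using ab by (auto simp: cs_def distinct_map inj_on_def)
  have set: "set cs = {x. a \<le> \<bar>x\<bar> \<and> \<bar>x\<bar> \<le> b}"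
  proof
    show "set cs \<subseteq> {x. a \<le> \<bar>x\<bar> \<and> \<bar>x\<bar> \<le> b}" using ab by (auto simp: cs_def)
    show "{x. a \<le> \<bar>x\<bar> \<and> \<bar>x\<bar> \<le> b} \<subseteq> set cs"
    proof
      fix x assume x: "x \<in> {x. a \<le> \<bar>x\<bar> \<and> \<bar>x\<bar> \<le> b}"
      show "x \<in> set cs"
      proof (cases "0 \<le> x")
        case True then show ?thesis using x by (simp add: cs_def)
      next
        case False
        then have "- x \<in> {a..b}" using x by simp
        then show ?thesis by (auto simp: cs_def intro!: image_eqI[of _ _ "- x"])
      qed
    qed
  qed
  show "signed_cycle a b permutes {x. a \<le> \<bar>x\<bar> \<and> \<bar>x\<bar> \<le> b}"
    using cycle_permutes[of cs] unfolding set by (simp add: signed_cycle_def cs_def)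
  have rot: "signed_cycle a b (cs ! k) = cs ! (Suc k mod (2 * L))" if "k < 2 * L" for k
  proof -
    have "map (cycle_of_list cs) cs = rotate1 cs" by (rule cyclic_rotation[OF d, of 1, simplified])
    then have "map (cycle_of_list cs) cs ! k = rotate1 cs ! k" by simp
    then show ?thesis using that len by (simp add: nth_rotate1 signed_cycle_def cs_def[symmetric])
  qed
  have xk: "\<exists>k. k < L \<and> x = a + int k \<and> (x < b \<longrightarrow> Suc k < L)" if "a \<le> x" "x \<le> b" for x
    using that ab by (intro exI[of _ "nat (x - a)"]) (auto simp: L_def)
  show "signed_cycle a b x = x + 1" if x: "a \<le> x" "x < b"
  proof -
    obtain k where k: "k < L" "x = a + int k" "Suc k < L" using xk[of x] x by auto
    show ?thesis using rot[of k] k nth1[of k] nth1[of "Suc k"] by simp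
  qed
  show "signed_cycle a b (- x) = - (x + 1)" if x: "a \<le> x" "x < b"
  proof -
    obtain k where k: "k < L" "x = a + int k" "Suc k < L" using xk[of x] x by auto
    show ?thesis using rot[of "L + k"] k nth2[of k] nth2[of "Suc k"] by simp
  qed
  show "signed_cycle a b b = - a"
    using rot[of "L - 1"] nth1[of "L - 1"] nth2[of 0] L ab by (simp add: L_def)
  show "signed_cycle a b (- b) = a"
  proof -
    have "Suc (L + (L - 1)) = 2 * L" using L by simp
    then have "Suc (L + (L - 1)) mod (2 * L) = 0" by (simp only: mod_self)
    moreover have "cs ! (L + (L - 1)) = - b" using nth2[of "L - 1"] L ab by (simp add: L_def)
    ultimately show ?thesis using rot[of "L + (L - 1)"] nth1[of 0] L by simp
  qed
qed

lemma signed_cycle_minus: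
  assumes ab: "1 \<le> a" "a \<le> b"
  shows "signed_cycle a b (- x) = - signed_cycle a b x"
proof -
  note s = signed_cycle_step[OF ab]
  consider "a \<le> x" "x < b" | "x = b" | "a \<le> - x" "- x < b" | "x = - b" | "\<not> (a \<le> \<bar>x\<bar> \<and> \<bar>x\<bar> \<le> b)"
    by linarith
  then show ?thesis
  proof cases
    case 1 then show ?thesis using s(2,4) by simp
  next
    case 2 then show ?thesis using s(3,5) by simp
  next
    case 3 then show ?thesis using s(2,4)[of "- x"] by simp
  next
    case 4 then show ?thesis using s(3,5) by simp
  next
    case 5
    then have "x \<notin> {x. a \<le> \<bar>x\<bar> \<and> \<bar>x\<bar> \<le> b}" "- x \<notin> {x. a \<le> \<bar>x\<bar> \<and> \<bar>x\<bar> \<le> b}" by simp_all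
    then show ?thesis using permutes_not_in[OF s(1)] by metis
  qed
qed

lemma signed_cycle_induct:
  assumes ab: "1 \<le> a" "a \<le> b"
    and closed: "\<And>x. a \<le> \<bar>x\<bar> \<Longrightarrow> \<bar>x\<bar> \<le> b \<Longrightarrow> P x \<Longrightarrow> P (signed_cycle a b x)"
    and x: "a \<le> \<bar>x\<bar>" "\<bar>x\<bar> \<le> b" "P x" and y: "a \<le> \<bar>y\<bar>" "\<bar>y\<bar> \<le> b"
  shows "P y"
proof -
  note s = signed_cycle_step[OF ab]
  \<comment> \<open>The sign \<open>t\<close> selects the positive or the negative half of the cycle; \<open>turn\<close> passes from one half to the other.\<close>
  have up: "P (t * j)" if t: "t = 1 \<or> t = - 1" and i: "a \<le> i" "P (t * i)" and ij: "i \<le> j" "j \<le> b" for t i j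
    using ij
  proof (induction j rule: int_ge_induct)
    case base then show ?case using i by simp
  next
    case (step j)
    have "P (signed_cycle a b (t * j))" using step t i(1) ab(1) closed[of "t * j"] by auto
    moreover have "signed_cycle a b (t * j) = t * (j + 1)" using t s(2,4)[of j] step i(1) by auto
    ultimately show ?case by simp
  qed
  have turn: "P (- t * a)" if t: "t = 1 \<or> t = - 1" and i: "a \<le> i" "i \<le> b" "P (t * i)" for t i
  proof -
    have "P (t * b)" using up[OF t i(1,3,2)] by simp
    then have "P (signed_cycle a b (t * b))" using t ab closed[of "t * b"] by auto
    then show ?thesis using t s(3,5) by auto
  qed
  define t :: int where "t = (if 0 < x then 1 else - 1)"
  have t: "t = 1 \<or> t = - 1" "- t = 1 \<or> - t = - 1" by (auto simp: t_def)
  have "P (t * \<bar>x\<bar>)" using x(3) x(1) ab by (auto simp: t_def)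
  then have m: "P (- t * a)" using turn[OF t(1) x(1,2)] by simp
  then have pl: "P (t * a)" using turn[OF t(2) order_refl ab(2)] by simp
  have "P (t * \<bar>y\<bar>)" "P (- t * \<bar>y\<bar>)" using up[OF t(1) order_refl pl y] up[OF t(2) order_refl m y] .
  moreover have "y = t * \<bar>y\<bar> \<or> y = - t * \<bar>y\<bar>" by (auto simp: t_def)
  ultimately show ?thesis by metis
qed


lemma gamma_B_eq:
  assumes "p \<ge> 1" "q \<ge> 1"
  shows "x \<in> signed_set p \<Longrightarrow> gamma_B p q x = signed_cycle 1 (int p) x"
    and "x \<in> signed_set (p + q) - signed_set p \<Longrightarrow> gamma_B p q x = signed_cycle (int p + 1) (int p + int q) x"
    and "signed_set p = {x. 1 \<le> \<bar>x\<bar> \<and> \<bar>x\<bar> \<le> int p}"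
    and "signed_set (p + q) - signed_set p = {x. int p + 1 \<le> \<bar>x\<bar> \<and> \<bar>x\<bar> \<le> int p + int q}"
    and "gamma_B p q permutes signed_set (p + q)"
proof -
  let ?s1 = "signed_cycle 1 (int p)" and ?s2 = "signed_cycle (int p + 1) (int p + int q)"
  have ab: "1 \<le> (1::int)" "1 \<le> int p" "1 \<le> int p + 1" "int p + 1 \<le> int p + int q" using assms by simp_all
  note P1 = signed_cycle_step(1)[OF ab(1,2)] and P2 = signed_cycle_step(1)[OF ab(3,4)]
  show S1: "signed_set p = {x. 1 \<le> \<bar>x\<bar> \<and> \<bar>x\<bar> \<le> int p}" by (simp add: signed_set_def)
  show S2: "signed_set (p + q) - signed_set p = {x. int p + 1 \<le> \<bar>x\<bar> \<and> \<bar>x\<bar> \<le> int p + int q}"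
    by (auto simp: signed_set_def)
  note p1 = P1[folded S1] and p2 = P2[folded S2]
  have sub: "signed_set p \<subseteq> signed_set (p + q)" by (auto simp: signed_set_def)
  show "gamma_B p q x = ?s1 x" if "x \<in> signed_set p"
  proof -
    have "?s2 x = x" by (rule permutes_not_in[OF p2]) (use that in blast)
    then show ?thesis by (simp add: gamma_B_def)
  qed
  show "gamma_B p q x = ?s2 x" if "x \<in> signed_set (p + q) - signed_set p"
  proof -
    have "?s2 x \<in> signed_set (p + q) - signed_set p" using permutes_in_image[OF p2] that by blast
    then have "?s1 (?s2 x) = ?s2 x" by (intro permutes_not_in[OF p1]) blast
    then show ?thesis by (simp add: gamma_B_def)
  qed
  show "gamma_B p q permutes signed_set (p + q)"
    unfolding gamma_B_def
    by (rule permutes_compose[OF permutes_subset[OF p2] permutes_subset[OF p1 sub]]) blast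
qed

lemma gamma_B_in:
  assumes "p \<ge> 1" "q \<ge> 1"
  shows "x \<in> signed_set p \<Longrightarrow> gamma_B p q x \<in> signed_set p"
    and "x \<in> signed_set (p + q) - signed_set p \<Longrightarrow> gamma_B p q x \<in> signed_set (p + q) - signed_set p"
proof -
  have ab: "1 \<le> (1::int)" "1 \<le> int p" "1 \<le> int p + 1" "int p + 1 \<le> int p + int q" using assms by simp_all
  note g = gamma_B_eq[OF assms]
  note p1 = signed_cycle_step(1)[OF ab(1,2), folded g(3)] and p2 = signed_cycle_step(1)[OF ab(3,4), folded g(4)]
  show "x \<in> signed_set p \<Longrightarrow> gamma_B p q x \<in> signed_set p"
    using g(1)[of x] permutes_in_image[OF p1, of x] by simp
  show "x \<in> signed_set (p + q) - signed_set p \<Longrightarrow> gamma_B p q x \<in> signed_set (p + q) - signed_set p"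
    using g(2)[of x] permutes_in_image[OF p2, of x] by simp
qed

lemma gamma_B_minus:
  assumes "p \<ge> 1" "q \<ge> 1"
  shows "gamma_B p q (- x) = - gamma_B p q x"
  using assms by (simp add: gamma_B_def signed_cycle_minus)

lemma gamma_B_hyperoctahedral:
  assumes "p \<ge> 1" "q \<ge> 1" shows "gamma_B p q \<in> hyperoctahedral (p + q)"
  by (intro hyperoctahedralI gamma_B_eq(5) gamma_B_minus assms)

lemma gamma_B_transitive:
  assumes pq: "p \<ge> 1" "q \<ge> 1"
    and T: "T = signed_set p \<or> T = signed_set (p + q) - signed_set p"
    and A: "A \<subseteq> T" "x \<in> A" "\<And>y. y \<in> A \<Longrightarrow> gamma_B p q y \<in> A"
  shows "A = T"
proof -
  note g = gamma_B_eq[OF pq]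
  obtain a b :: int where ab: "1 \<le> a" "a \<le> b" and Tab: "T = {x. a \<le> \<bar>x\<bar> \<and> \<bar>x\<bar> \<le> b}"
    and step: "\<And>y. y \<in> T \<Longrightarrow> gamma_B p q y = signed_cycle a b y"
    using T
  proof
    assume "T = signed_set p"
    then show thesis using that[of 1 "int p"] pq g(1,3) by simp
  next
    assume "T = signed_set (p + q) - signed_set p"
    then show thesis using that[of "int p + 1" "int p + int q"] pq g(2,4) by simp
  qed
  have "y \<in> A" if y: "y \<in> T" for y
  proof (rule signed_cycle_induct[OF ab, of "\<lambda>y. y \<in> A" x y])
    fix z assume "a \<le> \<bar>z\<bar>" "\<bar>z\<bar> \<le> b" "z \<in> A"
    then show "signed_cycle a b z \<in> A" using A(3)[of z] step[of z] A(1) by auto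
  qed (use A(1,2) y Tab in auto)
  then show ?thesis using A(1) by blast
qed

lemma Fix_B_gamma_B:
  assumes pq: "p \<ge> 1" "q \<ge> 1"
  shows "Fix_B (p + q) (gamma_B p q) = {\<lambda>_. 0}"
proof -
  have "f x = 0" if f: "f \<in> Fix_B (p + q) (gamma_B p q)" for f x
  proof -
    have z: "f x = 0" if x: "x \<in> T" and T: "T = signed_set p \<or> T = signed_set (p + q) - signed_set p" for T
    proof -
      have "{y \<in> T. f y = f x} = T"
        by (rule gamma_B_transitive[OF pq T, of _ x])
          (use x T gamma_B_in[OF pq] Fix_B_fixed[OF f gamma_B_eq(5)[OF pq]] in auto)
      moreover have "- x \<in> T" using x T by (auto simp: minus_in_signed_set)
      ultimately have "f (- x) = f x" by blast
      then show ?thesis using Fix_B_minus[OF f, of x] by (intro z3_double) simp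
    qed
    show ?thesis
    proof (cases "x \<in> signed_set (p + q)")
      case True
      then show ?thesis using z[of "signed_set p"] z[of "signed_set (p + q) - signed_set p"] by blast
    next
      case False
      then show ?thesis using f by (simp add: fixed_functions_def odd_functions_def)
    qed
  qed
  then show ?thesis using zero_in_fixed_functions by (auto simp: fun_eq_iff)
qed

section \<open>Doubling the points\<close>

definition double_minus :: "int \<times> bool \<Rightarrow> int \<times> bool" where
  "double_minus z = (- fst z, snd z)"

definition double_cycle :: "(int \<Rightarrow> int) \<Rightarrow> int \<times> bool \<Rightarrow> int \<times> bool" where
  "double_cycle \<gamma> z = (if snd z then (\<gamma> (fst z), False) else (fst z, True))"

text \<open>The second case is forced by the first, since a pairing is an involution.\<close>

definition double_pairing :: "nat \<Rightarrow> (int \<Rightarrow> int) \<Rightarrow> int \<times> bool \<Rightarrow> int \<times> bool" where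
  "double_pairing N \<tau> z = (if fst z \<in> signed_set N
     then if snd z then (\<tau> (fst z), False) else (inv \<tau> (fst z), True) else z)"

lemma circle_double:
  assumes fin: "finite T" and T: "\<And>x. x \<in> T \<Longrightarrow> - x \<in> T \<and> x \<noteq> 0 \<and> g x \<in> T \<and> g (- x) = - g x"
    and inj: "inj_on g T"
    and tr: "\<And>A x. A \<subseteq> T \<Longrightarrow> x \<in> A \<Longrightarrow> (\<And>y. y \<in> A \<Longrightarrow> g y \<in> A) \<Longrightarrow> A = T"
  shows "circle double_minus snd (double_cycle g) (T \<times> UNIV)"
  unfolding circle_def
proof (intro conjI ballI allI impI)
  show "finite (T \<times> (UNIV :: bool set))" using fin by simp
  fix z :: "int \<times> bool" assume z: "z \<in> T \<times> UNIV"
  then have x: "fst z \<in> T" by auto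
  note Tx = T[OF x]
  show "double_minus z \<in> T \<times> UNIV" using Tx by (simp add: double_minus_def)
  have "- fst z \<noteq> fst z" using Tx by simp
  then show "double_minus z \<noteq> z" by (metis double_minus_def fst_conv)
  show "double_minus (double_minus z) = z" by (simp add: double_minus_def)
  show "snd (double_minus z) = snd z" by (simp add: double_minus_def)
  show "double_cycle g z \<in> T \<times> UNIV" using Tx x by (simp add: double_cycle_def)
  show "double_cycle g (double_minus z) = double_minus (double_cycle g z)"
    using Tx by (simp add: double_cycle_def double_minus_def)
  show "snd (double_cycle g z) \<noteq> snd z" by (simp add: double_cycle_def)
next
  show "inj_on (double_cycle g) (T \<times> UNIV)"
    using inj by (auto simp: inj_on_def double_cycle_def split: if_splits)
  fix A :: "(int \<times> bool) set" assume A: "A \<subseteq> T \<times> UNIV" "A \<noteq> {}" "double_cycle g ` A \<subseteq> A"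
  have up: "(x, True) \<in> A" if "(x, False) \<in> A" for x
    using A(3) that by (force simp: double_cycle_def)
  have down: "(g x, False) \<in> A" if "(x, True) \<in> A" for x
    using A(3) that by (force simp: double_cycle_def)
  obtain x b where "(x, b) \<in> A" using A(2) by auto
  then have ex: "\<exists>x. (x, False) \<in> A" using down by (cases b) auto
  then obtain x where x: "(x, False) \<in> A" by blast
  have "{x. (x, False) \<in> A} = T"
    by (rule tr[of _ x]) (use A(1) x up down in auto)
  then have "(y, b) \<in> A" if "y \<in> T" for y b using that up by (cases b) auto
  then show "A = T \<times> UNIV" using A(1) by auto
qed

lemma two_circles_double:
  assumes pq: "p \<ge> 1" "q \<ge> 1"
  shows "two_circles double_minus snd (double_cycle (gamma_B p q))
    (signed_set p \<times> UNIV) ((signed_set (p + q) - signed_set p) \<times> UNIV)"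
proof -
  have inj: "inj_on (gamma_B p q) A" for A
    using permutes_inj[OF gamma_B_eq(5)[OF pq]] by (rule inj_on_subset) simp
  have "circle double_minus snd (double_cycle (gamma_B p q)) (T \<times> UNIV)"
    if T: "T = signed_set p \<or> T = signed_set (p + q) - signed_set p" for T
  proof (rule circle_double[OF _ _ inj])
    show "finite T" using T finite_signed_set by auto
    show "- x \<in> T \<and> x \<noteq> 0 \<and> gamma_B p q x \<in> T \<and> gamma_B p q (- x) = - gamma_B p q x" if "x \<in> T" for x
    proof -
      have "x \<noteq> 0" using that T by (auto simp: signed_set_def)
      moreover have "- x \<in> T" using that T by (auto simp: minus_in_signed_set)
      moreover have "gamma_B p q x \<in> T" using that T gamma_B_in[OF pq] by blast
      ultimately show ?thesis using gamma_B_minus[OF pq] by blast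
    qed
    show "A = T" if "A \<subseteq> T" "x \<in> A" "\<And>y. y \<in> A \<Longrightarrow> gamma_B p q y \<in> A" for A x
      using gamma_B_transitive[OF pq T that(1,2)] that(3) by blast
  qed
  then show ?thesis unfolding two_circles_def by blast
qed

lemma double_pairing_in:
  assumes "\<tau> \<in> hyperoctahedral N"
  shows "double_pairing N \<tau> \<in> pairings double_minus snd (signed_set N \<times> UNIV)"
proof (rule pairingsI)
  have p: "\<tau> permutes signed_set N" using assms by (rule hyperoctahedral_permutes)
  note pi = permutes_inv[OF p]
  note odd = hyperoctahedral_minus[OF assms] hyperoctahedral_minus[OF hyperoctahedral_inv[OF assms]]
  fix z :: "int \<times> bool" assume "z \<in> signed_set N \<times> UNIV"
  then have z: "fst z \<in> signed_set N" by auto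
  then have i: "\<tau> (fst z) \<in> signed_set N" "inv \<tau> (fst z) \<in> signed_set N" "- fst z \<in> signed_set N"
    using permutes_in_image[OF p] permutes_in_image[OF pi] by (simp_all add: minus_in_signed_set)
  show "double_pairing N \<tau> z \<in> signed_set N \<times> UNIV" using z i by (simp add: double_pairing_def)
  show "double_pairing N \<tau> (double_pairing N \<tau> z) = z"
    using z i permutes_inverses[OF p] by (cases z) (simp add: double_pairing_def)
  show "double_pairing N \<tau> (double_minus z) = double_minus (double_pairing N \<tau> z)"
    using z i odd by (simp add: double_pairing_def double_minus_def)
  show "snd (double_pairing N \<tau> z) \<noteq> snd z" using z by (simp add: double_pairing_def)
next
  fix z :: "int \<times> bool" assume "z \<notin> signed_set N \<times> UNIV"
  then have "fst z \<notin> signed_set N" by (cases z) auto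
  then show "double_pairing N \<tau> z = z" by (simp add: double_pairing_def)
qed

lemma bij_betw_double_pairing:
  "bij_betw (double_pairing N) (hyperoctahedral N) (pairings double_minus snd (signed_set N \<times> UNIV))"
proof (rule bij_betw_byWitness[where f' = "\<lambda>\<sigma> i. if i \<in> signed_set N then fst (\<sigma> (i, True)) else i"])
  let ?S = "signed_set N" and ?u = "\<lambda>\<sigma> i. if i \<in> signed_set N then fst (\<sigma> (i, True)) else i"
  show "\<forall>\<tau>\<in>hyperoctahedral N. ?u (double_pairing N \<tau>) = \<tau>"
  proof (intro ballI ext)
    fix \<tau> i assume t: "\<tau> \<in> hyperoctahedral N"
    show "?u (double_pairing N \<tau>) i = \<tau> i"
      using permutes_not_in[OF hyperoctahedral_permutes[OF t], of i] by (simp add: double_pairing_def)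
  qed
  show "double_pairing N ` hyperoctahedral N \<subseteq> pairings double_minus snd (?S \<times> UNIV)"
    using double_pairing_in by blast
  have u: "?u \<sigma> \<in> hyperoctahedral N \<and> double_pairing N (?u \<sigma>) = \<sigma>"
    if s: "\<sigma> \<in> pairings double_minus snd (?S \<times> UNIV)" for \<sigma>
  proof -
    define t where "t = ?u \<sigma>"
    define v where "v i = fst (\<sigma> (i, False))" for i
    have T: "\<sigma> (i, True) = (t i, False)" "t i \<in> ?S" if "i \<in> ?S" for i
      using pairingsD(2,5)[OF s, of "(i, True)"] that by (auto simp: t_def prod_eq_iff)
    have F: "\<sigma> (i, False) = (v i, True)" "v i \<in> ?S" if "i \<in> ?S" for i
      using pairingsD(2,5)[OF s, of "(i, False)"] that by (auto simp: v_def prod_eq_iff)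
    have vt: "v (t i) = i" if "i \<in> ?S" for i
      using pairingsD(3)[OF s, of "(i, True)"] T[OF that] F[of "t i"] that by simp
    have tv: "t (v i) = i" if "i \<in> ?S" for i
      using pairingsD(3)[OF s, of "(i, False)"] F[OF that] T[of "v i"] that by simp
    have "bij_betw t ?S ?S"
      by (rule bij_betw_byWitness[where f' = v]) (use vt tv T F in auto)
    then have per: "t permutes ?S" by (rule bij_imp_permutes) (simp add: t_def)
    have "t (- i) = - t i" for i
    proof (cases "i \<in> ?S")
      case True
      then show ?thesis
        using pairingsD(4)[OF s, of "(i, True)"] T[OF True] T[of "- i"]
        by (simp add: double_minus_def minus_in_signed_set)
    next
      case False
      then show ?thesis by (simp add: t_def minus_in_signed_set)
    qed
    with per have h: "t \<in> hyperoctahedral N" by (rule hyperoctahedralI)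
    have "double_pairing N t = \<sigma>"
    proof
      fix z :: "int \<times> bool"
      obtain i b where z: "z = (i, b)" by (cases z)
      show "double_pairing N t z = \<sigma> z"
      proof (cases "i \<in> ?S")
        case True
        have "inv t i = v i" using permutes_inverses(2)[OF per, of "v i"] tv[OF True] by simp
        then show ?thesis using True T F by (cases b) (simp_all add: z double_pairing_def)
      next
        case False
        then show ?thesis using pairingsD(6)[OF s, of z] by (simp add: z double_pairing_def)
      qed
    qed
    then show ?thesis using h by (simp only: t_def simp_thms)
  qed
  show "\<forall>\<sigma>\<in>pairings double_minus snd (?S \<times> UNIV). double_pairing N (?u \<sigma>) = \<sigma>" using u by blast
  show "?u ` pairings double_minus snd (?S \<times> UNIV) \<subseteq> hyperoctahedral N" using u by blast
qed

text \<open>On the points \<open>(i, False)\<close> the map \<open>\<sigma> \<circ> \<rho>\<close> is \<open>\<tau>\<close>, on the points \<open>(i, True)\<close> it is \<open>\<tau>\<^sup>-\<^sup>1 \<gamma>\<close>.\<close>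

lemma card_fixed_functions_double:
  assumes \<tau>: "\<tau> \<in> hyperoctahedral N" and \<gamma>: "\<gamma> permutes signed_set N"
  shows "card (fixed_functions double_minus (signed_set N \<times> UNIV) (double_pairing N \<tau> \<circ> double_cycle \<gamma>))
    = card (Fix_B N \<tau>) * card (Fix_B N (inv \<tau> \<circ> \<gamma>))"
proof -
  let ?S = "signed_set N"
  let ?F = "fixed_functions double_minus (?S \<times> UNIV) (double_pairing N \<tau> \<circ> double_cycle \<gamma>)"
  define \<Phi> :: "(int \<times> bool \<Rightarrow> 3) \<Rightarrow> (int \<Rightarrow> 3) \<times> (int \<Rightarrow> 3)"
    where "\<Phi> f = (\<lambda>i. f (i, False), \<lambda>i. f (i, True))" for f
  define \<Psi> :: "(int \<Rightarrow> 3) \<times> (int \<Rightarrow> 3) \<Rightarrow> int \<times> bool \<Rightarrow> 3"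
    where "\<Psi> p z = (if snd z then snd p (fst z) else fst p (fst z))" for p z
  have s: "(double_pairing N \<tau> \<circ> double_cycle \<gamma>) (i, False) = (\<tau> i, False)"
    "(double_pairing N \<tau> \<circ> double_cycle \<gamma>) (i, True) = (inv \<tau> (\<gamma> i), True)" if "i \<in> ?S" for i
    using that permutes_in_image[OF \<gamma>] by (simp_all add: double_pairing_def double_cycle_def)
  have iff: "f \<in> ?F \<longleftrightarrow> (\<lambda>i. f (i, False)) \<in> Fix_B N \<tau> \<and> (\<lambda>i. f (i, True)) \<in> Fix_B N (inv \<tau> \<circ> \<gamma>)" for f
  proof -
    have "f \<in> ?F \<longleftrightarrow> (\<forall>i\<in>?S. \<forall>b. f (- i, b) = - f (i, b)) \<and> (\<forall>i b. i \<notin> ?S \<longrightarrow> f (i, b) = 0)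
        \<and> (\<forall>i\<in>?S. \<forall>b. f ((double_pairing N \<tau> \<circ> double_cycle \<gamma>) (i, b)) = f (i, b))"
      by (simp add: fixed_functions_def odd_functions_def double_minus_def)
    also have "\<dots> \<longleftrightarrow> (\<lambda>i. f (i, False)) \<in> Fix_B N \<tau> \<and> (\<lambda>i. f (i, True)) \<in> Fix_B N (inv \<tau> \<circ> \<gamma>)"
      using s by (simp only: all_bool_eq) (auto simp: fixed_functions_def odd_functions_def)
    finally show ?thesis .
  qed
  have "bij_betw \<Phi> ?F (Fix_B N \<tau> \<times> Fix_B N (inv \<tau> \<circ> \<gamma>))"
  proof (rule bij_betw_byWitness[where f' = \<Psi>])
    show "\<forall>f\<in>?F. \<Psi> (\<Phi> f) = f" by (simp add: \<Phi>_def \<Psi>_def fun_eq_iff)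
    show "\<forall>p\<in>Fix_B N \<tau> \<times> Fix_B N (inv \<tau> \<circ> \<gamma>). \<Phi> (\<Psi> p) = p" by (simp add: \<Phi>_def \<Psi>_def)
    show "\<Phi> ` ?F \<subseteq> Fix_B N \<tau> \<times> Fix_B N (inv \<tau> \<circ> \<gamma>)"
    proof (rule image_subsetI)
      fix f assume "f \<in> ?F"
      then show "\<Phi> f \<in> Fix_B N \<tau> \<times> Fix_B N (inv \<tau> \<circ> \<gamma>)" unfolding iff \<Phi>_def by (elim conjE) (rule SigmaI)
    qed
    show "\<Psi> ` (Fix_B N \<tau> \<times> Fix_B N (inv \<tau> \<circ> \<gamma>)) \<subseteq> ?F"
    proof (rule image_subsetI)
      fix p assume p: "p \<in> Fix_B N \<tau> \<times> Fix_B N (inv \<tau> \<circ> \<gamma>)"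
      have "(\<lambda>i. \<Psi> p (i, False)) = fst p" "(\<lambda>i. \<Psi> p (i, True)) = snd p" by (simp_all add: \<Psi>_def)
      then show "\<Psi> p \<in> ?F" unfolding iff using p by (simp only: mem_Times_iff)
    qed
  qed
  then have "card ?F = card (Fix_B N \<tau> \<times> Fix_B N (inv \<tau> \<circ> \<gamma>))" by (rule bij_betw_same_card)
  then show ?thesis by (simp add: card_cartesian_product)
qed

definition exits :: "nat \<Rightarrow> (int \<Rightarrow> int) \<Rightarrow> int set" where
  "exits p \<tau> = {i \<in> signed_set p. \<tau> i \<notin> signed_set p}"

text \<open>A permutation leaves a set as often as it enters it, and each such step of \<open>\<tau>\<close> is a chord with two ends.\<close>

lemma card_crossings:
  assumes \<tau>: "\<tau> permutes signed_set (p + q)"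
  shows "card {y \<in> signed_set (p + q) \<times> UNIV. (y \<in> signed_set p \<times> UNIV) \<noteq> (double_pairing (p + q) \<tau> y \<in> signed_set p \<times> UNIV)}
    = 4 * card (exits p \<tau>)"
proof -
  let ?S = "signed_set (p + q)" and ?T = "signed_set p"
  have TS: "?T \<subseteq> ?S" by (auto simp: signed_set_def)
  have fin: "finite ?S" "finite ?T" by (rule finite_signed_set)+
  define M where "M = {i \<in> ?S. (i \<in> ?T) \<noteq> (\<tau> i \<in> ?T)}"
  define E where "E = {i \<in> ?S - ?T. \<tau> i \<in> ?T}"
  have inj: "inj_on \<tau> A" for A using permutes_inj[OF \<tau>] by (rule inj_on_subset) simp
  have finE: "finite (exits p \<tau>)" "finite E" using fin by (simp_all add: exits_def E_def)
  have "card {i \<in> ?T. \<tau> i \<in> ?T} + card (exits p \<tau>) = card ?T"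
    using fin finE by (subst card_Un_disjoint[symmetric]) (auto simp: exits_def intro: arg_cong[where f = card])
  moreover have "card {i \<in> ?T. \<tau> i \<in> ?T} + card E = card ?T"
  proof -
    have "\<tau> ` {i \<in> ?S. \<tau> i \<in> ?T} = ?T"
    proof
      show "?T \<subseteq> \<tau> ` {i \<in> ?S. \<tau> i \<in> ?T}"
      proof
        fix j assume j: "j \<in> ?T"
        then have "inv \<tau> j \<in> ?S" using TS permutes_in_image[OF permutes_inv[OF \<tau>]] by blast
        then show "j \<in> \<tau> ` {i \<in> ?S. \<tau> i \<in> ?T}"
          using j permutes_inverses(1)[OF \<tau>, of j] by (intro image_eqI[of _ _ "inv \<tau> j"]) simp_all
      qed
    qed auto
    then have "card {i \<in> ?S. \<tau> i \<in> ?T} = card ?T" using card_image[OF inj, of "{i \<in> ?S. \<tau> i \<in> ?T}"] by simp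
    moreover have "{i \<in> ?S. \<tau> i \<in> ?T} = {i \<in> ?T. \<tau> i \<in> ?T} \<union> E" using TS by (auto simp: E_def)
    moreover have "card ({i \<in> ?T. \<tau> i \<in> ?T} \<union> E) = card {i \<in> ?T. \<tau> i \<in> ?T} + card E"
      using fin finE by (intro card_Un_disjoint) (auto simp: E_def)
    ultimately show ?thesis by simp
  qed
  ultimately have EX: "card E = card (exits p \<tau>)" by simp
  have "M = exits p \<tau> \<union> E" using TS by (auto simp: M_def exits_def E_def)
  moreover have "card (exits p \<tau> \<union> E) = card (exits p \<tau>) + card E"
    using finE by (intro card_Un_disjoint) (auto simp: exits_def E_def)
  ultimately have M: "card M = 2 * card (exits p \<tau>)" using EX by simp
  have inv_in: "inv \<tau> i \<in> ?S \<longleftrightarrow> i \<in> ?S" for i using permutes_in_image[OF permutes_inv[OF \<tau>]] .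
  have "{y \<in> ?S \<times> UNIV. (y \<in> ?T \<times> UNIV) \<noteq> (double_pairing (p + q) \<tau> y \<in> ?T \<times> UNIV)}
      = M \<times> {True} \<union> (\<tau> ` M) \<times> {False}" (is "?L = ?R")
  proof (rule set_eqI)
    fix y :: "int \<times> bool"
    obtain i b where y: "y = (i, b)" by (cases y)
    have "i \<in> \<tau> ` M \<longleftrightarrow> inv \<tau> i \<in> M"
    proof
      assume "i \<in> \<tau> ` M"
      then show "inv \<tau> i \<in> M" using permutes_inverses(2)[OF \<tau>] by auto
    next
      assume "inv \<tau> i \<in> M"
      then show "i \<in> \<tau> ` M"
        using permutes_inverses(1)[OF \<tau>, of i] by (intro image_eqI[of _ _ "inv \<tau> i"]) simp_all
    qed
    then show "y \<in> ?L \<longleftrightarrow> y \<in> ?R"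
      using permutes_inverses(1)[OF \<tau>, of i] inv_in[of i]
      by (cases b) (auto simp: y M_def double_pairing_def)
  qed
  moreover have "card (M \<times> {True} \<union> (\<tau> ` M) \<times> {False}) = card (M \<times> {True}) + card ((\<tau> ` M) \<times> {False})"
    using fin by (intro card_Un_disjoint) (auto simp: M_def)
  moreover have "card (\<tau> ` M) = card M" using card_image[OF inj] .
  ultimately show ?thesis using M by (simp add: card_cartesian_product)
qed

lemma double_union: "signed_set p \<times> (UNIV :: bool set) \<union> (signed_set (p + q) - signed_set p) \<times> UNIV = signed_set (p + q) \<times> UNIV"
  by (auto simp: signed_set_def)

lemma card_signed_set: "card (signed_set N) = 2 * N"
proof -
  have "signed_set N = {1..int N} \<union> {- int N..- 1}" by (auto simp: signed_set_def)
  moreover have "card ({1..int N} \<union> {- int N..- 1}) = card {1..int N} + card {- int N..- 1}"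
    by (intro card_Un_disjoint) auto
  ultimately show ?thesis by simp
qed

abbreviation planar_B :: "nat \<Rightarrow> nat \<Rightarrow> nat \<Rightarrow> (int \<times> bool \<Rightarrow> int \<times> bool) set" where
  "planar_B p q \<equiv> planar_pairings double_minus snd (double_cycle (gamma_B p q))
     (signed_set p \<times> UNIV) ((signed_set (p + q) - signed_set p) \<times> UNIV)"

text \<open>The doubled set has \<open>4 N\<close> points, so the condition on the fourth power says that the product of the two fixed spaces has
\<open>3 ^ N\<close> elements, which is \<open>\<tau> \<le> \<gamma>\<close>.\<close>

lemma double_pairing_planar_iff:
  assumes pq: "p \<ge> 1" "q \<ge> 1" and \<tau>: "\<tau> \<in> hyperoctahedral (p + q)"
  shows "double_pairing (p + q) \<tau> \<in> planar_B p q c \<longleftrightarrow> \<tau> \<in> S_nc_B p q \<and> card (exits p \<tau>) = 2 * c"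
proof -
  let ?N = "p + q"
  let ?k = "card (Fix_B ?N \<tau>) * card (Fix_B ?N (inv \<tau> \<circ> gamma_B p q))"
  have D: "card (signed_set ?N \<times> (UNIV :: bool set)) = ?N * 4"
    by (simp add: card_cartesian_product card_signed_set)
  have "?k ^ 4 = 3 ^ (?N * 4) \<longleftrightarrow> ?k = 3 ^ ?N"
    unfolding power_mult by (simp add: power_eq_iff_eq_base)
  then have "?k ^ 4 = 3 ^ (?N * 4) \<longleftrightarrow> le_B ?N \<tau> (gamma_B p q)"
    using le_B_iff_card[OF \<tau> gamma_B_hyperoctahedral[OF pq] Fix_B_gamma_B[OF pq]] by simp
  then show ?thesis
    unfolding planar_pairings_def double_union mem_Collect_eq D
      card_fixed_functions_double[OF \<tau> gamma_B_eq(5)[OF pq]]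
      card_crossings[OF hyperoctahedral_permutes[OF \<tau>]]
    using double_pairing_in[OF \<tau>] \<tau> by (auto simp: S_nc_B_def)
qed

lemma card_S_nc_B_exits:
  assumes pq: "p \<ge> 1" "q \<ge> 1"
  shows "card {\<tau> \<in> S_nc_B p q. card (exits p \<tau>) = 2 * c} = card (planar_B p q c)"
proof (rule bij_betw_same_card)
  let ?d = "double_pairing (p + q)"
  note b = bij_betw_double_pairing[of "p + q"]
  have "?d ` {\<tau> \<in> S_nc_B p q. card (exits p \<tau>) = 2 * c} = planar_B p q c"
  proof
    show "?d ` {\<tau> \<in> S_nc_B p q. card (exits p \<tau>) = 2 * c} \<subseteq> planar_B p q c"
      using double_pairing_planar_iff[OF pq] by (auto simp: S_nc_B_def)
    show "planar_B p q c \<subseteq> ?d ` {\<tau> \<in> S_nc_B p q. card (exits p \<tau>) = 2 * c}"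
    proof
      fix \<sigma> assume s: "\<sigma> \<in> planar_B p q c"
      then have "\<sigma> \<in> pairings double_minus snd (signed_set (p + q) \<times> UNIV)"
        by (simp add: planar_pairings_def double_union)
      then obtain \<tau> where "\<tau> \<in> hyperoctahedral (p + q)" "\<sigma> = ?d \<tau>"
        using b unfolding bij_betw_def by blast
      then show "\<sigma> \<in> ?d ` {\<tau> \<in> S_nc_B p q. card (exits p \<tau>) = 2 * c}"
        using double_pairing_planar_iff[OF pq] s by blast
    qed
  qed
  moreover have "inj_on ?d {\<tau> \<in> S_nc_B p q. card (exits p \<tau>) = 2 * c}"
    using b unfolding bij_betw_def by (elim conjE) (rule inj_on_subset, assumption, auto simp: S_nc_B_def)
  ultimately show "bij_betw ?d {\<tau> \<in> S_nc_B p q. card (exits p \<tau>) = 2 * c} (planar_B p q c)"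
    unfolding bij_betw_def by blast
qed


section \<open>Connectivity and the final count\<close>

lemma even_card_exits:
  assumes "\<tau> \<in> hyperoctahedral N" shows "even (card (exits p \<tau>))"
proof -
  let ?A = "{i \<in> exits p \<tau>. 0 < i}"
  have fin: "finite (exits p \<tau>)" using finite_signed_set by (simp add: exits_def)
  have m: "- i \<in> exits p \<tau> \<longleftrightarrow> i \<in> exits p \<tau>" for i
    using hyperoctahedral_minus[OF assms, of i] by (simp add: exits_def minus_in_signed_set)
  have nz: "i \<noteq> 0" if "i \<in> exits p \<tau>" for i using that by (auto simp: exits_def signed_set_def)
  have "exits p \<tau> = ?A \<union> uminus ` ?A"
  proof
    show "exits p \<tau> \<subseteq> ?A \<union> uminus ` ?A"
    proof
      fix i assume i: "i \<in> exits p \<tau>"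
      show "i \<in> ?A \<union> uminus ` ?A"
      proof (cases "0 < i")
        case False
        then have "- i \<in> ?A" using i m[of i] nz[OF i] by simp
        then show ?thesis by (intro UnI2 image_eqI[of _ _ "- i"]) simp_all
      qed (use i in simp)
    qed
    show "?A \<union> uminus ` ?A \<subseteq> exits p \<tau>" using m by auto
  qed
  moreover have "card (?A \<union> uminus ` ?A) = card ?A + card (uminus ` ?A)"
    using fin by (intro card_Un_disjoint) auto
  moreover have "card (uminus ` ?A) = card ?A" by (rule card_image) (simp add: inj_on_def)
  ultimately have "card (exits p \<tau>) = 2 * card ?A" by (simp only: mult_2)
  then show ?thesis by simp
qed

lemma orbit_double:
  assumes \<tau>: "\<tau> permutes signed_set N" and i: "i \<in> signed_set N" and j: "j \<in> orbit \<tau> i"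
  shows "j \<in> signed_set N \<and> (j, True) \<in> orbit (double_cycle \<gamma> \<circ> double_pairing N \<tau>) (i, True)"
proof -
  let ?f = "double_cycle \<gamma> \<circ> double_pairing N \<tau>"
  have f: "?f (k, True) = (\<tau> k, True)" if "k \<in> signed_set N" for k
    using that by (simp add: double_cycle_def double_pairing_def)
  show ?thesis
    using j
  proof induction
    case base
    show ?case using orbit.base[of ?f "(i, True)"] unfolding f[OF i] using permutes_in_image[OF \<tau>] i by blast
  next
    case (step k)
    then have k: "k \<in> signed_set N" by blast
    show ?case
      using orbit.step[OF conjunct2[OF step.IH]] unfolding f[OF k] using permutes_in_image[OF \<tau>] k by blast
  qed
qed

text \<open>On the points \<open>(j, True)\<close> the map \<open>\<rho> \<circ> \<sigma>\<close> is \<open>\<tau>\<close>, so this is \<open>orbit_exits_once\<close> for the doubled circles.\<close>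

lemma exits_orbit:
  assumes pq: "p \<ge> 1" "q \<ge> 1" and \<tau>: "\<tau> \<in> S_nc_B p q" and i: "i \<in> exits p \<tau>"
  shows "j \<in> orbit \<tau> i \<Longrightarrow> j \<in> exits p \<tau> \<Longrightarrow> j = i" and "- i \<notin> orbit \<tau> i"
proof -
  have h: "\<tau> \<in> hyperoctahedral (p + q)" using \<tau> by (simp add: S_nc_B_def)
  have per: "\<tau> permutes signed_set (p + q)" using h by (rule hyperoctahedral_permutes)
  obtain c where "card (exits p \<tau>) = 2 * c" using even_card_exits[OF h] by blast
  then have pl: "double_pairing (p + q) \<tau> \<in> planar_B p q c"
    using double_pairing_planar_iff[OF pq h] \<tau> by blast
  have TS: "signed_set p \<subseteq> signed_set (p + q)" by (auto simp: signed_set_def)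
  have e: "(k, True) \<in> signed_set p \<times> UNIV" "double_pairing (p + q) \<tau> (k, True) \<notin> signed_set p \<times> UNIV" "k \<in> signed_set (p + q)"
    if "k \<in> exits p \<tau>" for k
    using that TS by (auto simp: exits_def double_pairing_def)
  note once = orbit_exits_once[OF two_circles_double[OF pq] pl e(1,2)[OF i]]
  note tr = orbit_double[OF per e(3)[OF i], of _ "gamma_B p q"]
  show "j = i" if "j \<in> orbit \<tau> i" "j \<in> exits p \<tau>"
    using conjunct1[OF once] conjunct2[OF tr[OF that(1)]] e(1,2)[OF that(2)] by blast
  show "- i \<notin> orbit \<tau> i"
  proof
    assume "- i \<in> orbit \<tau> i"
    from conjunct2[OF tr[OF this]] show False using conjunct2[OF once] by (simp add: double_minus_def)
  qed
qed

text \<open>An orbit that meets both circles has to leave the first one somewhere, and it does so only once.\<close>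

lemma connectivity_eq:
  assumes pq: "p \<ge> 1" "q \<ge> 1" and \<tau>: "\<tau> \<in> S_nc_B p q"
  shows "connectivity p q (merge_invariant (orbit_partition (p + q) \<tau>)) = real (card (exits p \<tau>)) / 2"
proof -
  let ?P = "orbit_partition (p + q) \<tau>"
  let ?B = "{A \<in> merge_invariant ?P. \<not> inversion_invariant A \<and>
       A \<inter> signed_set p \<noteq> {} \<and> A \<inter> (signed_set (p + q) - signed_set p) \<noteq> {}}"
  have h: "\<tau> \<in> hyperoctahedral (p + q)" using \<tau> by (simp add: S_nc_B_def)
  have per: "\<tau> permutes signed_set (p + q)" using h by (rule hyperoctahedral_permutes)
  have perm: "permutation \<tau>" unfolding permutation_permutes using per finite_signed_set by blast
  have self: "i \<in> orbit \<tau> i" for i by (rule permutation_self_in_orbit[OF perm])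
  have TS: "signed_set p \<subseteq> signed_set (p + q)" by (auto simp: signed_set_def)
  have merged: "A \<in> merge_invariant ?P \<and> \<not> inversion_invariant A \<longleftrightarrow> A \<in> ?P \<and> \<not> inversion_invariant A" for A
  proof -
    have "inversion_invariant (\<Union>{A \<in> ?P. inversion_invariant A})"
      unfolding inversion_invariant_def image_Union by auto
    then show ?thesis unfolding merge_invariant_def by (auto split: if_splits)
  qed
  have "bij_betw (orbit \<tau>) (exits p \<tau>) ?B"
    unfolding bij_betw_def
  proof
    show "inj_on (orbit \<tau>) (exits p \<tau>)"
    proof (rule inj_onI)
      fix i j assume i: "i \<in> exits p \<tau>" and j: "j \<in> exits p \<tau>" and e: "orbit \<tau> i = orbit \<tau> j"
      have "j \<in> orbit \<tau> i" using self[of j] e by simp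
      then show "i = j" using exits_orbit(1)[OF pq \<tau> i _ j] by simp
    qed
    show "orbit \<tau> ` exits p \<tau> = ?B"
    proof
      show "orbit \<tau> ` exits p \<tau> \<subseteq> ?B"
      proof (rule image_subsetI)
        fix i assume i: "i \<in> exits p \<tau>"
        then have iT: "i \<in> signed_set p" "\<tau> i \<notin> signed_set p" by (auto simp: exits_def)
        have "- i \<notin> orbit \<tau> i" by (rule exits_orbit(2)[OF pq \<tau> i])
        then have "\<not> inversion_invariant (orbit \<tau> i)" using self[of i] by (auto simp: inversion_invariant_def)
        moreover have "orbit \<tau> i \<in> ?P" using iT TS by (auto simp: orbit_partition_def)
        moreover have "\<tau> i \<in> orbit \<tau> i" by (rule orbit.base)
        moreover have "\<tau> i \<in> signed_set (p + q)" using iT TS permutes_in_image[OF per] by blast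
        ultimately show "orbit \<tau> i \<in> ?B" using merged iT self[of i] by blast
      qed
      show "?B \<subseteq> orbit \<tau> ` exits p \<tau>"
      proof
        fix A assume "A \<in> ?B"
        then have A: "A \<in> ?P" "A \<inter> signed_set p \<noteq> {}" "A \<inter> (signed_set (p + q) - signed_set p) \<noteq> {}"
          using merged by blast+
        obtain z where z: "A = orbit \<tau> z" using A(1) by (auto simp: orbit_partition_def)
        obtain a b where ab: "a \<in> A" "a \<in> signed_set p" "b \<in> A" "b \<notin> signed_set p" using A(2,3) by blast
        have orb: "A = orbit \<tau> a" if "a \<in> A" for a
        proof -
          have "cyclic_on \<tau> A" unfolding z by (rule cyclic_on_orbit[OF per finite_signed_set])
          then show ?thesis using that unfolding cyclic_on_alldef by blast
        qed
        have "\<exists>i\<in>A. i \<in> exits p \<tau>"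
        proof (rule ccontr)
          assume no: "\<not> (\<exists>i\<in>A. i \<in> exits p \<tau>)"
          have "y \<in> A \<and> y \<in> signed_set p" if "y \<in> orbit \<tau> a" for y
            using that
          proof induction
            case base
            have "\<tau> a \<in> A" using orb[OF ab(1)] orbit.base by metis
            then show ?case using no ab(1,2) by (auto simp: exits_def)
          next
            case (step y)
            then have "\<tau> y \<in> A" using orb[OF ab(1)] orbit.step by metis
            then show ?case using no step.IH by (auto simp: exits_def)
          qed
          then show False using ab(3,4) orb[OF ab(1)] by blast
        qed
        then show "A \<in> orbit \<tau> ` exits p \<tau>" using orb by blast
      qed
    qed
  qed
  then have "card (exits p \<tau>) = card ?B" by (rule bij_betw_same_card)
  then show ?thesis by (simp add: connectivity_def)
qed

lemma symmetric_double:
  fixes T :: "int set"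
  assumes W: "\<And>z. z \<in> W \<Longrightarrow> double_minus z \<in> W" and T: "finite T" "\<And>x. x \<in> T \<Longrightarrow> - x \<in> T \<and> x \<noteq> 0"
  shows "W \<inter> T \<times> UNIV = W \<inter> {x \<in> T. 0 < x} \<times> UNIV \<union> double_minus ` (W \<inter> {x \<in> T. 0 < x} \<times> UNIV)"
    and "card (W \<inter> T \<times> UNIV) = 2 * card (W \<inter> {x \<in> T. 0 < x} \<times> UNIV)"
proof -
  let ?U = "W \<inter> {x \<in> T. 0 < x} \<times> (UNIV :: bool set)"
  have dd: "double_minus (double_minus z) = z" for z by (simp add: double_minus_def)
  show e: "W \<inter> T \<times> UNIV = ?U \<union> double_minus ` ?U"
  proof
    show "W \<inter> T \<times> UNIV \<subseteq> ?U \<union> double_minus ` ?U"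
    proof
      fix z assume z: "z \<in> W \<inter> T \<times> UNIV"
      then have zT: "fst z \<in> T" by auto
      show "z \<in> ?U \<union> double_minus ` ?U"
      proof (cases "0 < fst z")
        case True then show ?thesis using z zT by (auto simp: mem_Times_iff)
      next
        case False
        then have "double_minus z \<in> ?U"
          using z zT W[of z] T(2)[OF zT] by (simp add: mem_Times_iff double_minus_def)
        then show ?thesis using dd[of z] by (intro UnI2 image_eqI[of _ _ "double_minus z"]) simp_all
      qed
    qed
    show "?U \<union> double_minus ` ?U \<subseteq> W \<inter> T \<times> UNIV"
      using W T(2) by (auto simp: mem_Times_iff double_minus_def)
  qed
  have "finite (T \<times> (UNIV :: bool set))" using T(1) by simp
  then have fin: "finite ?U" by (rule rev_finite_subset) auto
  have "card (?U \<union> double_minus ` ?U) = card ?U + card (double_minus ` ?U)"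
  proof (rule card_Un_disjoint)
    show "?U \<inter> double_minus ` ?U = {}" by (auto simp: mem_Times_iff double_minus_def)
  qed (use fin in auto)
  moreover have "card (double_minus ` ?U) = card ?U" by (rule card_image) (metis dd inj_onI)
  ultimately show "card (W \<inter> T \<times> UNIV) = 2 * card ?U" using e by simp
qed

text \<open>A symmetric set is determined by its part with positive first components, which is an arbitrary set of half the size
among \<open>2 p\<close> respectively \<open>2 q\<close> points.\<close>

lemma card_circle_words_double:
  assumes c: "c \<le> p" "c \<le> q"
  shows "card (circle_words double_minus (signed_set p \<times> UNIV) ((signed_set (p + q) - signed_set p) \<times> UNIV) c)
    = ((2 * p) choose (p - c)) * ((2 * q) choose (q - c))"
proof -
  let ?T1 = "signed_set p" and ?T2 = "signed_set (p + q) - signed_set p"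
  let ?P1 = "{x \<in> ?T1. 0 < x} \<times> (UNIV :: bool set)" and ?P2 = "{x \<in> ?T2. 0 < x} \<times> (UNIV :: bool set)"
  let ?Y = "circle_words double_minus (?T1 \<times> UNIV) (?T2 \<times> UNIV) c"
  let ?R1 = "{U. U \<subseteq> ?P1 \<and> card U = p - c}" and ?R2 = "{U. U \<subseteq> ?P2 \<and> card U = q - c}"
  define \<Psi> where "\<Psi> = (\<lambda>(U1, U2). U1 \<union> double_minus ` U1 \<union> (U2 \<union> double_minus ` U2))"
  have dd: "double_minus (double_minus z) = z" for z by (simp add: double_minus_def)
  have T1: "finite ?T1" "\<And>x. x \<in> ?T1 \<Longrightarrow> - x \<in> ?T1 \<and> x \<noteq> 0"
    and T2: "finite ?T2" "\<And>x. x \<in> ?T2 \<Longrightarrow> - x \<in> ?T2 \<and> x \<noteq> 0"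
    using finite_signed_set by (auto simp: minus_in_signed_set) (auto simp: signed_set_def)
  have c1: "card (?T1 \<times> (UNIV :: bool set)) = 4 * p" by (simp add: card_cartesian_product card_signed_set)
  have "card ?T2 = 2 * q"
  proof -
    have "?T1 \<subseteq> signed_set (p + q)" by (auto simp: signed_set_def)
    then show ?thesis by (simp add: card_Diff_subset finite_signed_set card_signed_set)
  qed
  then have c2: "card (?T2 \<times> (UNIV :: bool set)) = 4 * q" by (simp add: card_cartesian_product)
  have "{x \<in> ?T1. 0 < x} = {1..int p}" "{x \<in> ?T2. 0 < x} = {int p + 1..int p + int q}"
    by (auto simp: signed_set_def)
  then have P: "card ?P1 = 2 * p" "card ?P2 = 2 * q" "finite ?P1" "finite ?P2"
    by (simp_all add: card_cartesian_product)
  have sym: "double_minus z \<in> W" if "W \<in> ?Y" "z \<in> W" for W z using that by (simp add: circle_words_def)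
  have Yiff: "W \<in> ?Y \<longleftrightarrow> W \<subseteq> ?T1 \<times> UNIV \<union> ?T2 \<times> UNIV \<and> (\<forall>z\<in>W. double_minus z \<in> W)
      \<and> card (W \<inter> ?P1) = p - c \<and> card (W \<inter> ?P2) = q - c" for W
  proof (cases "\<forall>z\<in>W. double_minus z \<in> W")
    case True
    then have "card (W \<inter> ?T1 \<times> UNIV) = 2 * card (W \<inter> ?P1)" "card (W \<inter> ?T2 \<times> UNIV) = 2 * card (W \<inter> ?P2)"
      using symmetric_double(2)[OF _ T1, of W] symmetric_double(2)[OF _ T2, of W] by blast+
    then have "2 * card (W \<inter> ?T1 \<times> UNIV) + 4 * c = card (?T1 \<times> (UNIV :: bool set)) \<longleftrightarrow> card (W \<inter> ?P1) = p - c"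
      "2 * card (W \<inter> ?T2 \<times> UNIV) + 4 * c = card (?T2 \<times> (UNIV :: bool set)) \<longleftrightarrow> card (W \<inter> ?P2) = q - c"
      unfolding c1 c2 using c by linarith+
    then show ?thesis unfolding circle_words_def by blast
  next
    case False
    then show ?thesis unfolding circle_words_def by blast
  qed
  have "bij_betw (\<lambda>W. (W \<inter> ?P1, W \<inter> ?P2)) ?Y (?R1 \<times> ?R2)"
  proof (rule bij_betw_byWitness[where f' = \<Psi>])
    show "\<forall>W\<in>?Y. \<Psi> (W \<inter> ?P1, W \<inter> ?P2) = W"
    proof
      fix W assume W: "W \<in> ?Y"
      have "W = W \<inter> ?T1 \<times> UNIV \<union> W \<inter> ?T2 \<times> UNIV" using W by (auto simp: circle_words_def)
      then show "\<Psi> (W \<inter> ?P1, W \<inter> ?P2) = W"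
        using symmetric_double(1)[OF sym[OF W] T1] symmetric_double(1)[OF sym[OF W] T2] by (simp add: \<Psi>_def)
    qed
    have restored: "\<Psi> (U1, U2) \<inter> ?P1 = U1 \<and> \<Psi> (U1, U2) \<inter> ?P2 = U2 \<and> \<Psi> (U1, U2) \<subseteq> ?T1 \<times> UNIV \<union> ?T2 \<times> UNIV
        \<and> (\<forall>z\<in>\<Psi> (U1, U2). double_minus z \<in> \<Psi> (U1, U2))"
      if U: "U1 \<subseteq> ?P1" "U2 \<subseteq> ?P2" for U1 U2
    proof (intro conjI)
      have neg: "\<not> 0 < fst z" if "z \<in> double_minus ` U1 \<union> double_minus ` U2" for z
        using that U by (auto simp: double_minus_def)
      show "\<Psi> (U1, U2) \<inter> ?P1 = U1" "\<Psi> (U1, U2) \<inter> ?P2 = U2"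
        using U neg unfolding \<Psi>_def by fastforce+
      show "\<Psi> (U1, U2) \<subseteq> ?T1 \<times> UNIV \<union> ?T2 \<times> UNIV"
        using U T1(2) T2(2) unfolding \<Psi>_def double_minus_def by fastforce
      show "\<forall>z\<in>\<Psi> (U1, U2). double_minus z \<in> \<Psi> (U1, U2)"
        unfolding \<Psi>_def using dd by auto
    qed
    show "\<forall>p\<in>?R1 \<times> ?R2. (\<Psi> p \<inter> ?P1, \<Psi> p \<inter> ?P2) = p" using restored by blast
    show "(\<lambda>W. (W \<inter> ?P1, W \<inter> ?P2)) ` ?Y \<subseteq> ?R1 \<times> ?R2"
    proof (rule image_subsetI)
      fix W assume "W \<in> ?Y"
      then show "(W \<inter> ?P1, W \<inter> ?P2) \<in> ?R1 \<times> ?R2" unfolding Yiff by simp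
    qed
    show "\<Psi> ` (?R1 \<times> ?R2) \<subseteq> ?Y"
    proof (rule image_subsetI)
      fix U assume "U \<in> ?R1 \<times> ?R2"
      then obtain U1 U2 where "U = (U1, U2)" "U1 \<subseteq> ?P1" "U2 \<subseteq> ?P2" "card U1 = p - c" "card U2 = q - c" by blast
      then show "\<Psi> U \<in> ?Y" unfolding Yiff using restored[of U1 U2] by simp
    qed
  qed
  then have "card ?Y = card (?R1 \<times> ?R2)" by (rule bij_betw_same_card)
  also have "\<dots> = card ?R1 * card ?R2" by (rule card_cartesian_product)
  also have "\<dots> = ((2 * p) choose (p - c)) * ((2 * q) choose (q - c))"
    by (simp only: n_subsets[OF P(3)] n_subsets[OF P(4)] P(1,2))
  finally show ?thesis .
qed

lemma card_NC_B_connectivity: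
  assumes pq: "p \<ge> 1" "q \<ge> 1" and c: "c \<le> p" "c \<le> q"
  shows "card {P \<in> NC_B p q. connectivity p q P = real c}
    = rotations c * (((2 * p) choose (p - c)) * ((2 * q) choose (q - c)))"
proof -
  let ?f = "\<lambda>\<tau>. merge_invariant (orbit_partition (p + q) \<tau>)"
  have "connectivity p q (?f \<tau>) = real c \<longleftrightarrow> card (exits p \<tau>) = 2 * c" if "\<tau> \<in> S_nc_B p q" for \<tau>
    unfolding connectivity_eq[OF pq that] by linarith
  then have "{P \<in> NC_B p q. connectivity p q P = real c} = ?f ` {\<tau> \<in> S_nc_B p q. card (exits p \<tau>) = 2 * c}"
    unfolding NC_B_def by blast
  moreover have "inj_on ?f {\<tau> \<in> S_nc_B p q. card (exits p \<tau>) = 2 * c}"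
    using inj_on_merged_partition[OF gamma_B_hyperoctahedral[OF pq] Fix_B_gamma_B[OF pq]]
    by (rule inj_on_subset) (auto simp: S_nc_B_def)
  ultimately have "card {P \<in> NC_B p q. connectivity p q P = real c} = card {\<tau> \<in> S_nc_B p q. card (exits p \<tau>) = 2 * c}"
    by (simp only: card_image)
  then show ?thesis
    unfolding card_S_nc_B_exits[OF pq] card_planar_pairings[OF two_circles_double[OF pq]]
      card_circle_words_double[OF c] .
qed

lemma card_exits_le:
  assumes \<tau>: "\<tau> \<in> hyperoctahedral (p + q)"
  shows "card (exits p \<tau>) \<le> 2 * p" "card (exits p \<tau>) \<le> 2 * q"
proof -
  let ?S = "signed_set (p + q)" and ?T = "signed_set p"
  have per: "\<tau> permutes ?S" using \<tau> by (rule hyperoctahedral_permutes)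
  have TS: "?T \<subseteq> ?S" by (auto simp: signed_set_def)
  have "exits p \<tau> \<subseteq> ?T" by (auto simp: exits_def)
  then show "card (exits p \<tau>) \<le> 2 * p"
    using card_mono[OF finite_signed_set, of "exits p \<tau>" p] by (simp add: card_signed_set)
  have "\<tau> ` exits p \<tau> \<subseteq> ?S - ?T" using permutes_in_image[OF per] TS by (auto simp: exits_def)
  then have "card (exits p \<tau>) \<le> card (?S - ?T)"
    using permutes_inj[OF per] finite_signed_set by (intro card_inj_on_le[of \<tau>]) (auto intro: inj_on_subset)
  then show "card (exits p \<tau>) \<le> 2 * q"
    using TS by (simp add: card_Diff_subset finite_signed_set card_signed_set)
qed

text \<open>With \<open>a c = 2 p choose (p - c)\<close> and \<open>b c = 2 q choose (q - c)\<close>, the quantity \<open>(p - c) (q - c) a c b c\<close> equals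
\<open>(p + c + 1) (q + c + 1) a (c + 1) b (c + 1)\<close>, so that the sum telescopes.\<close>

lemma sum_connectivities:
  fixes p q :: nat
  assumes pq: "p \<ge> 1" "q \<ge> 1" and k: "k \<le> p" "k \<le> q"
  shows "real (p + q) * (\<Sum>c=1..k. 2 * real c * real ((2 * p) choose (p - c)) * real ((2 * q) choose (q - c)))
    = real (p * q) * real ((2 * p) choose p) * real ((2 * q) choose q)
      - real ((p - k) * (q - k)) * real ((2 * p) choose (p - k)) * real ((2 * q) choose (q - k))"
  using k
proof (induction k)
  case 0
  then show ?case by simp
next
  case (Suc k)
  have absorb: "real (m - k) * real ((2 * m) choose (m - k)) = real (m + Suc k) * real ((2 * m) choose (m - Suc k))"
    if "Suc k \<le> m" for m
  proof -
    have s: "m - k = Suc (m - Suc k)" using that by simp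
    have "(m - k) * ((2 * m) choose (m - k)) = (2 * m - (m - Suc k)) * ((2 * m) choose (m - Suc k))"
      unfolding s binomial_absorb_comp using times_binomial_minus1_eq[of "Suc (m - Suc k)" "2 * m"] by simp
    moreover have "2 * m - (m - Suc k) = m + Suc k" using that by simp
    ultimately show ?thesis by (metis of_nat_mult)
  qed
  let ?a = "real ((2 * p) choose (p - Suc k))" and ?b = "real ((2 * q) choose (q - Suc k))"
  have "real ((p - k) * (q - k)) * real ((2 * p) choose (p - k)) * real ((2 * q) choose (q - k))
      = (real (p - k) * real ((2 * p) choose (p - k))) * (real (q - k) * real ((2 * q) choose (q - k)))"
    by simp
  also have "\<dots> = (real (p + Suc k) * ?a) * (real (q + Suc k) * ?b)"
    using absorb[of p] absorb[of q] Suc.prems by simp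
  finally have G: "real ((p - k) * (q - k)) * real ((2 * p) choose (p - k)) * real ((2 * q) choose (q - k))
      = (real (p + Suc k) * ?a) * (real (q + Suc k) * ?b)" .
  have d: "real (p - Suc k) = real p - real (Suc k)" "real (q - Suc k) = real q - real (Suc k)"
    using Suc.prems by (simp_all add: of_nat_diff)
  have IH: "real (p + q) * (\<Sum>c=1..k. 2 * real c * real ((2 * p) choose (p - c)) * real ((2 * q) choose (q - c)))
    = real (p * q) * real ((2 * p) choose p) * real ((2 * q) choose q)
      - (real (p + Suc k) * ?a) * (real (q + Suc k) * ?b)"
    using Suc.IH Suc.prems unfolding G by simp
  have "real (p + q) * (\<Sum>c=1..Suc k. 2 * real c * real ((2 * p) choose (p - c)) * real ((2 * q) choose (q - c)))
     = real (p + q) * (\<Sum>c=1..k. 2 * real c * real ((2 * p) choose (p - c)) * real ((2 * q) choose (q - c)))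
       + real (p + q) * (2 * real (Suc k) * ?a * ?b)"
    by (simp add: distrib_left)
  also have "\<dots> = real (p * q) * real ((2 * p) choose p) * real ((2 * q) choose q)
      - (real p - real (Suc k)) * (real q - real (Suc k)) * ?a * ?b"
    unfolding IH unfolding of_nat_add by (simp add: algebra_simps del: of_nat_Suc)
  finally show ?case unfolding of_nat_mult[of "p - Suc k"] d .
qed

theorem theorem4p5:
  fixes p q :: nat
  assumes "p \<ge> 1" and "q \<ge> 1"
  shows "(\<forall>c::nat. 1 \<le> c \<and> c \<le> min p q \<longrightarrow>
            card {P \<in> NC_B p q. connectivity p q P = real c}
              = 2 * c * ((2 * p) choose (p - c)) * ((2 * q) choose (q - c)))
       \<and> card {P \<in> NC_B p q. connectivity p q P = 0}
            = ((2 * p) choose p) * ((2 * q) choose q)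
       \<and> real (card (NC_B p q))
            = real (p + q + p * q) / real (p + q)
              * real ((2 * p) choose p) * real ((2 * q) choose q)"
proof (intro conjI allI impI)
  let ?N = "\<lambda>c. {P \<in> NC_B p q. connectivity p q P = real c}"
  let ?m = "min p q"
  note count = card_NC_B_connectivity[OF assms]
  have pos: "card (?N c) = 2 * c * ((2 * p) choose (p - c)) * ((2 * q) choose (q - c))"
    if "1 \<le> c \<and> c \<le> ?m" for c
    using count[of c] that by (simp add: rotations_def mult.assoc)
  then show "card (?N c) = 2 * c * ((2 * p) choose (p - c)) * ((2 * q) choose (q - c))"
    if "1 \<le> c \<and> c \<le> ?m" for c using that .
  have zero: "card (?N 0) = ((2 * p) choose p) * ((2 * q) choose q)"
    using count[of 0] by (simp add: rotations_def)
  then show "card {P \<in> NC_B p q. connectivity p q P = 0} = ((2 * p) choose p) * ((2 * q) choose q)"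
    by simp
  have "finite {\<tau>. \<tau> permutes signed_set (p + q)}" by (rule finite_permutations[OF finite_signed_set])
  then have "finite (S_nc_B p q)"
    by (rule rev_finite_subset) (auto simp: S_nc_B_def hyperoctahedral_def)
  then have fin: "finite (NC_B p q)" by (simp add: NC_B_def)
  have "\<exists>c\<in>{..?m}. connectivity p q P = real c" if P: "P \<in> NC_B p q" for P
  proof -
    obtain \<tau> where \<tau>: "\<tau> \<in> S_nc_B p q" and e: "P = merge_invariant (orbit_partition (p + q) \<tau>)"
      using P by (auto simp: NC_B_def)
    have h: "\<tau> \<in> hyperoctahedral (p + q)" using \<tau> by (simp add: S_nc_B_def)
    obtain c where c: "card (exits p \<tau>) = 2 * c" using even_card_exits[OF h] by blast
    have "connectivity p q P = real c" unfolding e connectivity_eq[OF assms \<tau>] c by simp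
    moreover have "c \<in> {..?m}" using card_exits_le[OF h] c by simp
    ultimately show ?thesis by blast
  qed
  then have "NC_B p q = (\<Union>c\<in>{..?m}. ?N c)" by blast
  moreover have "card (\<Union>c\<in>{..?m}. ?N c) = (\<Sum>c\<le>?m. card (?N c))"
    using fin by (intro card_UN_disjoint) auto
  ultimately have "card (NC_B p q) = (\<Sum>c\<le>?m. card (?N c))" by simp
  also have "{..?m} = insert 0 {1..?m}" by auto
  also have "(\<Sum>c\<in>insert 0 {1..?m}. card (?N c)) = card (?N 0) + (\<Sum>c=1..?m. card (?N c))" by simp
  also have "(\<Sum>c=1..?m. card (?N c)) = (\<Sum>c=1..?m. 2 * c * ((2 * p) choose (p - c)) * ((2 * q) choose (q - c)))"
    by (rule sum.cong[OF refl]) (use pos in simp)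
  finally have total: "real (card (NC_B p q)) = real ((2 * p) choose p) * real ((2 * q) choose q)
      + (\<Sum>c=1..?m. 2 * real c * real ((2 * p) choose (p - c)) * real ((2 * q) choose (q - c)))"
    unfolding zero by simp
  have "(p - ?m) * (q - ?m) = 0" by (auto simp: min_def)
  then have last: "real ((p - ?m) * (q - ?m)) = 0" by (simp only: of_nat_0)
  have "real (p + q) * (\<Sum>c=1..?m. 2 * real c * real ((2 * p) choose (p - c)) * real ((2 * q) choose (q - c)))
      = real (p * q) * real ((2 * p) choose p) * real ((2 * q) choose q)"
    using sum_connectivities[OF assms, of ?m] unfolding last by simp
  moreover have "real (p + q) \<noteq> 0" using assms by simp
  ultimately show "real (card (NC_B p q)) = real (p + q + p * q) / real (p + q)
      * real ((2 * p) choose p) * real ((2 * q) choose q)"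
    unfolding total by (simp add: field_simps)
qed

end
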